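(* Let $A=(a_{ij})$ be a $d\times n$ integer matrix whose columns span $\mathbf{Z}^d$, let $\beta\in\mathbf{C}^d$, and let $g=(g_1,\ldots,g_d)$ be a tuple of holonomic functions. Then every solution $f$ of the incomplete $\mathcal{A}$-hypergeometric system $H_A(\beta,g)$ is a holonomic function.
   Context: $D$ denotes the Weyl algebra in $n$ variables $x_1,\ldots,x_n$ over $\mathbf{C}$, with $\partial_i=\partial/\partial x_i$; $\bullet$ denotes the action of differential operators on functions. A multi-valued holomorphic function $f$ defined on a Zariski open set in $\mathbf{C}^n$ is called a holonomic function if there exists a left ideal $I$ of $D$ such that (1) $D/I$ is a holonomic $D$-module and (2) $I\bullet f=0$. The incomplete $\mathcal{A}$-hypergeometric system $H_A(\beta,g)$ is the system of differential equations for a (multi-valued holomorphic) function $f$: $$\Big(\sum_{j=1}^n a_{ij}x_j\partial_j-\beta_i\Big)\bullet f=g_i\quad(i=1,\ldots,d),$$ $$\Big(\prod_{i=1}^n\partial_i^{u_i}-\prod_{j=1}^n\partial_j^{v_j}\Big)\bullet f=0\quad\text{for all } u,v\in\mathbf{N}_0^n \text{ with } Au=Av,$$ where $\mathbf{N}_0=\{0,1,2,\ldots\}$ and $g_1,\ldots,g_d$ are given holonomic functions (which may depend on $\beta$). *)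

theory Defs
  imports
    "HOL-Analysis.Analysis"
    "HOL-Library.Poly_Mapping"
    "HOL-Computational_Algebra.Polynomial"
begin

section \<open>The Weyl algebra\<close>

text \<open>
  An element of the Weyl algebra is given by its normal form
  \<open>\<Sum> c\<^bsub>a,b\<^esub> x\<^sup>a \<partial>\<^sup>b\<close>, i.e. by the finitely supported family of its coefficients
  \<open>c\<^bsub>a,b\<^esub>\<close>. The variables are indexed by the finite type \<open>'n\<close>.
\<close>

typedef ('n::finite) weyl = "UNIV :: (((nat^'n) \<times> (nat^'n)) \<Rightarrow>\<^sub>0 complex) set"
  morphisms coeffs Weyl ..

setup_lifting type_definition_weyl

instantiation weyl :: (finite) ab_group_add
begin

lift_definition zero_weyl :: "'a weyl" is 0 .
lift_definition plus_weyl :: "'a weyl \<Rightarrow> 'a weyl \<Rightarrow> 'a weyl" is "(+)" .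
lift_definition uminus_weyl :: "'a weyl \<Rightarrow> 'a weyl" is uminus .
lift_definition minus_weyl :: "'a weyl \<Rightarrow> 'a weyl \<Rightarrow> 'a weyl" is "(-)" .

instance
  by standard (transfer; simp)+

end

definition wcoeff :: "'n::finite weyl \<Rightarrow> nat^'n \<Rightarrow> nat^'n \<Rightarrow> complex"
  where "wcoeff P a b = Poly_Mapping.lookup (coeffs P) (a, b)"

definition wsupp :: "'n::finite weyl \<Rightarrow> ((nat^'n) \<times> (nat^'n)) set"
  where "wsupp P = Poly_Mapping.keys (coeffs P)"

text \<open>\<open>wterm c a b\<close> is \<open>c x\<^sup>a \<partial>\<^sup>b\<close>.\<close>

definition wterm :: "complex \<Rightarrow> nat^'n \<Rightarrow> nat^'n \<Rightarrow> 'n::finite weyl"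
  where "wterm c a b = Weyl (Poly_Mapping.single (a, b) c)"

text \<open>
  The product is the bilinear extension of the Leibniz rule
  \<open>x\<^sup>a \<partial>\<^sup>b \<cdot> x\<^sup>c \<partial>\<^sup>d = \<Sum>\<^bsub>k\<^esub> k! (b choose k) (c choose k) x\<^bsup>a+c-k\<^esup> \<partial>\<^bsup>b+d-k\<^esup>\<close>
  (multi-index notation). Indices \<open>k\<close> with \<open>k \<le> c\<close> failing contribute \<open>0\<close>, so truncated
  subtraction is harmless.
\<close>

definition leibniz_coeff :: "nat^'n \<Rightarrow> nat^'n \<Rightarrow> nat^'n \<Rightarrow> nat"
  where "leibniz_coeff b c k =
    (\<Prod>i\<in>UNIV. fact (k $ i) * ((b $ i) choose (k $ i)) * ((c $ i) choose (k $ i)))"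

instantiation weyl :: (finite) "{one, times}"
begin

definition one_weyl :: "'a weyl"
  where "one_weyl = wterm 1 0 0"

definition times_weyl :: "'a weyl \<Rightarrow> 'a weyl \<Rightarrow> 'a weyl"
  where "times_weyl P Q =
    (\<Sum>(a, b)\<in>wsupp P. \<Sum>(c, d)\<in>wsupp Q. \<Sum>k\<in>{k. \<forall>i. k $ i \<le> b $ i}.
      wterm (wcoeff P a b * wcoeff Q c d * of_nat (leibniz_coeff b c k)) (a + c - k) (b + d - k))"

instance ..

end

text \<open>
  To verify the ring axioms we use the faithful right action on families \<open>s\<close> of
  complex numbers indexed by exponents that is dual to the action on polynomials:
  \<open>(s P)(m) = s(P \<bullet> x\<^sup>m)\<close>, where \<open>s\<close> is extended linearly from monomials to polynomials.
\<close>

definition falling :: "nat^'n \<Rightarrow> nat^'n \<Rightarrow> nat"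
  where "falling m b = (\<Prod>i\<in>UNIV. fact (b $ i) * ((m $ i) choose (b $ i)))"

definition ract :: "'n::finite weyl \<Rightarrow> (nat^'n \<Rightarrow> complex) \<Rightarrow> nat^'n \<Rightarrow> complex"
  where "ract P s m =
    (\<Sum>(a, b)\<in>wsupp P. wcoeff P a b * of_nat (falling m b) * s (m - b + a))"

lemma finite_wsupp [simp]: "finite (wsupp P)"
  by (simp add: wsupp_def)

lemma ract_superset:
  assumes "finite S" "wsupp P \<subseteq> S"
  shows "ract P s m = (\<Sum>(a, b)\<in>S. wcoeff P a b * of_nat (falling m b) * s (m - b + a))"
  unfolding ract_def using assms
  by (intro sum.mono_neutral_left) (auto simp: wsupp_def wcoeff_def in_keys_iff)

lemma wcoeff_add: "wcoeff (P + Q) a b = wcoeff P a b + wcoeff Q a b"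
  by (simp add: wcoeff_def plus_weyl.rep_eq lookup_add)

lemma wcoeff_zero [simp]: "wcoeff 0 a b = 0"
  by (simp add: wcoeff_def zero_weyl.rep_eq)

lemma wsupp_add: "wsupp (P + Q) \<subseteq> wsupp P \<union> wsupp Q"
  by (simp add: wsupp_def plus_weyl.rep_eq keys_add)

lemma ract_add: "ract (P + Q) s m = ract P s m + ract Q s m"
  using ract_superset[OF _ wsupp_add, of P Q s m]
    ract_superset[of "wsupp P \<union> wsupp Q" P s m] ract_superset[of "wsupp P \<union> wsupp Q" Q s m]
  by (simp add: wcoeff_add case_prod_unfold algebra_simps sum.distrib)

lemma ract_zero [simp]: "ract 0 s m = 0"
  by (simp add: ract_def case_prod_unfold)

lemma ract_sum: "ract (\<Sum>x\<in>X. P x) s m = (\<Sum>x\<in>X. ract (P x) s m)"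
  by (induction X rule: infinite_finite_induct) (simp_all add: ract_add)

lemma ract_wterm [simp]: "ract (wterm c a b) s m = c * of_nat (falling m b) * s (m - b + a)"
  by (simp add: ract_def wterm_def wsupp_def wcoeff_def Weyl_inverse)

lemma ract_add_right: "ract P (\<lambda>m. s m + t m) = (\<lambda>m. ract P s m + ract P t m)"
  by (simp add: ract_def fun_eq_iff case_prod_unfold algebra_simps sum.distrib)

lemma ract_inject:
  fixes P :: "'n::finite weyl"
  assumes "\<And>s m. ract P s m = 0"
  shows "P = 0"
proof (rule ccontr)
  assume "P \<noteq> 0"
  hence "coeffs P \<noteq> 0"
    by (metis coeffs_inverse zero_weyl.abs_eq)
  hence ne: "wsupp P \<noteq> {}"
    by (simp add: wsupp_def)
  define h :: "(nat^'n) \<times> (nat^'n) \<Rightarrow> nat" where "h = (\<lambda>p. \<Sum>i\<in>UNIV. snd p $ i)"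
  obtain p where p: "p \<in> wsupp P" "\<And>q. q \<in> wsupp P \<Longrightarrow> h p \<le> h q"
    using ne ex_has_least_nat[of "\<lambda>p. p \<in> wsupp P" _ h] unfolding ex_in_conv[symmetric] by blast
  obtain a0 b0 where ab: "p = (a0, b0)" by (cases p)
  define s :: "nat^'n \<Rightarrow> complex" where "s = (\<lambda>v. if v = a0 then 1 else 0)"
  have eq: "(a, b) = (a0, b0)"
    if ab_in: "(a, b) \<in> wsupp P" and nz: "falling b0 b \<noteq> 0" and idx: "b0 - b + a = a0" for a b
  proof -
    have le: "b $ i \<le> b0 $ i" for i
      using nz by (auto simp: falling_def dest!: spec[of _ i] intro: ccontr)
    have "h (a0, b0) \<le> h (a, b)"
      using p ab ab_in by auto
    hence "b $ i = b0 $ i" for i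
      using le sum_strict_mono_ex1[of UNIV "\<lambda>i. b $ i" "\<lambda>i. b0 $ i"]
      unfolding h_def by (metis UNIV_I finite_code leD le_neq_implies_less snd_conv)
    hence "b = b0" by (simp add: vec_eq_iff)
    thus ?thesis using idx by (simp add: vec_eq_iff)
  qed
  have "ract P s b0 = (\<Sum>q\<in>{p}. case q of (a, b) \<Rightarrow>
      wcoeff P a b * of_nat (falling b0 b) * s (b0 - b + a))"
    unfolding ract_def
    by (rule sum.mono_neutral_right) (use p ab eq in \<open>auto simp: s_def split: if_splits\<close>)
  also have "\<dots> = wcoeff P a0 b0 * of_nat (falling b0 b0)"
    by (simp add: ab s_def vec_eq_iff)
  also have "\<dots> \<noteq> 0"
    using p(1) ab by (simp add: falling_def wcoeff_def wsupp_def in_keys_iff)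
  finally show False using assms by simp
qed

lemma ract_eqI:
  assumes "\<And>s m. ract P s m = ract Q s m"
  shows "P = Q"
proof -
  have "ract (P - Q) s m = 0" for s m
    using ract_add[of "P - Q" Q s m] assms by simp
  thus ?thesis
    using ract_inject[of "P - Q"] by simp
qed

lemma choose_mult_falling:
  "(fact d * (m choose d)) * (fact e * ((m - d) choose e)) = fact (d + e) * (m choose (d + e) :: nat)"
proof (cases "d + e \<le> m")
  case True
  have 1: "fact d * (m choose d) * fact (m - d) = (fact m :: nat)"
    using True binomial_fact_lemma[of d m] by (simp add: ac_simps)
  have 2: "fact e * ((m - d) choose e) * fact (m - d - e) = (fact (m - d) :: nat)"
    using True binomial_fact_lemma[of e "m - d"] by (simp add: ac_simps)
  have 3: "fact (d + e) * (m choose (d + e)) * fact (m - d - e) = (fact m :: nat)"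
    using True binomial_fact_lemma[of "d + e" m] by (simp add: ac_simps)
  have "(fact d * (m choose d)) * (fact e * ((m - d) choose e)) * fact (m - d - e)
      = fact (d + e) * (m choose (d + e)) * (fact (m - d - e) :: nat)"
    using 1 2 3 by (metis mult.assoc)
  thus ?thesis by simp
next
  case False
  hence "m choose (d + e) = 0" "m choose d = 0 \<or> (m - d) choose e = 0"
    by (auto simp: binomial_eq_0_iff)
  thus ?thesis
    by (elim disjE) (simp_all only: mult_zero_left mult_zero_right)
qed

lemma leibniz_1:
  fixes b c m :: nat
  shows "(\<Sum>k\<le>b. fact k * (b choose k) * (c choose k) * (fact (b - k) * (m choose (b - k))))
    = fact b * ((m + c) choose b)"
proof -
  have "(\<Sum>k\<le>b. fact k * (b choose k) * (c choose k) * (fact (b - k) * (m choose (b - k))))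
      = (\<Sum>k\<le>b. fact b * ((c choose k) * (m choose (b - k))))"
  proof (rule sum.cong)
    fix k assume "k \<in> {..b}"
    hence f: "fact k * fact (b - k) * (b choose k) = fact b"
      by (simp add: binomial_fact_lemma)
    show "fact k * (b choose k) * (c choose k) * (fact (b - k) * (m choose (b - k)))
        = fact b * ((c choose k) * (m choose (b - k)))"
      by (simp only: f[symmetric] ac_simps)
  qed simp
  also have "\<dots> = fact b * ((m + c) choose b)"
    by (simp add: vandermonde add.commute flip: sum_distrib_left)
  finally show ?thesis .
qed

lemma bij_betw_le_vec:
  "bij_betw vec_lambda (PiE UNIV (\<lambda>i. {..b $ i})) {k :: nat^'n. \<forall>i. k $ i \<le> b $ i}"
  by (rule bij_betw_byWitness[where f' = vec_nth]) auto

lemma falling_mult_sum: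
  fixes b c d m :: "nat^'n::finite"
  shows "(\<Sum>k\<in>{k. \<forall>i. k $ i \<le> b $ i}. leibniz_coeff b c k * falling m (b + d - k))
    = falling m d * falling (m - d + c) b"
proof -
  have "leibniz_coeff b c k * falling m (b + d - k) =
      (\<Prod>i\<in>UNIV. fact (d $ i) * ((m $ i) choose (d $ i))
        * (fact (k $ i) * ((b $ i) choose (k $ i)) * ((c $ i) choose (k $ i))
        * (fact (b $ i - k $ i) * ((m $ i - d $ i) choose (b $ i - k $ i)))))"
    if k: "\<forall>i. k $ i \<le> b $ i" for k
    unfolding leibniz_coeff_def falling_def prod.distrib[symmetric]
  proof (rule prod.cong)
    fix i
    have "b $ i + d $ i - k $ i = d $ i + (b $ i - k $ i)"
      using k by (simp add: add.commute)
    thus "fact (k $ i) * (b $ i choose k $ i) * (c $ i choose k $ i) *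
        (fact ((b + d - k) $ i) * (m $ i choose (b + d - k) $ i)) =
        fact (d $ i) * (m $ i choose d $ i) *
        (fact (k $ i) * (b $ i choose k $ i) * (c $ i choose k $ i) *
        (fact (b $ i - k $ i) * (m $ i - d $ i choose (b $ i - k $ i))))"
      using choose_mult_falling[of "d $ i" "m $ i" "b $ i - k $ i"]
      by (simp add: ac_simps)
  qed simp
  hence "(\<Sum>k\<in>{k. \<forall>i. k $ i \<le> b $ i}. leibniz_coeff b c k * falling m (b + d - k)) =
      (\<Sum>k\<in>{k. \<forall>i. k $ i \<le> b $ i}. \<Prod>i\<in>UNIV. fact (d $ i) * ((m $ i) choose (d $ i))
        * (fact (k $ i) * ((b $ i) choose (k $ i)) * ((c $ i) choose (k $ i))
        * (fact (b $ i - k $ i) * ((m $ i - d $ i) choose (b $ i - k $ i)))))"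
    by (intro sum.cong) auto
  also have "\<dots> = (\<Sum>k\<in>PiE UNIV (\<lambda>i. {..b $ i}). \<Prod>i\<in>UNIV. fact (d $ i) * ((m $ i) choose (d $ i))
        * (fact (k i) * ((b $ i) choose (k i)) * ((c $ i) choose (k i))
        * (fact (b $ i - k i) * ((m $ i - d $ i) choose (b $ i - k i)))))"
    by (subst sum.reindex_bij_betw[OF bij_betw_le_vec, symmetric]) simp
  also have "\<dots> = (\<Prod>i\<in>UNIV. \<Sum>k\<le>b $ i. fact (d $ i) * ((m $ i) choose (d $ i))
        * (fact k * ((b $ i) choose k) * ((c $ i) choose k)
        * (fact (b $ i - k) * ((m $ i - d $ i) choose (b $ i - k)))))"
    by (rule prod_sum_PiE[symmetric]) auto
  also have "\<dots> = (\<Prod>i\<in>UNIV. fact (d $ i) * ((m $ i) choose (d $ i))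
        * (fact (b $ i) * ((m $ i - d $ i + c $ i) choose (b $ i))))"
    by (simp only: sum_distrib_left[symmetric] leibniz_1)
  finally show ?thesis
    by (simp add: falling_def prod.distrib)
qed

lemma leibniz_index:
  fixes a b c d k m :: "nat^'n::finite"
  assumes "leibniz_coeff b c k * falling m (b + d - k) \<noteq> 0"
  shows "m - (b + d - k) + (a + c - k) = m - d + c - b + a"
proof -
  have le: "k $ i \<le> b $ i \<and> k $ i \<le> c $ i \<and> b $ i + d $ i - k $ i \<le> m $ i" for i
  proof -
    have "(b $ i) choose (k $ i) \<noteq> 0" "(c $ i) choose (k $ i) \<noteq> 0"
      "(m $ i) choose ((b + d - k) $ i) \<noteq> 0"
      using assms by (auto simp: leibniz_coeff_def falling_def)
    thus ?thesis
      by (metis binomial_eq_0 not_le vector_add_component vector_minus_component)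
  qed
  show ?thesis
    unfolding vec_eq_iff
  proof
    fix i
    show "(m - (b + d - k) + (a + c - k)) $ i = (m - d + c - b + a) $ i"
    proof -
      obtain b' where b': "b $ i = k $ i + b'"
        using le[of i] le_Suc_ex by blast
      obtain c' where c': "c $ i = k $ i + c'"
        using le[of i] le_Suc_ex by blast
      obtain m' where m': "m $ i = b' + d $ i + m'"
        using le[of i] b' le_Suc_ex[of "b' + d $ i" "m $ i"] by auto
      show ?thesis
        by (simp add: b' c' m')
    qed
  qed
qed

lemma ract_mult: "ract (P * Q) s m = ract Q (ract P s) m"
proof -
  have inner: "(\<Sum>k\<in>{k. \<forall>i. k $ i \<le> b $ i}.
      x * of_nat (leibniz_coeff b c k) * of_nat (falling m (b + d - k))
        * s (m - (b + d - k) + (a + c - k)))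
      = x * of_nat (falling m d) * of_nat (falling (m - d + c) b) * s (m - d + c - b + a)"
    (is "?L = ?R") for a b c d x
  proof -
    have "?L = (\<Sum>k\<in>{k. \<forall>i. k $ i \<le> b $ i}.
        x * of_nat (leibniz_coeff b c k * falling m (b + d - k)) * s (m - d + c - b + a))"
    proof (rule sum.cong, goal_cases)
      case (2 k)
      show ?case
        using leibniz_index[of b c k m d a]
        by (cases "leibniz_coeff b c k * falling m (b + d - k) = 0") auto
    qed simp
    also have "\<dots> = x * of_nat (\<Sum>k\<in>{k. \<forall>i. k $ i \<le> b $ i}.
        leibniz_coeff b c k * falling m (b + d - k)) * s (m - d + c - b + a)"
      by (simp only: of_nat_sum sum_distrib_left sum_distrib_right)
    also have "\<dots> = ?R"
      by (simp add: falling_mult_sum)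
    finally show ?thesis .
  qed
  have "ract (P * Q) s m = (\<Sum>(a, b)\<in>wsupp P. \<Sum>(c, d)\<in>wsupp Q.
      wcoeff P a b * wcoeff Q c d * of_nat (falling m d) * of_nat (falling (m - d + c) b)
      * s (m - d + c - b + a))"
    by (simp add: times_weyl_def ract_sum case_prod_unfold inner)
  also have "\<dots> = (\<Sum>(c, d)\<in>wsupp Q. \<Sum>(a, b)\<in>wsupp P.
      wcoeff P a b * wcoeff Q c d * of_nat (falling m d) * of_nat (falling (m - d + c) b)
      * s (m - d + c - b + a))"
    unfolding case_prod_unfold by (rule sum.swap)
  also have "\<dots> = ract Q (ract P s) m"
    by (simp add: ract_def case_prod_unfold sum_distrib_left ac_simps)
  finally show ?thesis .
qed

lemma ract_one [simp]: "ract 1 s = s"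
  by (simp add: one_weyl_def fun_eq_iff falling_def)

instance weyl :: (finite) ring_1
proof
  fix P Q R :: "'a weyl"
  have add: "ract (P + Q) s = (\<lambda>m. ract P s m + ract Q s m)" for P Q :: "'a weyl" and s
    by (simp add: fun_eq_iff ract_add)
  show "P * Q * R = P * (Q * R)"
    by (rule ract_eqI) (simp add: ract_mult[abs_def])
  show "(P + Q) * R = P * R + Q * R"
    by (rule ract_eqI) (simp add: ract_mult ract_add add ract_add_right)
  show "P * (Q + R) = P * Q + P * R"
    by (rule ract_eqI) (simp add: ract_mult ract_add)
  show "1 * P = P" "P * 1 = P"
    by (rule ract_eqI; simp add: ract_mult)+
  show "(0 :: 'a weyl) \<noteq> 1"
  proof
    assume "(0 :: 'a weyl) = 1"
    hence "ract (0 :: 'a weyl) (\<lambda>_. 1) 0 = ract 1 (\<lambda>_. 1) 0" by simp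
    thus False by (simp only: ract_one ract_zero) simp
  qed
qed

definition wconst :: "complex \<Rightarrow> 'n::finite weyl"
  where "wconst c = wterm c 0 0"

definition wx :: "'n \<Rightarrow> 'n::finite weyl"
  where "wx i = wterm 1 (axis i 1) 0"

definition wd :: "'n \<Rightarrow> 'n::finite weyl"
  where "wd i = wterm 1 0 (axis i 1)"

definition wd_pow :: "nat^'n \<Rightarrow> 'n::finite weyl"
  where "wd_pow u = wterm 1 0 u"

definition wscale :: "complex \<Rightarrow> 'n::finite weyl \<Rightarrow> 'n weyl"
  where "wscale c P = wconst c * P"

lemma ract_wconst [simp]: "ract (wconst c) s = (\<lambda>m. c * s m)"
  by (simp add: wconst_def fun_eq_iff falling_def)

lemma ract_scale_right: "ract P (\<lambda>m. c * s m) = (\<lambda>m. c * ract P s m)"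
  by (simp add: ract_def fun_eq_iff case_prod_unfold sum_distrib_left ac_simps)

lemma wconst_central: "wconst c * P = P * wconst c"
  by (rule ract_eqI) (simp add: ract_mult ract_scale_right)

global_interpretation weyl: vector_space "wscale :: complex \<Rightarrow> 'n::finite weyl \<Rightarrow> 'n weyl"
proof
  fix a b :: complex and P Q :: "'n weyl"
  have "wconst (a + b) = wconst a + (wconst b :: 'n weyl)"
    by (rule ract_eqI) (simp add: ract_add algebra_simps)
  thus "wscale (a + b) P = wscale a P + wscale b P"
    by (simp add: wscale_def distrib_right)
  have "wconst (a * b) = wconst a * (wconst b :: 'n weyl)"
    by (rule ract_eqI) (simp add: ract_mult ac_simps)
  thus "wscale a (wscale b P) = wscale (a * b) P"
    by (simp add: wscale_def mult.assoc)
  show "wscale a (P + Q) = wscale a P + wscale a Q"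
    by (simp add: wscale_def distrib_left)
  have "wconst 1 = (1 :: 'n weyl)"
    by (simp add: wconst_def one_weyl_def)
  thus "wscale 1 P = P"
    by (simp add: wscale_def)
qed

lemma falling_axis: "falling m (axis i 1) = m $ i"
proof -
  have "falling m (axis i 1) = (\<Prod>j\<in>UNIV. if j = i then m $ i else 1)"
    unfolding falling_def by (rule prod.cong) (auto simp: axis_def)
  thus ?thesis by simp
qed

lemma ract_wx [simp]: "ract (wx i) s m = s (m + axis i 1)"
  by (simp add: wx_def falling_def)

lemma ract_wd [simp]: "ract (wd i) s m = of_nat (m $ i) * s (m - axis i 1)"
  by (simp only: wd_def ract_wterm falling_axis) simp

lemma weyl_relations:
  "wx i * wx j = wx j * wx i"
  "wd i * wd j = wd j * wd i"
  "wd i * wx j = wx j * wd i + (if i = j then 1 else 0)"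
proof -
  show "wx i * wx j = wx j * wx i"
    by (rule ract_eqI) (simp add: ract_mult ac_simps)
  show "wd i * wd j = wd j * wd i"
  proof (cases "i = j")
    case False
    have "m - axis i 1 - axis j 1 = m - axis j 1 - axis i (1 :: nat)" for m
      by (simp add: vec_eq_iff add.commute)
    thus ?thesis
      using False by (intro ract_eqI) (simp add: ract_mult axis_def)
  qed simp
  show "wd i * wx j = wx j * wd i + (if i = j then 1 else 0)"
  proof (rule ract_eqI, goal_cases)
    case (1 s m)
    have eq: "of_nat (m $ i) * s (m + axis j 1 - axis i 1) = of_nat (m $ i) * s (m - axis i 1 + axis j 1)"
    proof (cases "m $ i = 0")
      case False
      hence "m + axis j 1 - axis i 1 = m - axis i 1 + axis j 1"
        by (auto simp: vec_eq_iff axis_def)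
      thus ?thesis by simp
    qed simp
    have lhs: "ract (wd i * wx j) s m
        = of_nat ((m + axis j 1) $ i) * s (m + axis j 1 - axis i 1)"
      by (simp only: ract_mult ract_wx ract_wd)
    have rhs: "ract (wx j * wd i) s m = of_nat (m $ i) * s (m - axis i 1 + axis j 1)"
      by (simp only: ract_mult ract_wx ract_wd)
    show ?case
    proof (cases "i = j")
      case True
      have idx: "m + axis j 1 - axis i 1 = m" "(m + axis j 1) $ i = m $ i + 1"
        using True by (simp_all add: vec_eq_iff)
      have "ract (wd i * wx j) s m = of_nat (m $ i) * s m + s m"
        unfolding lhs idx by (simp add: distrib_right)
      also have "\<dots> = ract (wx j * wd i + 1) s m"
        using eq by (simp only: ract_add ract_one rhs idx)
      finally show ?thesis
        using True by (simp only: if_True simp_thms)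
    next
      case False
      hence "(m + axis j 1) $ i = m $ i"
        by (simp add: axis_def)
      thus ?thesis
        using eq False by (simp only: lhs rhs if_False add_0_right)
    qed
  qed
qed

section \<open>Holonomic quotients of the Weyl algebra\<close>

definition left_ideal :: "'n::finite weyl set \<Rightarrow> bool"
  where "left_ideal I \<longleftrightarrow>
    0 \<in> I \<and> (\<forall>P\<in>I. \<forall>Q\<in>I. P + Q \<in> I) \<and> (\<forall>P. \<forall>Q\<in>I. P * Q \<in> I)"

text \<open>The \<open>k\<close>-th piece of the Bernstein filtration: the span of all \<open>x\<^sup>a \<partial>\<^sup>b\<close> with \<open>|a| + |b| \<le> k\<close>.\<close>

definition bernstein :: "nat \<Rightarrow> 'n::finite weyl set"
  where "bernstein k = {P. \<forall>(a, b)\<in>wsupp P. (\<Sum>i\<in>UNIV. a $ i) + (\<Sum>i\<in>UNIV. b $ i) \<le> k}"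

text \<open>
  The Hilbert function of \<open>D/I\<close> for the filtration \<open>(F\<^sub>k + I)/I \<cong> F\<^sub>k/(F\<^sub>k \<inter> I)\<close> induced by the
  Bernstein filtration; as \<open>F\<^sub>k\<close> is finite-dimensional, the dimension of the
  quotient is a difference of dimensions.
\<close>

definition hilbert_function :: "'n::finite weyl set \<Rightarrow> nat \<Rightarrow> nat"
  where "hilbert_function I k = weyl.dim (bernstein k :: 'n weyl set) - weyl.dim (bernstein k \<inter> I)"

text \<open>
  Bernstein's definition: a finitely generated \<open>D\<close>-module is holonomic if it is zero or its
  dimension, i.e. the degree of its Hilbert polynomial, is the number \<open>n\<close> of variables.
\<close>

definition holonomic_quotient :: "'n::finite weyl set \<Rightarrow> bool"
  where "holonomic_quotient I \<longleftrightarrow> I = UNIV \<or>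
    (\<exists>p :: real poly. degree p = CARD('n) \<and>
      (\<forall>\<^sub>F k in sequentially. real (hilbert_function I k) = poly p (real k)))"


section \<open>Multi-valued holomorphic functions\<close>

definition monom_eval :: "nat^'n \<Rightarrow> complex^'n \<Rightarrow> complex"
  where "monom_eval a z = (\<Prod>i\<in>UNIV. (z $ i) ^ (a $ i))"

text \<open>Polynomials in the variables indexed by \<open>'n\<close> are the finitely supported families
  \<^typ>\<open>(nat^'n) \<Rightarrow>\<^sub>0 complex\<close>.\<close>

definition mpoly_eval :: "((nat^'n) \<Rightarrow>\<^sub>0 complex) \<Rightarrow> complex^'n \<Rightarrow> complex"
  where "mpoly_eval q z = (\<Sum>a\<in>Poly_Mapping.keys q. Poly_Mapping.lookup q a * monom_eval a z)"

definition zariski_open :: "(complex^'n) set \<Rightarrow> bool"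
  where "zariski_open U \<longleftrightarrow> (\<exists>T. U = - {z. \<forall>q\<in>T. mpoly_eval q z = 0})"

definition complex_differentiable_at :: "(complex^'n \<Rightarrow> complex) \<Rightarrow> complex^'n \<Rightarrow> bool"
  where "complex_differentiable_at \<phi> z \<longleftrightarrow>
    (\<exists>L. (\<phi> has_derivative L) (at z) \<and> (\<forall>c v. L (c *s v) = c * L v))"

text \<open>
  Germs of holomorphic functions at \<open>p\<close> are represented by total functions \<open>\<phi>\<close> that
  are holomorphic on a neighbourhood of \<open>p\<close>, modulo agreement near \<open>p\<close>.
\<close>

definition holomorphic_near :: "complex^'n \<Rightarrow> (complex^'n \<Rightarrow> complex) \<Rightarrow> bool"
  where "holomorphic_near p \<phi> \<longleftrightarrow> (\<forall>\<^sub>F z in nhds p. complex_differentiable_at \<phi> z)"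

definition germ_eq :: "complex^'n \<Rightarrow> (complex^'n \<Rightarrow> complex) \<Rightarrow> (complex^'n \<Rightarrow> complex) \<Rightarrow> bool"
  where "germ_eq p \<phi> \<psi> \<longleftrightarrow> (\<forall>\<^sub>F z in nhds p. \<phi> z = \<psi> z)"

definition continuation_along ::
    "(real \<Rightarrow> complex^'n) \<Rightarrow> (real \<Rightarrow> complex^'n \<Rightarrow> complex) \<Rightarrow> bool"
  where "continuation_along \<gamma> \<Phi> \<longleftrightarrow>
    (\<forall>t\<in>{0..1}. holomorphic_near (\<gamma> t) (\<Phi> t)) \<and>
    (\<forall>t\<in>{0..1}. \<forall>\<^sub>F s in at t within {0..1}. germ_eq (\<gamma> s) (\<Phi> s) (\<Phi> t))"

definition continues_to :: "(complex^'n) set \<Rightarrow> complex^'n \<Rightarrow> (complex^'n \<Rightarrow> complex)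
    \<Rightarrow> complex^'n \<Rightarrow> (complex^'n \<Rightarrow> complex) \<Rightarrow> bool"
  where "continues_to U p \<phi> q \<psi> \<longleftrightarrow>
    (\<exists>\<gamma> \<Phi>. path \<gamma> \<and> path_image \<gamma> \<subseteq> U \<and> pathstart \<gamma> = p \<and> pathfinish \<gamma> = q \<and>
      continuation_along \<gamma> \<Phi> \<and> \<Phi> 0 = \<phi> \<and> \<Phi> 1 = \<psi>)"

text \<open>
  A multi-valued function \<open>F\<close> assigns to each point the set of its branches there, each germ
  being represented by all of its representatives. A multi-valued holomorphic function on \<open>U\<close>
  can be continued along every path in \<open>U\<close>, starting from any branch, and its branches are
  exactly the continuations of any one of them. (Constant paths show that branches are
  holomorphic and that \<open>F p\<close> is closed under \<^term>\<open>germ_eq p\<close>.) Values of \<open>F\<close>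
  outside of \<open>U\<close> are irrelevant.
\<close>

type_synonym 'n multifun = "complex^'n \<Rightarrow> (complex^'n \<Rightarrow> complex) set"

definition multivalued_holomorphic_on :: "(complex^'n) set \<Rightarrow> 'n multifun \<Rightarrow> bool"
  where "multivalued_holomorphic_on U F \<longleftrightarrow>
    U \<noteq> {} \<and> (\<forall>p\<in>U. F p \<noteq> {}) \<and>
    (\<forall>p\<in>U. \<forall>\<phi>\<in>F p.
      (\<forall>\<gamma>. path \<gamma> \<and> path_image \<gamma> \<subseteq> U \<and> pathstart \<gamma> = p \<longrightarrow>
        (\<exists>\<Phi>. continuation_along \<gamma> \<Phi> \<and> \<Phi> 0 = \<phi>)) \<and>
      (\<forall>q\<in>U. F q = {\<psi>. continues_to U p \<phi> q \<psi>}))"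


section \<open>Action of differential operators and holonomic functions\<close>

definition pderiv_var :: "'n \<Rightarrow> (complex^'n \<Rightarrow> complex) \<Rightarrow> complex^'n \<Rightarrow> complex"
  where "pderiv_var i \<phi> z = deriv (\<lambda>t. \<phi> (z + t *s axis i 1)) 0"

text \<open>
  Partial derivatives of holomorphic functions commute, so for those the choice of the order of
  differentiation in \<open>\<partial>\<^sup>b\<close> does not matter.
\<close>

definition var_list :: "'n::finite list"
  where "var_list = (SOME xs. distinct xs \<and> set xs = UNIV)"

definition pderiv_multi :: "nat^'n \<Rightarrow> (complex^'n \<Rightarrow> complex) \<Rightarrow> complex^'n \<Rightarrow> complex"
  where "pderiv_multi b \<phi> = foldr (\<lambda>i. pderiv_var i ^^ (b $ i)) var_list \<phi>"

definition act :: "'n::finite weyl \<Rightarrow> (complex^'n \<Rightarrow> complex) \<Rightarrow> complex^'n \<Rightarrow> complex"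
  where "act P \<phi> z = (\<Sum>(a, b)\<in>wsupp P. wcoeff P a b * monom_eval a z * pderiv_multi b \<phi> z)"

lemma act_wterm: "act (wterm c a b) \<phi> z = c * monom_eval a z * pderiv_multi b \<phi> z"
  by (simp add: act_def wterm_def wsupp_def wcoeff_def Weyl_inverse)

lemma pderiv_multi_zero:
  fixes \<phi> :: "complex^'n::finite \<Rightarrow> complex"
  shows "pderiv_multi 0 \<phi> = \<phi>"
proof -
  have "foldr (\<lambda>i. pderiv_var i ^^ ((0 :: nat^'n) $ i)) xs \<phi> = \<phi>" for xs
    by (induction xs) simp_all
  thus ?thesis by (simp only: pderiv_multi_def)
qed

lemma pderiv_multi_axis:
  fixes \<phi> :: "complex^'n::finite \<Rightarrow> complex"
  shows "pderiv_multi (axis i 1) \<phi> = pderiv_var i \<phi>"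
proof -
  have "\<exists>xs :: 'n list. distinct xs \<and> set xs = UNIV"
    using finite_distinct_list[of "UNIV :: 'n set"] by auto
  from someI_ex[OF this]
  have distinct: "distinct (var_list :: 'n list)" and set: "set (var_list :: 'n list) = UNIV"
    unfolding var_list_def by blast+
  have "foldr (\<lambda>j. pderiv_var j ^^ (axis i 1 $ j)) xs \<phi> = (if i \<in> set xs then pderiv_var i \<phi> else \<phi>)"
    if "distinct xs" for xs
    using that by (induction xs) (auto simp: axis_def)
  from this[OF distinct] show ?thesis
    by (simp only: pderiv_multi_def set UNIV_I if_True)
qed

lemma act_wx: "act (wx i) \<phi> z = z $ i * \<phi> z"
proof -
  have "monom_eval (axis i 1) z = (\<Prod>j\<in>UNIV. if j = i then z $ i else 1)"
    unfolding monom_eval_def by (rule prod.cong) (auto simp: axis_def)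
  thus ?thesis
    by (simp only: wx_def act_wterm pderiv_multi_zero) simp
qed

lemma act_wd: "act (wd i) \<phi> = pderiv_var i \<phi>"
  unfolding wd_def by (rule ext) (simp only: act_wterm pderiv_multi_axis, simp add: monom_eval_def)

text \<open>The branches of \<open>P \<bullet> F\<close> are the germs \<open>P \<bullet> \<phi>\<close> for the branches \<open>\<phi>\<close> of \<open>F\<close>.\<close>

definition act_multi :: "'n::finite weyl \<Rightarrow> 'n multifun \<Rightarrow> 'n multifun"
  where "act_multi P F p = {\<psi>. \<exists>\<phi>\<in>F p. germ_eq p \<psi> (act P \<phi>)}"

definition multifun_eq_on :: "(complex^'n) set \<Rightarrow> 'n multifun \<Rightarrow> 'n multifun \<Rightarrow> bool"
  where "multifun_eq_on U F G \<longleftrightarrow> (\<forall>p\<in>U. F p = G p)"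

definition zero_multifun :: "'n::finite multifun"
  where "zero_multifun p = {\<psi>. germ_eq p \<psi> (\<lambda>_. 0)}"

definition holonomic_function :: "(complex^'n::finite) set \<Rightarrow> 'n multifun \<Rightarrow> bool"
  where "holonomic_function U F \<longleftrightarrow>
    zariski_open U \<and> multivalued_holomorphic_on U F \<and>
    (\<exists>I. left_ideal I \<and> holonomic_quotient I \<and>
      (\<forall>P\<in>I. multifun_eq_on U (act_multi P F) zero_multifun))"


section \<open>Incomplete A-hypergeometric systems\<close>

definition euler_op :: "int^'n^'d \<Rightarrow> complex^'d \<Rightarrow> 'd \<Rightarrow> 'n::finite weyl"
  where "euler_op A \<beta> i = (\<Sum>j\<in>UNIV. wconst (of_int (A $ i $ j)) * wx j * wd j) - wconst (\<beta> $ i)"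

definition box_op :: "nat^'n \<Rightarrow> nat^'n \<Rightarrow> 'n::finite weyl"
  where "box_op u v = wd_pow u - wd_pow v"

definition nat_vec_to_int :: "nat^'n \<Rightarrow> int^'n"
  where "nat_vec_to_int u = (\<chi> j. int (u $ j))"

text \<open>
  The multi-valued function \<open>f\<close> on \<open>U\<close> solves \<open>H\<^sub>A(\<beta>, g)\<close>, where \<open>g i\<close> is a multi-valued function
  on \<open>V i\<close>; the inhomogeneous equations are imposed where both sides are defined.
\<close>

definition solves_incomplete_hypergeometric ::
    "int^'n^'d \<Rightarrow> complex^'d \<Rightarrow> ('d \<Rightarrow> (complex^'n) set) \<Rightarrow> ('d \<Rightarrow> 'n multifun)
      \<Rightarrow> (complex^'n::finite) set \<Rightarrow> 'n multifun \<Rightarrow> bool"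
  where "solves_incomplete_hypergeometric A \<beta> V g U f \<longleftrightarrow>
    (\<forall>i. multifun_eq_on (U \<inter> V i) (act_multi (euler_op A \<beta> i) f) (g i)) \<and>
    (\<forall>u v. A *v nat_vec_to_int u = A *v nat_vec_to_int v \<longrightarrow>
      multifun_eq_on U (act_multi (box_op u v) f) zero_multifun)"

end

theory Submission
  imports Defs "HOL-Complex_Analysis.Conformal_Mappings"
begin

text \<open>
  Let \<open>I\<close> be the annihilator of \<open>f\<close>, so that \<open>D/I \<cong> D \<bullet> f\<close>. The submodule generated by the
  \<open>(\<theta>\<^sub>i - \<beta>\<^sub>i) \<bullet> f\<close>, where \<open>\<theta>\<^sub>i = \<Sum> a\<^sub>i\<^sub>j x\<^sub>j \<partial>\<^sub>j\<close>, is a sum of quotients of holonomic modules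
  \<open>D/J\<^sub>i\<close> with \<open>J\<^sub>i \<bullet> g\<^sub>i = 0\<close>, and the quotient by it is a quotient of the module of the homogeneous
  A-hypergeometric system. The latter is holonomic: under the relations every monomial
  \<open>x\<^sup>a \<partial>\<^sup>b\<close> reduces to those with \<open>a\<^sub>j = 0\<close> or \<open>b\<^sub>j \<le> M\<close> for each \<open>j\<close>, of which there are only
  \<open>O(k\<^sup>n)\<close> in degree \<open>k\<close>. Growth of order \<open>k\<^sup>n\<close> passes to extensions by a
  Groebner basis argument, and together with Bernstein's inequality and the existence of the
  Hilbert polynomial it gives holonomicity of \<open>D/I\<close>.
\<close>

text \<open>Each \<open>g i\<close> lives on its own Zariski open set \<open>V i\<close>, and its
  Euler equation is given only on \<open>U \<inter> V i\<close>. Two nonempty Zariski open sets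
  meet, and the identity theorem along paths spreads annihilation from one common point to all
  branches of \<open>f\<close>; so an operator \<open>P\<close> killing \<open>g i\<close> yields
  \<open>P * euler_op A \<beta> i\<close> in the annihilator of \<open>f\<close>. The filtration
  that D/I induces on a submodule differs from the one given by a generator of the submodule. A
  Groebner basis for a degree-compatible order bounds the discrepancy by a constant shift of degree.
  A box operator may join derivatives of different orders, so the toric relations need not respect
  the total degree. The reduction of monomials therefore follows a weight that is generic enough to
  single out one term of each box operator in use, and that gives all products x_l d_l the same
  value. The surviving monomials may exceed the degree of the monomial being reduced, which is why
  growth is measured with spanning sets of unrestricted degree.\<close>

declare One_nat_def [simp del] split_paired_All [simp del] split_paired_Ex [simp del]

section \<open>Normal forms in the Weyl algebra\<close>

type_synonym 'n exponent = "(nat^'n) \<times> (nat^'n)"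

abbreviation vsum :: "nat^'n::finite \<Rightarrow> nat"
  where "vsum a \<equiv> (\<Sum>i\<in>UNIV. a $ i)"

definition tdeg :: "'n::finite exponent \<Rightarrow> nat"
  where "tdeg m = vsum (fst m) + vsum (snd m)"

definition wmon :: "'n::finite exponent \<Rightarrow> 'n weyl"
  where "wmon m = wterm 1 (fst m) (snd m)"

definition wcf :: "'n::finite weyl \<Rightarrow> 'n exponent \<Rightarrow> complex"
  where "wcf P m = wcoeff P (fst m) (snd m)"

lemma wcf_eq_lookup: "wcf P m = Poly_Mapping.lookup (coeffs P) m"
  by (simp add: wcf_def wcoeff_def)

lemma wsupp_iff: "m \<in> wsupp P \<longleftrightarrow> wcf P m \<noteq> 0"
  by (simp add: wsupp_def wcf_eq_lookup in_keys_iff)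

lemma weyl_eqI: "(\<And>m. wcf P m = wcf Q m) \<Longrightarrow> P = Q"
  by (metis coeffs_inject poly_mapping_eqI wcf_eq_lookup)

lemma wcf_zero [simp]: "wcf 0 m = 0"
  by (simp add: wcf_def)

lemma wcf_add [simp]: "wcf (P + Q) m = wcf P m + wcf Q m"
  by (simp add: wcf_def wcoeff_add)

lemma wcf_diff [simp]: "wcf (P - Q) m = wcf P m - wcf Q m"
  by (simp add: wcf_eq_lookup minus_weyl.rep_eq lookup_minus)

lemma wcf_sum: "wcf (\<Sum>x\<in>X. P x) m = (\<Sum>x\<in>X. wcf (P x) m)"
  by (induction X rule: infinite_finite_induct) simp_all

lemma wcf_wterm: "wcf (wterm c a b) m = (if m = (a, b) then c else 0)"
  by (auto simp: wcf_eq_lookup wterm_def Weyl_inverse lookup_single)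

lemma wcf_wmon: "wcf (wmon p) m = (if m = p then 1 else 0)"
  by (simp add: wmon_def wcf_wterm)

lemma wsupp_zero [simp]: "wsupp 0 = {}"
  by (auto simp: wsupp_iff)

lemma wsupp_eq_empty [simp]: "wsupp P = {} \<longleftrightarrow> P = 0"
  by (metis (no_types) empty_iff weyl_eqI wcf_zero wsupp_iff wsupp_zero)

lemma wterm_add: "wterm (c + d) a b = wterm c a b + wterm d a b"
  by (rule weyl_eqI) (simp add: wcf_wterm)

lemma wterm_zero [simp]: "wterm 0 a b = 0"
  by (rule weyl_eqI) (simp add: wcf_wterm)

lemma weyl_expansion: "P = (\<Sum>m\<in>wsupp P. wterm (wcf P m) (fst m) (snd m))"
proof (rule weyl_eqI)
  fix p
  have "(\<Sum>m\<in>wsupp P. if p = m then wcf P m else 0) = wcf P p"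
    by (simp add: wsupp_iff)
  thus "wcf P p = wcf (\<Sum>m\<in>wsupp P. wterm (wcf P m) (fst m) (snd m)) p"
    by (simp add: wcf_sum wcf_wterm cong: if_cong)
qed

lemma weyl_induct [case_names zero add wterm]:
  assumes "R 0" "\<And>P Q. R P \<Longrightarrow> R Q \<Longrightarrow> R (P + Q)" "\<And>c a b. R (wterm c a b)"
  shows "R P"
proof -
  have "R (\<Sum>m\<in>M. wterm (wcf P m) (fst m) (snd m))" if "finite M" for M
    using that by induction (auto intro: assms)
  from this[OF finite_wsupp[of P]] show ?thesis
    by (simp flip: weyl_expansion)
qed

section \<open>Products of monomials with the generators\<close>

lemma finite_vec_le: "finite {k :: nat^'n::finite. \<forall>i. k $ i \<le> b $ i}"
proof -
  have "finite (PiE UNIV (\<lambda>i. {..b $ i}))"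
    by (rule finite_PiE) auto
  thus ?thesis
    using bij_betw_finite[OF bij_betw_le_vec] by blast
qed

lemma wterm_mult_wterm:
  "wterm c a b * wterm d a' b' = (\<Sum>k\<in>{k. \<forall>i. k $ i \<le> b $ i}.
      wterm (c * d * of_nat (leibniz_coeff b a' k)) (a + a' - k) (b + b' - k))"
proof -
  have supp: "wsupp (wterm c a b) = (if c = 0 then {} else {(a, b)})" for c a b
    by (auto simp: wsupp_iff wcf_wterm split: if_splits)
  have wcoeff: "wcoeff (wterm c a b) a b = c" for c a b
    using wcf_wterm[of c a b "(a, b)"] by (simp add: wcf_def)
  show ?thesis
  proof (cases "c = 0 \<or> d = 0")
    case True
    thus ?thesis by auto
  next
    case False
    thus ?thesis
      by (subst times_weyl_def) (simp add: supp wcoeff)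
  qed
qed

lemma leibniz_coeff_zero [simp]: "leibniz_coeff b c 0 = 1"
  by (simp add: leibniz_coeff_def)

lemma leibniz_coeff_le: "leibniz_coeff b c k \<noteq> 0 \<Longrightarrow> k $ i \<le> b $ i \<and> k $ i \<le> c $ i"
  by (auto simp: leibniz_coeff_def not_less[symmetric])

text \<open>Cuts the Leibniz sum down to two terms when one of the factors is \<open>wx i\<close> or
  \<open>wd i\<close>.\<close>

lemma le_axis_iff: "(\<forall>j. k $ j \<le> (axis i 1 :: nat^'n) $ j) \<longleftrightarrow> k = 0 \<or> k = axis i 1"
proof
  assume k: "\<forall>j. k $ j \<le> (axis i 1 :: nat^'n) $ j"
  hence 1: "k $ j = 0" if "j \<noteq> i" for j
    using that by (auto simp: axis_def dest!: spec[of _ j])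
  have "k $ i = 0 \<or> k $ i = 1"
    using k by (auto dest!: spec[of _ i])
  thus "k = 0 \<or> k = axis i 1"
  proof
    assume "k $ i = 0"
    hence "k $ j = 0" for j using 1 by (cases "j = i") auto
    thus ?thesis by (simp add: vec_eq_iff)
  next
    assume "k $ i = 1"
    hence "k $ j = axis i 1 $ j" for j using 1 by (cases "j = i") (auto simp: axis_def)
    thus ?thesis by (simp add: vec_eq_iff)
  qed
qed auto

lemma leibniz_coeff_axis:
  assumes "b $ i \<noteq> 0" "c $ i \<noteq> 0"
  shows "leibniz_coeff b c (axis i 1) = b $ i * c $ i"
proof -
  have "leibniz_coeff b c (axis i 1) = (\<Prod>j\<in>UNIV. if j = i then b $ i * c $ i else 1)"
    unfolding leibniz_coeff_def by (rule prod.cong) (auto simp: axis_def binomial_1[unfolded One_nat_def[symmetric]])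
  thus ?thesis by simp
qed

lemma wterm_mult_dpow: "wterm c a b * wterm d 0 b' = wterm (c * d) a (b + b')"
proof -
  have "wterm c a b * wterm d 0 b' = (\<Sum>k\<in>{0}.
      wterm (c * d * of_nat (leibniz_coeff b 0 k)) (a + 0 - k) (b + b' - k))"
    unfolding wterm_mult_wterm
  proof (rule sum.mono_neutral_right)
    show "\<forall>k\<in>{k. \<forall>i. k $ i \<le> b $ i} - {0}.
        wterm (c * d * of_nat (leibniz_coeff b 0 k)) (a + 0 - k) (b + b' - k) = 0"
    proof
      fix k assume "k \<in> {k. \<forall>i. k $ i \<le> b $ i} - {0}"
      hence "leibniz_coeff b 0 k = 0"
        using leibniz_coeff_le[of b 0 k] by (force simp: vec_eq_iff)
      thus "wterm (c * d * of_nat (leibniz_coeff b 0 k)) (a + 0 - k) (b + b' - k) = 0" by simp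
    qed
  qed (auto simp: finite_vec_le)
  thus ?thesis by simp
qed

lemma xpow_mult_wterm: "wterm c a 0 * wterm d a' b' = wterm (c * d) (a + a') b'"
proof -
  have "{k :: nat^'a. \<forall>i. k $ i \<le> 0 $ i} = {0}" by (auto simp: vec_eq_iff)
  thus ?thesis by (simp add: wterm_mult_wterm)
qed

text \<open>Truncated subtraction forces the case split: for \<open>b $ i = 0\<close> the index
  \<open>axis i 1\<close> does not occur in the Leibniz sum, and the second summand vanishes through
  its coefficient.\<close>

lemma wterm_mult_wx: "wterm c a b * wx i = wterm c (a + axis i 1) b + wterm (c * of_nat (b $ i)) a (b - axis i 1)"
proof (cases "b $ i = 0")
  case True
  have "wterm c a b * wx i = (\<Sum>k\<in>{0}.
      wterm (c * 1 * of_nat (leibniz_coeff b (axis i 1) k)) (a + axis i 1 - k) (b + 0 - k))"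
    unfolding wterm_mult_wterm wx_def
  proof (rule sum.mono_neutral_right)
    show "\<forall>k\<in>{k. \<forall>i. k $ i \<le> b $ i} - {0}.
        wterm (c * 1 * of_nat (leibniz_coeff b (axis i 1) k)) (a + axis i 1 - k) (b + 0 - k) = 0"
    proof
      fix k assume k: "k \<in> {k. \<forall>i. k $ i \<le> b $ i} - {0}"
      have "leibniz_coeff b (axis i 1) k = 0"
      proof (rule ccontr)
        assume "leibniz_coeff b (axis i 1) k \<noteq> 0"
        hence "k = 0 \<or> k = axis i 1" "k $ i \<le> b $ i"
          using leibniz_coeff_le le_axis_iff by blast+
        thus False using k True by auto
      qed
      thus "wterm (c * 1 * of_nat (leibniz_coeff b (axis i 1) k)) (a + axis i 1 - k) (b + 0 - k) = 0"
        by simp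
    qed
  qed (auto simp: finite_vec_le)
  thus ?thesis using True by simp
next
  case False
  have "wterm c a b * wx i = (\<Sum>k\<in>{0, axis i 1}.
      wterm (c * 1 * of_nat (leibniz_coeff b (axis i 1) k)) (a + axis i 1 - k) (b + 0 - k))"
    unfolding wterm_mult_wterm wx_def
  proof (rule sum.mono_neutral_right)
    show "\<forall>k\<in>{k. \<forall>i. k $ i \<le> b $ i} - {0, axis i 1}.
        wterm (c * 1 * of_nat (leibniz_coeff b (axis i 1) k)) (a + axis i 1 - k) (b + 0 - k) = 0"
    proof
      fix k assume k: "k \<in> {k. \<forall>i. k $ i \<le> b $ i} - {0, axis i 1}"
      have "leibniz_coeff b (axis i 1) k = 0"
      proof (rule ccontr)
        assume "leibniz_coeff b (axis i 1) k \<noteq> 0"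
        hence "k = 0 \<or> k = axis i 1"
          using leibniz_coeff_le le_axis_iff by blast+
        thus False using k by auto
      qed
      thus "wterm (c * 1 * of_nat (leibniz_coeff b (axis i 1) k)) (a + axis i 1 - k) (b + 0 - k) = 0"
        by simp
    qed
    show "{0, axis i 1} \<subseteq> {k. \<forall>i. k $ i \<le> b $ i}"
      using False by (auto simp: axis_def not_less_eq_eq)
  qed (rule finite_vec_le)
  moreover have "a + axis i 1 - axis i 1 = a" by (simp add: vec_eq_iff)
  ultimately show ?thesis
    using False by (simp add: leibniz_coeff_axis[where c = "axis i 1"])
qed

lemma wd_mult_wterm: "wd i * wterm c a b = wterm c a (b + axis i 1) + wterm (c * of_nat (a $ i)) (a - axis i 1) b"
proof -
  have set: "{k. \<forall>j. k $ j \<le> (axis i 1 :: nat^'a) $ j} = {0, axis i 1}"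
    using le_axis_iff[of _ i] by blast
  have eq: "axis i 1 + b - axis i 1 = b" by (simp add: vec_eq_iff)
  have "wterm (c * of_nat (leibniz_coeff (axis i 1) a (axis i 1))) (a - axis i 1) b
      = wterm (c * of_nat (a $ i)) (a - axis i 1) b"
  proof (cases "a $ i = 0")
    case True
    hence "leibniz_coeff (axis i 1) a (axis i 1) = 0"
      using leibniz_coeff_le[of "axis i 1" a "axis i 1" i] by auto
    thus ?thesis using True by simp
  next
    case False
    thus ?thesis by (subst leibniz_coeff_axis) auto
  qed
  thus ?thesis
    by (simp add: wd_def wterm_mult_wterm set eq add.commute)
qed

lemma wx_mult_wterm: "wx i * wterm c a b = wterm c (a + axis i 1) b"
  by (simp add: wx_def xpow_mult_wterm add.commute)

lemma wterm_mult_wd: "wterm c a b * wd i = wterm c a (b + axis i 1)"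
  by (simp add: wd_def wterm_mult_dpow)

lemma wconst_mult_wterm: "wconst c * wterm d a b = wterm (c * d) a b"
  by (simp add: wconst_def xpow_mult_wterm)

lemma wscale_wterm: "wscale c (wterm d a b) = wterm (c * d) a b"
  by (simp add: wscale_def wconst_mult_wterm)

lemma wcf_wscale [simp]: "wcf (wscale c P) m = c * wcf P m"
proof (induction P rule: weyl_induct)
  case (wterm d a b)
  thus ?case by (simp add: wscale_wterm wcf_wterm)
qed (simp_all add: weyl.scale_right_distrib algebra_simps)

lemma wterm_eq_wscale: "wterm c a b = wscale c (wmon (a, b))"
  by (simp add: wmon_def wscale_wterm)

lemma wscale_mult_left: "wscale c P * Q = wscale c (P * Q)"
  by (simp add: wscale_def mult.assoc)

lemma wscale_mult_right: "P * wscale c Q = wscale c (P * Q)"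
  by (metis mult.assoc wconst_central wscale_def)

text \<open>This is the form in which the Euler operators enter the reduction of monomials: both
  exponents at \<open>j\<close> rise together, up to a multiple of the monomial itself. The
  truncated subtraction in the product with \<open>wx j\<close> does harm only for
  \<open>b $ j = 0\<close>, where the coefficient is zero.\<close>

lemma wterm_mult_theta:
  "wterm c a b * (wx j * wd j)
    = wterm c (a + axis j 1) (b + axis j 1) + wterm (c * of_nat (b $ j)) a b"
proof -
  have "wterm (c * of_nat (b $ j)) a (b - axis j 1 + axis j 1) = wterm (c * of_nat (b $ j)) a b"
  proof (cases "b $ j = 0")
    case False
    hence "b - axis j 1 + axis j 1 = b"
      by (auto simp: vec_eq_iff axis_def)
    thus ?thesis by simp
  qed simp
  thus ?thesis
    by (simp add: wterm_mult_wx distrib_right wterm_mult_wd flip: mult.assoc)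
qed

text \<open>Commuting with x_i acts on normal forms as differentiation with respect to the symbol of
  the i-th derivative. Over the complex numbers the factor \<open>b $ i + 1\<close> is never zero,
  so a vanishing commutator kills every coefficient with a positive exponent there.\<close>

lemma wcf_commutator_wx:
  "wcf (P * wx i - wx i * P) (a, b) = of_nat (b $ i + 1) * wcf P (a, b + axis i 1)"
proof (induction P rule: weyl_induct)
  case (wterm c a' b')
  have "b' $ i \<noteq> 0 \<and> b = b' - axis i 1 \<longleftrightarrow> b' = b + axis i 1"
    by (auto simp: vec_eq_iff axis_def)
  hence "wcf (wterm (c * of_nat (b' $ i)) a' (b' - axis i 1)) (a, b)
      = of_nat (b $ i + 1) * wcf (wterm c a' b') (a, b + axis i 1)"
    by (auto simp: wcf_wterm)
  thus ?case
    by (simp add: wterm_mult_wx wx_mult_wterm)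
qed (simp_all add: algebra_simps)

lemma wcf_commutator_wd:
  "wcf (wd i * P - P * wd i) (a, b) = of_nat (a $ i + 1) * wcf P (a + axis i 1, b)"
proof (induction P rule: weyl_induct)
  case (wterm c a' b')
  have "a' $ i \<noteq> 0 \<and> a = a' - axis i 1 \<longleftrightarrow> a' = a + axis i 1"
    by (auto simp: vec_eq_iff axis_def)
  hence "wcf (wterm (c * of_nat (a' $ i)) (a' - axis i 1) b') (a, b)
      = of_nat (a $ i + 1) * wcf (wterm c a' b') (a + axis i 1, b)"
    by (auto simp: wcf_wterm)
  thus ?case
    by (simp add: wd_mult_wterm wterm_mult_wd)
qed (simp_all add: algebra_simps)

section \<open>The Bernstein filtration\<close>

lemma bernstein_iff: "P \<in> bernstein k \<longleftrightarrow> (\<forall>m\<in>wsupp P. tdeg m \<le> k)"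
  by (auto simp: bernstein_def tdeg_def case_prod_unfold)

lemma bernstein_iff_wcf: "P \<in> bernstein k \<longleftrightarrow> (\<forall>m. wcf P m \<noteq> 0 \<longrightarrow> tdeg m \<le> k)"
  unfolding bernstein_iff Ball_def wsupp_iff by (rule refl)

lemma tdeg_add: "tdeg (p + q) = tdeg p + tdeg q"
  by (simp add: tdeg_def sum.distrib)

lemma tdeg_axis [simp]: "tdeg (a + axis i 1, b) = tdeg (a, b) + 1" "tdeg (a, b + axis i 1) = tdeg (a, b) + 1"
  by (simp_all add: tdeg_def sum.distrib axis_def)

lemma subspace_bernstein: "weyl.subspace (bernstein k)"
  by (auto simp: weyl.subspace_def bernstein_iff_wcf) (metis add_0)

lemma bernstein_mono: "j \<le> k \<Longrightarrow> bernstein j \<subseteq> bernstein k"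
  unfolding subset_iff bernstein_iff by (meson order_trans)

lemma wterm_in_bernstein: "tdeg (a, b) \<le> k \<Longrightarrow> wterm c a b \<in> bernstein k"
  by (auto simp: bernstein_iff_wcf wcf_wterm split: if_splits)

lemma wmon_in_bernstein: "tdeg m \<le> k \<Longrightarrow> wmon m \<in> bernstein k"
  by (simp add: wmon_def wterm_in_bernstein)

lemma exists_bernstein: "\<exists>k. P \<in> bernstein k"
  unfolding bernstein_iff by (intro exI[of _ "\<Sum>m\<in>wsupp P. tdeg m"]) (auto intro: member_le_sum)

lemma vsum_diff_le:
  fixes a k :: "nat^'n::finite"
  shows "vsum (a - k) \<le> vsum a"
  by (rule sum_mono) simp

text \<open>The terms with \<open>k \<noteq> 0\<close> of the Leibniz rule have lower degree.\<close>

lemma wmon_mult_leading: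
  "\<exists>R. wmon m * P = (\<Sum>p\<in>wsupp P. wscale (wcf P p) (wmon (m + p))) + R
    \<and> (\<forall>r\<in>wsupp R. \<exists>p\<in>wsupp P. tdeg r < tdeg m + tdeg p)"
proof -
  define a b where "a = fst m" and "b = snd m"
  define R where "R p = (\<Sum>k\<in>{k. \<forall>i. k $ i \<le> b $ i} - {0}. wterm (wcf P p * of_nat (leibniz_coeff b (fst p) k))
     (a + fst p - k) (b + snd p - k))" for p
  have 1: "wmon m * wterm (wcf P p) (fst p) (snd p) = wscale (wcf P p) (wmon (m + p)) + R p" for p
  proof -
    have "wmon m * wterm (wcf P p) (fst p) (snd p) = wterm (wcf P p * of_nat (leibniz_coeff b (fst p) 0))
     (a + fst p - 0) (b + snd p - 0) + R p"
      unfolding wmon_def a_def[symmetric] b_def[symmetric] wterm_mult_wterm R_def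
      by (subst sum.remove[where x = 0]) (auto simp: finite_vec_le)
    thus ?thesis by (simp add: wterm_eq_wscale a_def b_def plus_prod_def)
  qed
  have 2: "tdeg r < tdeg m + tdeg p" if r: "r \<in> wsupp (R p)" for r p
  proof -
    have "\<exists>k\<in>{k. \<forall>i. k $ i \<le> b $ i} - {0}. wcf (wterm (wcf P p * of_nat (leibniz_coeff b (fst p) k))
     (a + fst p - k) (b + snd p - k)) r \<noteq> 0"
      using r unfolding wsupp_iff R_def wcf_sum by (meson sum.neutral)
    then obtain k where k: "k \<noteq> 0" "\<forall>i. k $ i \<le> b $ i" "leibniz_coeff b (fst p) k \<noteq> 0"
      "r = (a + fst p - k, b + snd p - k)"
      by (auto simp: wcf_wterm split: if_splits)
    obtain i where "k $ i \<noteq> 0"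
      using k(1) by (auto simp: vec_eq_iff)
    have le: "k $ i \<le> b $ i" for i using k by auto
    have "vsum (b + snd p - k) < vsum (b + snd p)"
    proof (rule sum_strict_mono_ex1)
      have "(b + snd p - k) $ i < (b + snd p) $ i"
        using \<open>k $ i \<noteq> 0\<close> le[of i] by simp
      thus "\<exists>i\<in>UNIV. (b + snd p - k) $ i < (b + snd p) $ i" by blast
    qed auto
    moreover have "vsum (a + fst p - k) \<le> vsum (a + fst p)"
      by (rule vsum_diff_le)
    ultimately have "tdeg r < vsum (a + fst p) + vsum (b + snd p)"
      by (simp add: k(4) tdeg_def)
    thus ?thesis by (simp add: tdeg_def a_def b_def sum.distrib)
  qed
  have "wmon m * P = wmon m * (\<Sum>p\<in>wsupp P. wterm (wcf P p) (fst p) (snd p))"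
    by (simp flip: weyl_expansion)
  also have "\<dots> = (\<Sum>p\<in>wsupp P. wscale (wcf P p) (wmon (m + p))) + (\<Sum>p\<in>wsupp P. R p)"
    by (simp add: sum_distrib_left 1 sum.distrib)
  finally have eq: "wmon m * P = \<dots>" .
  have "\<exists>p\<in>wsupp P. tdeg r < tdeg m + tdeg p" if "r \<in> wsupp (\<Sum>p\<in>wsupp P. R p)" for r
  proof -
    have "\<exists>p\<in>wsupp P. wcf (R p) r \<noteq> 0"
      using that unfolding wsupp_iff wcf_sum by (meson sum.neutral)
    thus ?thesis using 2 unfolding wsupp_iff by blast
  qed
  thus ?thesis using eq by blast
qed

lemma wmon_mult_bernstein:
  assumes "P \<in> bernstein k"
  shows "wmon m * P \<in> bernstein (tdeg m + k)"
proof -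
  obtain R where R: "wmon m * P = (\<Sum>p\<in>wsupp P. wscale (wcf P p) (wmon (m + p))) + R"
    "\<forall>r\<in>wsupp R. \<exists>p\<in>wsupp P. tdeg r < tdeg m + tdeg p"
    using wmon_mult_leading by blast
  have "R \<in> bernstein (tdeg m + k)"
    using R(2) assms unfolding bernstein_iff by fastforce
  moreover have "(\<Sum>p\<in>wsupp P. wscale (wcf P p) (wmon (m + p))) \<in> bernstein (tdeg m + k)"
    using assms by (intro weyl.subspace_sum weyl.subspace_scale subspace_bernstein wmon_in_bernstein)
      (auto simp: tdeg_add bernstein_iff)
  ultimately show ?thesis
    using weyl.subspace_add[OF subspace_bernstein] R(1) by metis
qed

lemma weyl_expansion_wmon: "P = (\<Sum>m\<in>wsupp P. wscale (wcf P m) (wmon m))"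
  using weyl_expansion[of P] by (simp add: wterm_eq_wscale)

lemma mult_bernstein:
  assumes "P \<in> bernstein j" "Q \<in> bernstein k"
  shows "P * Q \<in> bernstein (j + k)"
proof -
  have "wmon m * Q \<in> bernstein (j + k)" if "m \<in> wsupp P" for m
    using wmon_mult_bernstein[OF assms(2), of m] bernstein_mono[of "tdeg m + k" "j + k"] that assms(1)
    by (force simp: bernstein_iff)
  moreover have "P * Q = (\<Sum>m\<in>wsupp P. wscale (wcf P m) (wmon m * Q))"
    by (subst weyl_expansion_wmon[of P]) (simp add: sum_distrib_right wscale_mult_left)
  ultimately show ?thesis
    by (metis (no_types, lifting) subspace_bernstein weyl.subspace_scale weyl.subspace_sum)
qed

section \<open>Dickson's lemma\<close>

text \<open>A monotone subsequence that is not increasing is decreasing, and a decreasing sequence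
  of naturals is constant from the index of its least value on.\<close>

lemma monotone_nat_subsequence:
  fixes s :: "nat \<Rightarrow> nat"
  shows "\<exists>r :: nat \<Rightarrow> nat. strict_mono r \<and> (\<forall>i j. i \<le> j \<longrightarrow> s (r i) \<le> s (r j))"
proof -
  obtain r :: "nat \<Rightarrow> nat" where "strict_mono r \<and> monoseq (\<lambda>n. s (r n))"
    using seq_monosub[of s] by (rule exE)
  hence r: "strict_mono r" "monoseq (\<lambda>n. s (r n))"
    by simp_all
  show ?thesis
  proof (cases "\<forall>i j. i \<le> j \<longrightarrow> s (r i) \<le> s (r j)")
    case True
    show ?thesis by (intro exI[of _ r] conjI r(1) True)
  next
    case False
    have "(\<forall>m. \<forall>n\<ge>m. s (r m) \<le> s (r n)) \<or> (\<forall>m. \<forall>n\<ge>m. s (r n) \<le> s (r m))"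
      using r(2) by (simp only: monoseq_def)
    with False have "\<forall>m. \<forall>n\<ge>m. s (r n) \<le> s (r m)"
      by (elim disjE) simp_all
    hence dec: "s (r j) \<le> s (r i)" if "i \<le> j" for i j
      using that by simp
    obtain N where N: "\<And>n. s (r N) \<le> s (r n)"
      using ex_has_least_nat[of "\<lambda>_. True" 0 "\<lambda>n. s (r n)"] by auto
    have "s (r (N + i)) = s (r N)" for i
      using N dec[of N "N + i"] by (simp add: le_antisym)
    moreover have "strict_mono (\<lambda>i. r (N + i))"
      using r(1) by (simp add: strict_mono_def)
    ultimately show ?thesis
      by (intro exI[of _ "\<lambda>i. r (N + i)"]) auto
  qed
qed

text \<open>Refining the sequence for one coordinate preserves monotonicity in the coordinates
  treated before, so finitely many refinements make all coordinates nondecreasing at once.\<close>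

lemma dickson_sequence:
  fixes f :: "nat \<Rightarrow> 'i::finite \<Rightarrow> nat"
  shows "\<exists>i j. i < j \<and> f i \<le> f j"
proof -
  have "\<exists>r :: nat \<Rightarrow> nat. strict_mono r \<and> (\<forall>l\<in>S. \<forall>i j. i \<le> j \<longrightarrow> f (r i) l \<le> f (r j) l)" if "finite S" for S
    using that
  proof induction
    case empty
    show ?case using strict_mono_id by blast
  next
    case (insert l S)
    obtain r :: "nat \<Rightarrow> nat" where "strict_mono r \<and> (\<forall>l\<in>S. \<forall>i j. i \<le> j \<longrightarrow> f (r i) l \<le> f (r j) l)"
      using insert.IH by (rule exE)
    hence r: "strict_mono r" "\<And>l i j. l \<in> S \<Longrightarrow> i \<le> j \<Longrightarrow> f (r i) l \<le> f (r j) l"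
      by simp_all
    obtain q :: "nat \<Rightarrow> nat" where "strict_mono q \<and> (\<forall>i j. i \<le> j \<longrightarrow> f (r (q i)) l \<le> f (r (q j)) l)"
      using monotone_nat_subsequence[of "\<lambda>i. f (r i) l"] by (rule exE)
    hence q: "strict_mono q" "\<And>i j. i \<le> j \<Longrightarrow> f (r (q i)) l \<le> f (r (q j)) l"
      by simp_all
    have "f (r (q i)) l' \<le> f (r (q j)) l'" if "l' \<in> insert l S" "i \<le> j" for l' i j
      using that r(2)[of l' "q i" "q j"] q by (auto simp: strict_mono_less_eq)
    moreover have "strict_mono (\<lambda>i. r (q i))"
      using r(1) q(1) by (simp add: strict_mono_def)
    ultimately show ?case
      by (intro exI[of _ "\<lambda>i. r (q i)"]) simp
  qed
  from this[OF finite[of UNIV]] obtain r :: "nat \<Rightarrow> nat" where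
    "strict_mono r \<and> (\<forall>l\<in>UNIV. \<forall>i j. i \<le> j \<longrightarrow> f (r i) l \<le> f (r j) l)"
    by (rule exE)
  hence "r 0 < r 1 \<and> f (r 0) \<le> f (r 1)"
    by (auto simp: strict_mono_def le_fun_def)
  thus ?thesis by blast
qed

text \<open>The minimal elements of \<open>L\<close> serve as \<open>G\<close>. They form an
  antichain, and an infinite one would contradict the version for sequences; descent on the
  coordinate sum finds a minimal element below any given one.\<close>

lemma dickson:
  fixes L :: "('i::finite \<Rightarrow> nat) set"
  shows "\<exists>G. finite G \<and> G \<subseteq> L \<and> (\<forall>x\<in>L. \<exists>g\<in>G. g \<le> x)"
proof -
  define G where "G = {g\<in>L. \<forall>x\<in>L. x \<le> g \<longrightarrow> x = g}"
  have "finite G"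
  proof (rule ccontr)
    assume "infinite G"
    then obtain f :: "nat \<Rightarrow> 'i \<Rightarrow> nat" where f: "inj f" "range f \<subseteq> G"
      using infinite_countable_subset by blast
    obtain i j where ij: "i < j" "f i \<le> f j"
      using dickson_sequence by blast
    have "f i \<in> G" "f j \<in> G" using f by auto
    hence "f i = f j"
      using ij by (auto simp: G_def)
    thus False using f(1) ij by (auto dest: injD)
  qed
  moreover have "\<exists>g\<in>G. g \<le> x" if "x \<in> L" for x
    using that
  proof (induction "\<Sum>i\<in>UNIV. x i" arbitrary: x rule: less_induct)
    case less
    show ?case
    proof (cases "x \<in> G")
      case False
      then obtain y where y: "y \<in> L" "y \<le> x" "y \<noteq> x"
        using less.prems by (auto simp: G_def)
      then obtain i where "y i < x i"
        by (metis le_fun_def order_le_less ext)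
      hence "(\<Sum>i\<in>UNIV. y i) < (\<Sum>i\<in>UNIV. x i)"
        using y(2) by (intro sum_strict_mono_ex1) (auto simp: le_fun_def)
      thus ?thesis using less.hyps y order_trans by blast
    qed auto
  qed
  ultimately show ?thesis
    unfolding G_def by (intro exI[of _ G]) (auto simp: G_def)
qed

section \<open>A degree-compatible monomial order\<close>

text \<open>The type \<open>'n\<close> carries no order, so the variables receive an arbitrary
  numbering. The numbers serve as exponents of univariate polynomials, both in the monomial order
  and in the choice of a separating weight.\<close>

definition var_index :: "'n::finite \<Rightarrow> nat"
  where "var_index = (SOME f. inj f \<and> range f \<subseteq> {..<CARD('n)})"

lemma var_index: "inj (var_index :: 'n::finite \<Rightarrow> nat)" "var_index (i :: 'n) < CARD('n)"
proof -
  obtain f :: "'n \<Rightarrow> nat" where "bij_betw f UNIV {0..<CARD('n)}"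
    using ex_bij_betw_finite_nat[of "UNIV :: 'n set"] by auto
  hence "\<exists>f :: 'n \<Rightarrow> nat. inj f \<and> range f \<subseteq> {..<CARD('n)}"
    by (intro exI[of _ f]) (auto simp: bij_betw_def)
  from someI_ex[OF this]
  have "inj (var_index :: 'n \<Rightarrow> nat) \<and> range (var_index :: 'n \<Rightarrow> nat) \<subseteq> {..<CARD('n)}"
    unfolding var_index_def .
  thus "inj (var_index :: 'n \<Rightarrow> nat)" "var_index (i :: 'n) < CARD('n)"
    by auto
qed

text \<open>
  Integer polynomials are ordered by the sign of the leading coefficient of the difference, so
  placing the total degree on top of the individual exponents yields an additive order
  in which the total degree is compared first.
\<close>

definition mkey :: "'n::finite exponent \<Rightarrow> int poly"
  where "mkey m = monom (int (tdeg m)) (2 * CARD('n))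
    + (\<Sum>i\<in>UNIV. monom (int (fst m $ i)) (var_index i))
    + (\<Sum>i\<in>UNIV. monom (int (snd m $ i)) (CARD('n) + var_index i))"

lemma mkey_add: "mkey (p + q) = mkey p + mkey q"
  by (simp add: mkey_def tdeg_add sum.distrib add_monom[symmetric])

lemma coeff_mkey:
  fixes m :: "'n::finite exponent"
  shows "coeff (mkey m) (2 * CARD('n)) = int (tdeg m)"
    "coeff (mkey m) (var_index i) = int (fst m $ i)"
    "coeff (mkey m) (CARD('n) + var_index i) = int (snd m $ i)"
    "j > 2 * CARD('n) \<Longrightarrow> coeff (mkey m) j = 0"
proof -
  have lt: "var_index (i :: 'n) < CARD('n)" for i by (rule var_index)
  have ne: "var_index i \<noteq> 2 * CARD('n)" "CARD('n) + var_index i \<noteq> 2 * CARD('n)"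
    "2 * CARD('n) \<noteq> var_index i" "2 * CARD('n) \<noteq> CARD('n) + var_index i" for i :: 'n
    using lt[of i] by auto
  have ne2: "var_index i \<noteq> CARD('n) + var_index j" "CARD('n) + var_index j \<noteq> var_index i" for i j :: 'n
    using lt[of i] by auto
  have inj: "var_index i = var_index j \<longleftrightarrow> i = j" for i j :: 'n
    using var_index(1) by (auto dest: injD)
  show "coeff (mkey m) (2 * CARD('n)) = int (tdeg m)"
    "coeff (mkey m) (var_index i) = int (fst m $ i)"
    "coeff (mkey m) (CARD('n) + var_index i) = int (snd m $ i)"
    by (simp_all add: mkey_def coeff_sum ne ne2 inj)
  assume j: "j > 2 * CARD('n)"
  hence "var_index i \<noteq> j" "CARD('n) + var_index i \<noteq> j" for i :: 'n
    using lt[of i] by auto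
  thus "coeff (mkey m) j = 0"
    using j by (simp add: mkey_def coeff_sum)
qed

lemma mkey_inject [simp]: "mkey p = mkey q \<longleftrightarrow> p = q"
proof
  assume "mkey p = mkey q"
  hence "fst p $ i = fst q $ i" "snd p $ i = snd q $ i" for i
    using coeff_mkey(2,3)[of p i] coeff_mkey(2,3)[of q i] by auto
  thus "p = q" by (auto simp: vec_eq_iff prod_eq_iff)
qed simp

text \<open>The exponent \<open>2 * CARD('n)\<close> lies above all those that hold individual
  variables, so for unequal total degrees it carries the leading coefficient of the
  difference.\<close>

lemma tdeg_less_imp_mkey_less:
  fixes p q :: "'n::finite exponent"
  assumes "tdeg p < tdeg q"
  shows "mkey p < mkey q"
proof -
  have "degree (mkey q - mkey p) \<le> 2 * CARD('n)"
    by (rule degree_le) (auto simp: coeff_mkey)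
  moreover have "coeff (mkey q - mkey p) (2 * CARD('n)) = int (tdeg q) - int (tdeg p)"
    by (simp add: coeff_mkey)
  ultimately have "degree (mkey q - mkey p) = 2 * CARD('n)"
    using assms by (intro antisym le_degree) auto
  hence "pos_poly (mkey q - mkey p)"
    using assms by (simp add: pos_poly_def coeff_mkey)
  thus ?thesis by (simp add: less_poly_def)
qed

lemma mkey_le_imp_tdeg_le: "mkey (p :: 'n::finite exponent) \<le> mkey (q :: 'n exponent) \<Longrightarrow> tdeg p \<le> tdeg q"
  using tdeg_less_imp_mkey_less[of q p] by (meson leD leI)

section \<open>Leading monomials\<close>

text \<open>A relation and not a function, because \<open>0\<close> has no leading monomial.\<close>

definition is_lm :: "'n::finite weyl \<Rightarrow> 'n exponent \<Rightarrow> bool"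
  where "is_lm P p \<longleftrightarrow> p \<in> wsupp P \<and> (\<forall>q\<in>wsupp P. mkey q \<le> mkey p)"

definition lead_monoms :: "'n::finite weyl set \<Rightarrow> 'n exponent set"
  where "lead_monoms I = {m. \<exists>P\<in>I. is_lm P m}"

lemma is_lm_exists:
  assumes "P \<noteq> 0"
  shows "\<exists>p. is_lm P p"
proof -
  have "finite (mkey ` wsupp P)" "mkey ` wsupp P \<noteq> {}"
    using assms by auto
  from Max_in[OF this] obtain p where p: "p \<in> wsupp P" "Max (mkey ` wsupp P) = mkey p"
    by auto
  hence "is_lm P p"
    unfolding is_lm_def by (metis Max_ge \<open>finite (mkey ` wsupp P)\<close> imageI)
  thus ?thesis by blast
qed

lemma is_lm_coeff: "is_lm P p \<Longrightarrow> wcf P p \<noteq> 0"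
  by (simp add: is_lm_def wsupp_iff)

text \<open>The corrections in the Leibniz rule have smaller total degree, which the order compares
  before anything else, so they stay below \<open>m + p\<close>. The other terms cannot cancel each
  other, as adding \<open>m\<close> is injective, and it preserves the order.\<close>

lemma is_lm_mult:
  assumes "is_lm P p"
  shows "is_lm (wmon m * P) (m + p)"
proof -
  obtain R where R: "wmon m * P = (\<Sum>p\<in>wsupp P. wscale (wcf P p) (wmon (m + p))) + R"
    "\<forall>r\<in>wsupp R. \<exists>p\<in>wsupp P. tdeg r < tdeg m + tdeg p"
    using wmon_mult_leading by blast
  have R_small: "mkey r < mkey (m + p)" if r: "r \<in> wsupp R" for r
  proof -
    obtain q where q: "q \<in> wsupp P" "tdeg r < tdeg m + tdeg q"
      using R(2) r by blast
    hence "tdeg q \<le> tdeg p"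
      using assms by (auto simp: is_lm_def intro: mkey_le_imp_tdeg_le)
    thus ?thesis
      using q by (intro tdeg_less_imp_mkey_less) (simp add: tdeg_add)
  qed
  have wcf: "wcf (wmon m * P) r = (\<Sum>q\<in>wsupp P. if r = m + q then wcf P q else 0) + wcf R r" for r
    by (simp add: R(1) wcf_sum wcf_wmon if_distrib cong: if_cong)
  have "wcf R (m + p) = 0"
    using R_small[of "m + p"] by (auto simp: wsupp_iff)
  moreover have "(\<Sum>q\<in>wsupp P. if m + p = m + q then wcf P q else 0) = wcf P p"
    using assms by (simp add: is_lm_def)
  ultimately have "m + p \<in> wsupp (wmon m * P)"
    using is_lm_coeff[OF assms] by (simp add: wsupp_iff wcf)
  moreover have "mkey r \<le> mkey (m + p)" if r: "r \<in> wsupp (wmon m * P)" for r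
  proof (cases "r \<in> wsupp R")
    case True
    thus ?thesis using R_small by (simp add: less_imp_le)
  next
    case False
    hence "(\<Sum>q\<in>wsupp P. if r = m + q then wcf P q else 0) \<noteq> 0"
      using r by (simp add: wsupp_iff wcf)
    hence "\<exists>q\<in>wsupp P. r = m + q"
      by (rule contrapos_np) (intro sum.neutral, simp)
    thus ?thesis
      using assms by (auto simp: is_lm_def mkey_add)
  qed
  ultimately show ?thesis by (simp add: is_lm_def)
qed

lemma left_ideal_subspace: "left_ideal I \<Longrightarrow> weyl.subspace I"
  by (simp add: left_ideal_def weyl.subspace_def wscale_def)

lemma left_ideal_mult: "left_ideal I \<Longrightarrow> Q \<in> I \<Longrightarrow> P * Q \<in> I"
  by (simp add: left_ideal_def)

lemma lead_monoms_add: "left_ideal I \<Longrightarrow> p \<in> lead_monoms I \<Longrightarrow> m + p \<in> lead_monoms I"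
  unfolding lead_monoms_def using is_lm_mult left_ideal_mult by blast

lemma finite_tdeg_le: "finite {m :: 'n::finite exponent. tdeg m \<le> k}"
proof (rule finite_subset)
  show "finite ({a :: nat^'n. \<forall>i. a $ i \<le> (\<chi> i. k) $ i} \<times> {a :: nat^'n. \<forall>i. a $ i \<le> (\<chi> i. k) $ i})"
    by (intro finite_SigmaI finite_vec_le)
  have le: "a $ i \<le> vsum a" for a :: "nat^'n" and i
    by (rule member_le_sum) auto
  have "a $ i \<le> k \<and> b $ i \<le> k" if "tdeg (a, b) \<le> k" for a b :: "nat^'n" and i
    using that le[of a i] le[of b i] by (simp add: tdeg_def)
  thus "{m :: 'n exponent. tdeg m \<le> k}
      \<subseteq> {a. \<forall>i. a $ i \<le> (\<chi> i. k) $ i} \<times> {a. \<forall>i. a $ i \<le> (\<chi> i. k) $ i}"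
    by auto
qed

text \<open>Division by leading monomials never leaves \<open>bernstein k\<close>, which involves
  only finitely many monomials. Counting those below the support thus takes the place of
  well-foundedness of the order.\<close>

lemma bernstein_lead_induct [consumes 1, case_names zero lead]:
  fixes P :: "'n::finite weyl"
  assumes "P \<in> bernstein k" "R 0"
    and lead: "\<And>P p. P \<in> bernstein k \<Longrightarrow> is_lm P p \<Longrightarrow> tdeg p \<le> k \<Longrightarrow>
      (\<And>Q. Q \<in> bernstein k \<Longrightarrow> \<forall>q\<in>wsupp Q. mkey q < mkey p \<Longrightarrow> R Q) \<Longrightarrow> R P"
  shows "R P"
proof -
  define below where "below P = {q :: 'n exponent. tdeg q \<le> k \<and> (\<exists>p\<in>wsupp P. mkey q \<le> mkey p)}" for P :: "'n weyl"
  have fin: "finite (below P)" for P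
    unfolding below_def by (rule finite_subset[OF _ finite_tdeg_le[of k]]) auto
  show ?thesis
    using assms(1)
  proof (induction "card (below P)" arbitrary: P rule: less_induct)
    case less
    show ?case
    proof (cases "P = 0")
      case False
      then obtain p where p: "is_lm P p" using is_lm_exists by blast
      have pk: "tdeg p \<le> k"
        using p less.prems by (auto simp: is_lm_def bernstein_iff)
      show ?thesis
      proof (rule lead[OF less.prems p pk])
        fix Q :: "'n weyl" assume Q: "Q \<in> bernstein k" "\<forall>q\<in>wsupp Q. mkey q < mkey p"
        have "below Q \<subset> below P"
        proof
          show "below Q \<subseteq> below P"
            using Q(2) p unfolding below_def is_lm_def
            by (auto intro!: bexI[of _ p] intro: order.trans less_imp_le)
          have "p \<in> below P" "p \<notin> below Q"
            using p Q(2) pk by (auto simp: below_def is_lm_def dest: leD)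
          thus "below Q \<noteq> below P" by auto
        qed
        thus "R Q"
          by (intro less.hyps Q(1) psubset_card_mono fin)
      qed
    qed (use \<open>R 0\<close> in simp)
  qed
qed

text \<open>The degree of \<open>G\<close> is controlled by the order: it refines the total degree,
  so every monomial of \<open>G\<close> has degree at most \<open>tdeg p\<close>.\<close>

lemma is_lm_cancel:
  assumes P: "P \<in> bernstein k" "is_lm P p" and G: "is_lm G p"
  shows "P - wscale (wcf P p / wcf G p) G \<in> bernstein k"
    "\<forall>q\<in>wsupp (P - wscale (wcf P p / wcf G p) G). mkey q < mkey p"
proof -
  let ?Q = "P - wscale (wcf P p / wcf G p) G"
  have "wcf ?Q p = 0"
    using is_lm_coeff[OF G] by simp
  moreover have le: "mkey q \<le> mkey p" if "q \<in> wsupp ?Q" for q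
    using that P(2) G by (cases "q \<in> wsupp P"; cases "q \<in> wsupp G") (auto simp: is_lm_def wsupp_iff)
  ultimately show "\<forall>q\<in>wsupp ?Q. mkey q < mkey p"
    by (metis mkey_inject order_le_less wsupp_iff)
  have "tdeg p \<le> k"
    using P by (auto simp: is_lm_def bernstein_iff)
  thus "?Q \<in> bernstein k"
    using le mkey_le_imp_tdeg_le unfolding bernstein_iff by (meson order_trans)
qed

text \<open>\<open>G\<close> is a Groebner basis. Each division step uses a multiplier
  \<open>m\<close> with \<open>p = m + e\<close> for the current leading monomial \<open>p\<close>,
  so its degree is at most \<open>k\<close>. For arbitrary generators, terms of high degree could
  cancel and no such bound would follow.\<close>

lemma filtered_generators:
  fixes I :: "'n::finite weyl set"
  assumes I: "left_ideal I"
  shows "\<exists>G. finite G \<and> G \<subseteq> I \<and>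
    (\<forall>k. \<forall>P\<in>I \<inter> bernstein k. \<exists>R. (\<forall>g\<in>G. R g \<in> bernstein k) \<and> P = (\<Sum>g\<in>G. R g * g))"
proof -
  \<comment> \<open>Exponents are viewed as functions on the disjoint sum of two copies of the
    variables, so that Dickson's lemma applies with the pointwise order.\<close>
  define h :: "'n exponent \<Rightarrow> 'n + 'n \<Rightarrow> nat" where
    "h m = case_sum (vec_nth (fst m)) (vec_nth (snd m))" for m
  obtain E where E: "finite E" "E \<subseteq> h ` lead_monoms I" "\<And>x. x \<in> h ` lead_monoms I \<Longrightarrow> \<exists>e\<in>E. e \<le> x"
    using dickson[of "h ` lead_monoms I"] by blast
  have "\<exists>g. g \<in> I \<and> (\<exists>m. is_lm g m \<and> h m = e)" if "e \<in> E" for e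
    using E(2) that unfolding lead_monoms_def by blast
  then obtain g where g: "\<And>e. e \<in> E \<Longrightarrow> g e \<in> I \<and> (\<exists>m. is_lm (g e) m \<and> h m = e)"
    by metis
  define G where "G = g ` E"
  have fin: "finite G" and sub: "G \<subseteq> I"
    using E g by (auto simp: G_def)
  have div: "\<exists>q\<in>G. \<exists>e m. is_lm q e \<and> p = m + e" if p: "p \<in> lead_monoms I" for p
  proof -
    obtain x where x: "x \<in> E" "x \<le> h p" using E(3)[of "h p"] p by blast
    then obtain e where e: "is_lm (g x) e" "h e = x" using g by blast
    have le: "fst e $ i \<le> fst p $ i" "snd e $ i \<le> snd p $ i" for i
      using le_funD[OF x(2), of "Inl i"] le_funD[OF x(2), of "Inr i"]
      by (simp_all add: e(2)[symmetric] h_def)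
    have "p = (fst p - fst e, snd p - snd e) + e"
      using le by (simp add: prod_eq_iff vec_eq_iff)
    thus ?thesis using e x by (auto simp: G_def)
  qed
  have "P \<in> I \<longrightarrow> (\<exists>R. (\<forall>q\<in>G. R q \<in> bernstein k) \<and> P = (\<Sum>q\<in>G. R q * q))"
    if "P \<in> bernstein k" for P k
    using that
  proof (induction rule: bernstein_lead_induct)
    case zero
    show ?case
      by (intro impI exI[of _ "\<lambda>_. 0"]) (simp add: bernstein_iff)
  next
    case (lead P p)
    show ?case
    proof
      assume P: "P \<in> I"
      then obtain q e m where q: "q \<in> G" "is_lm q e" "p = m + e"
        using lead(2) div[of p] unfolding lead_monoms_def by blast
      have lm: "is_lm (wmon m * q) p"
        using is_lm_mult[OF q(2)] q(3) by simp
      define c where "c = wcf P p / wcf (wmon m * q) p"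
      define Q where "Q = P - wscale c (wmon m * q)"
      have "wmon m * q \<in> I"
        using q sub left_ideal_mult[OF I] by blast
      hence "Q \<in> I"
        unfolding Q_def using P left_ideal_subspace[OF I]
        by (intro weyl.subspace_diff weyl.subspace_scale) auto
      moreover have "Q \<in> bernstein k" "\<forall>r\<in>wsupp Q. mkey r < mkey p"
        using is_lm_cancel[OF lead(1,2) lm] by (simp_all add: Q_def c_def)
      ultimately obtain R where R: "\<forall>q\<in>G. R q \<in> bernstein k" "Q = (\<Sum>q\<in>G. R q * q)"
        using lead(4) by blast
      have "tdeg m \<le> k"
        using lead(3) q(3) by (simp add: tdeg_add)
      hence "R q + wscale c (wmon m) \<in> bernstein k"
        using R(1) q(1) by (intro weyl.subspace_add weyl.subspace_scale subspace_bernstein wmon_in_bernstein) auto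
      moreover have "P = (\<Sum>r\<in>G. (R(q := R q + wscale c (wmon m))) r * r)"
      proof -
        have "(\<Sum>r\<in>G. (R(q := R q + wscale c (wmon m))) r * r)
            = (\<Sum>r\<in>G. R r * r + (if r = q then wscale c (wmon m * q) else 0))"
          by (rule sum.cong) (auto simp: distrib_right wscale_mult_left)
        also have "\<dots> = Q + wscale c (wmon m * q)"
          using fin q(1) by (simp add: sum.distrib R(2))
        finally show ?thesis by (simp add: Q_def)
      qed
      ultimately show "\<exists>R. (\<forall>q\<in>G. R q \<in> bernstein k) \<and> P = (\<Sum>q\<in>G. R q * q)"
        using R(1) by (intro exI[of _ "R(q := R q + wscale c (wmon m))"]) auto
    qed
  qed
  thus ?thesis using fin sub by blast
qed

section \<open>Standard monomials and the Hilbert function\<close>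

definition std_monoms :: "'n::finite weyl set \<Rightarrow> nat \<Rightarrow> 'n exponent set"
  where "std_monoms I k = {m. tdeg m \<le> k \<and> m \<notin> lead_monoms I}"

lemma finite_std_monoms: "finite (std_monoms I k)"
  unfolding std_monoms_def by (rule finite_subset[OF _ finite_tdeg_le[of k]]) auto

lemma inj_wmon: "inj wmon"
  by (rule injI) (metis wcf_wmon zero_neq_one)

lemma wsupp_span_wmon: "P \<in> weyl.span (wmon ` X) \<Longrightarrow> wsupp P \<subseteq> X"
proof (induction rule: weyl.span_induct_alt)
  case (step c x y)
  thus ?case by (auto simp: wsupp_iff wcf_wmon split: if_splits)
qed simp

lemma in_span_wmon: "wsupp P \<subseteq> X \<Longrightarrow> P \<in> weyl.span (wmon ` X)"
  by (subst weyl_expansion_wmon, rule weyl.span_sum, rule weyl.span_scale, rule weyl.span_base) auto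

lemma independent_wmon: "weyl.independent (wmon ` X)"
  unfolding weyl.dependent_def
proof clarify
  fix m assume "m \<in> X" "wmon m \<in> weyl.span (wmon ` X - {wmon m})"
  hence "wmon m \<in> weyl.span (wmon ` (X - {m}))"
    by (metis image_insert image_set_diff inj_wmon image_empty)
  hence "wsupp (wmon m) \<subseteq> X - {m}" by (rule wsupp_span_wmon)
  moreover have "m \<in> wsupp (wmon m)" by (simp add: wsupp_iff wcf_wmon)
  ultimately show False by blast
qed

text \<open>Division with remainder: a leading monomial from \<open>lead_monoms I\<close> is
  cancelled by an element of \<open>I\<close>, any other one is moved into the remainder
  \<open>S\<close>.\<close>

lemma std_reduction:
  assumes I: "left_ideal I" and "P \<in> bernstein k"
  shows "\<exists>S \<in> weyl.span (wmon ` std_monoms I k). P - S \<in> I"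
  using assms(2)
proof (induction rule: bernstein_lead_induct)
  case zero
  show ?case
    using I by (intro bexI[of _ 0]) (auto simp: left_ideal_def weyl.span_zero)
next
  case (lead P p)
  note sub = left_ideal_subspace[OF I]
  show ?case
  proof (cases "p \<in> lead_monoms I")
    case True
    then obtain G where G: "G \<in> I" "is_lm G p" by (auto simp: lead_monoms_def)
    obtain S where S: "S \<in> weyl.span (wmon ` std_monoms I k)" "P - wscale (wcf P p / wcf G p) G - S \<in> I"
      using lead(4) is_lm_cancel[OF lead(1,2) G(2)] by blast
    have "P - wscale (wcf P p / wcf G p) G - S + wscale (wcf P p / wcf G p) G \<in> I"
      by (intro weyl.subspace_add[OF sub] weyl.subspace_scale[OF sub] S G)
    hence "P - S \<in> I" by (simp add: algebra_simps)
    thus ?thesis using S by blast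
  next
    case False
    have lm: "is_lm (wmon p) p"
      unfolding is_lm_def Ball_def wsupp_iff wcf_wmon by simp
    let ?c = "wcf P p / wcf (wmon p) p"
    obtain S where S: "S \<in> weyl.span (wmon ` std_monoms I k)" "P - wscale ?c (wmon p) - S \<in> I"
      using lead(4) is_lm_cancel[OF lead(1,2) lm] by blast
    have "wscale ?c (wmon p) + S \<in> weyl.span (wmon ` std_monoms I k)"
      by (rule weyl.span_add, rule weyl.span_scale, rule weyl.span_base)
        (use False lead(3) S in \<open>auto simp: std_monoms_def\<close>)
    thus ?thesis
      using S(2) by (intro bexI[of _ "wscale ?c (wmon p) + S"]) (auto simp: algebra_simps)
  qed
qed

lemma std_independent_mod:
  assumes "S \<in> weyl.span (wmon ` std_monoms I k)" "S \<in> I"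
  shows "S = 0"
proof (rule ccontr)
  assume "S \<noteq> 0"
  then obtain p where p: "is_lm S p" using is_lm_exists by blast
  hence "p \<in> std_monoms I k"
    using wsupp_span_wmon[OF assms(1)] by (auto simp: is_lm_def)
  thus False
    using p assms(2) by (auto simp: std_monoms_def lead_monoms_def)
qed

lemma bernstein_eq_span: "bernstein k = weyl.span (wmon ` {m. tdeg m \<le> k})"
  using wsupp_span_wmon in_span_wmon unfolding bernstein_iff set_eq_iff subset_iff
  by (metis (mono_tags, lifting) mem_Collect_eq bernstein_iff)

text \<open>Macaulay's principle: a basis of \<open>bernstein k \<inter> I\<close> and the standard
  monomials together form a basis of \<open>bernstein k\<close>. Independence holds because a
  combination of standard monomials in \<open>I\<close> is zero, spanning by division with
  remainder.\<close>

lemma hilbert_function_eq_card: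
  fixes I :: "'n::finite weyl set"
  assumes I: "left_ideal I"
  shows "hilbert_function I k = card (std_monoms I k)"
proof -
  let ?F = "bernstein k :: 'n weyl set" and ?W = "wmon ` std_monoms I k"
  obtain B where B: "B \<subseteq> ?F \<inter> I" "weyl.independent B" "?F \<inter> I \<subseteq> weyl.span B"
    "card B = weyl.dim (?F \<inter> I)"
    using weyl.basis_exists by blast
  have finB: "finite B"
    using weyl.independent_span_bound[OF _ B(2), of "wmon ` {m. tdeg m \<le> k}"] B(1)
    by (auto simp: finite_tdeg_le bernstein_eq_span)
  have spanB: "weyl.span B \<subseteq> I"
    using B(1) by (intro weyl.span_minimal left_ideal_subspace I) auto
  have finW: "finite ?W" by (simp add: finite_std_monoms)
  have indW: "weyl.independent ?W" by (rule independent_wmon)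
  have W_sub: "?W \<subseteq> ?F"
    by (auto simp: std_monoms_def intro: wmon_in_bernstein)
  have inter: "x = 0" if "x \<in> weyl.span B" "x \<in> weyl.span ?W" for x
    using that spanB std_independent_mod by blast
  have disj: "B \<inter> ?W = {}"
    using inter B(2) weyl.dependent_zero by (metis disjoint_iff weyl.span_base)
  have "weyl.independent (B \<union> ?W)"
  proof
    assume "weyl.dependent (B \<union> ?W)"
    then obtain u v where u: "v \<in> B \<union> ?W" "u v \<noteq> 0" "(\<Sum>v\<in>B \<union> ?W. wscale (u v) v) = 0"
      using weyl.dependent_finite[of "B \<union> ?W"] finB finW by auto
    have eq: "(\<Sum>v\<in>B. wscale (u v) v) = - (\<Sum>v\<in>?W. wscale (u v) v)"
      using u(3) by (simp add: sum.union_disjoint[OF finB finW disj] add_eq_0_iff2)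
    have 1: "(\<Sum>v\<in>B. wscale (u v) v) \<in> weyl.span B"
      by (intro weyl.span_sum weyl.span_scale weyl.span_base)
    have 2: "(\<Sum>v\<in>?W. wscale (u v) v) \<in> weyl.span ?W"
      by (intro weyl.span_sum weyl.span_scale weyl.span_base)
    have "(\<Sum>v\<in>B. wscale (u v) v) = 0"
      using inter 1 weyl.span_neg[OF 2] eq by metis
    moreover from this have "(\<Sum>v\<in>?W. wscale (u v) v) = 0"
      using eq by simp
    ultimately show False
      using u(1,2) B(2) indW weyl.dependent_finite[OF finB] weyl.dependent_finite[OF finW] by blast
  qed
  moreover have "?F \<subseteq> weyl.span (B \<union> ?W)"
  proof
    fix P assume P: "P \<in> ?F"
    obtain S where S: "S \<in> weyl.span ?W" "P - S \<in> I"
      using std_reduction[OF I P] by blast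
    have "S \<in> ?F"
      using S(1) W_sub weyl.span_minimal[OF _ subspace_bernstein] by blast
    hence "P - S \<in> weyl.span B"
      using P S(2) B(3) weyl.subspace_diff[OF subspace_bernstein] by blast
    hence "(P - S) + S \<in> weyl.span (B \<union> ?W)"
      using S(1) weyl.span_mono[of B "B \<union> ?W"] weyl.span_mono[of ?W "B \<union> ?W"]
      by (intro weyl.span_add) auto
    thus "P \<in> weyl.span (B \<union> ?W)" by simp
  qed
  ultimately have "weyl.dim ?F = card (B \<union> ?W)"
    using W_sub B(1) by (intro weyl.dim_unique[of "B \<union> ?W"]) auto
  also have "\<dots> = card B + card (std_monoms I k)"
    using disj finB finW by (simp add: card_Un_disjoint card_image[OF inj_on_subset[OF inj_wmon]])
  finally show ?thesis
    by (simp add: hilbert_function_def B(4))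
qed

section \<open>Holomorphic functions of several variables\<close>

definition hol_on :: "(complex^'n) set \<Rightarrow> (complex^'n \<Rightarrow> complex) \<Rightarrow> bool"
  where "hol_on S \<phi> \<longleftrightarrow> (\<forall>z\<in>S. complex_differentiable_at \<phi> z)"

lemma hol_on_subset: "hol_on S \<phi> \<Longrightarrow> T \<subseteq> S \<Longrightarrow> hol_on T \<phi>"
  by (auto simp: hol_on_def)

lemma smult_axis: "t *s axis i 1 = (axis i t :: complex^'n)"
  by (simp add: vec_eq_iff axis_def)

lemma norm_axis_complex: "norm (axis i t :: complex^'n) = norm t"
proof -
  have "(\<Sum>j\<in>UNIV. (norm (axis i t $ j :: complex))\<^sup>2) = (\<Sum>j\<in>UNIV. if j = i then (norm t)\<^sup>2 else 0)"
    by (rule sum.cong) (auto simp: axis_def)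
  thus ?thesis
    by (simp add: norm_vec_def L2_set_def)
qed

lemma continuous_on_axis [continuous_intros]:
  fixes f :: "'a::topological_space \<Rightarrow> complex"
  assumes "continuous_on S f"
  shows "continuous_on S (\<lambda>x. axis i (f x) :: complex^'n)"
proof -
  have "continuous_on S (\<lambda>x. if j = i then f x else 0)" for j
    using assms by (cases "j = i") auto
  thus ?thesis
    unfolding axis_def by (rule continuous_on_vec_lambda)
qed

lemma bounded_linear_axis: "bounded_linear (\<lambda>t :: complex. axis i t :: complex^'n)"
  by (rule bounded_linear_intro[of _ 1]) (simp_all add: norm_axis_complex, simp_all add: vec_eq_iff axis_def)

lemma complex_derivative_expansion:
  fixes \<phi> :: "complex^'n::finite \<Rightarrow> complex"
  assumes "complex_differentiable_at \<phi> z"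
  shows "(\<phi> has_derivative (\<lambda>v. \<Sum>j\<in>UNIV. v $ j * pderiv_var j \<phi> z)) (at z)"
    "((\<lambda>t. \<phi> (z + axis i t)) has_field_derivative pderiv_var i \<phi> z) (at 0)"
proof -
  obtain L where L: "(\<phi> has_derivative L) (at z)" "\<And>c v. L (c *s v) = c * L v"
    using assms by (auto simp: complex_differentiable_at_def)
  have line: "((\<lambda>t. \<phi> (z + axis j t)) has_field_derivative L (axis j 1)) (at 0)" for j
  proof -
    have "((\<lambda>t. z + axis j t) has_derivative (\<lambda>t. axis j t)) (at (0::complex))"
      using has_derivative_add[OF has_derivative_const[of z]
        bounded_linear_imp_has_derivative[OF bounded_linear_axis[of j]]] by simp
    moreover have "axis j 0 = (0 :: complex^'n)" by (simp add: vec_eq_iff axis_def)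
    ultimately have "((\<lambda>t. \<phi> (z + axis j t)) has_derivative (\<lambda>t. L (axis j t))) (at 0)"
      using has_derivative_compose[of "\<lambda>t. z + axis j t" "\<lambda>t. axis j t" 0 UNIV \<phi> L] L(1)
      by (simp del: axis_eq_0_iff)
    moreover have "(\<lambda>t. L (axis j t)) = (*) (L (axis j 1))"
    proof
      fix t
      have "L (axis j t) = t * L (axis j 1)"
        using L(2)[of t "axis j 1"] by (simp only: smult_axis)
      thus "L (axis j t) = L (axis j 1) * t" by (metis mult.commute)
    qed
    ultimately show ?thesis
      by (simp only: has_field_derivative_def)
  qed
  have pd: "pderiv_var j \<phi> z = L (axis j 1)" for j
    unfolding pderiv_var_def smult_axis by (rule DERIV_imp_deriv[OF line])
  show "((\<lambda>t. \<phi> (z + axis i t)) has_field_derivative pderiv_var i \<phi> z) (at 0)"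
    using line pd by simp
  have "L v = (\<Sum>j\<in>UNIV. v $ j * L (axis j 1))" for v
  proof -
    have "v = (\<Sum>j\<in>UNIV. v $ j *s axis j 1)"
      by (simp add: vec_eq_iff axis_def if_distrib cong: if_cong)
    hence "L v = L (\<Sum>j\<in>UNIV. v $ j *s axis j 1)" by simp
    also have "\<dots> = (\<Sum>j\<in>UNIV. v $ j * L (axis j 1))"
      using has_derivative_linear[OF L(1)] by (simp add: linear_sum L(2))
    finally show ?thesis .
  qed
  hence "L = (\<lambda>v. \<Sum>j\<in>UNIV. v $ j * pderiv_var j \<phi> z)"
    unfolding pd by (rule ext)
  thus "(\<phi> has_derivative (\<lambda>v. \<Sum>j\<in>UNIV. v $ j * pderiv_var j \<phi> z)) (at z)"
    using L(1) by metis
qed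

lemma hol_on_has_derivative:
  "hol_on S \<phi> \<Longrightarrow> z \<in> S \<Longrightarrow> (\<phi> has_derivative (\<lambda>v. \<Sum>j\<in>UNIV. v $ j * pderiv_var j \<phi> z)) (at z)"
  by (simp add: hol_on_def complex_derivative_expansion)

lemma complex_differentiable_atI:
  assumes "(\<phi> has_derivative (\<lambda>v. \<Sum>j\<in>UNIV. v $ j * d j)) (at z)"
  shows "complex_differentiable_at \<phi> z" "pderiv_var i \<phi> z = d i"
proof -
  show diff: "complex_differentiable_at \<phi> z"
    unfolding complex_differentiable_at_def
    by (intro exI conjI, rule assms) (simp add: sum_distrib_left mult.assoc)
  have eq: "(\<lambda>v. \<Sum>j\<in>UNIV. v $ j * d j) = (\<lambda>v. \<Sum>j\<in>UNIV. v $ j * pderiv_var j \<phi> z)"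
    by (rule has_derivative_unique[OF assms complex_derivative_expansion(1)[OF diff]])
  have "(\<Sum>j\<in>UNIV. axis i 1 $ j * x j) = (x i :: complex)" for x
  proof -
    have "(\<Sum>j\<in>UNIV. axis i 1 $ j * x j) = (\<Sum>j\<in>UNIV. if j = i then x j else 0)"
      by (rule sum.cong) (auto simp: axis_def)
    thus ?thesis by simp
  qed
  thus "pderiv_var i \<phi> z = d i"
    using fun_cong[OF eq, of "axis i 1"] by simp
qed

lemma hol_on_imp_continuous_on: "hol_on S \<phi> \<Longrightarrow> continuous_on S \<phi>"
  by (meson continuous_at_imp_continuous_on has_derivative_continuous hol_on_has_derivative)

lemma hol_on_line:
  fixes z :: "complex^'n::finite"
  assumes "hol_on S \<phi>" "z + axis i t \<in> S"
  shows "((\<lambda>t. \<phi> (z + axis i t)) has_field_derivative pderiv_var i \<phi> (z + axis i t)) (at t)"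
proof -
  have "((\<lambda>s. \<phi> (z + axis i t + axis i s)) has_field_derivative pderiv_var i \<phi> (z + axis i t)) (at 0)"
    using assms by (intro complex_derivative_expansion) (auto simp: hol_on_def)
  moreover have "(\<lambda>s. \<phi> (z + axis i t + axis i s)) = (\<lambda>s. \<phi> (z + axis i (s + t)))"
    by (auto simp: fun_eq_iff vec_eq_iff axis_def intro!: arg_cong[where f = \<phi>])
  ultimately show ?thesis
    using DERIV_shift[of "\<lambda>t. \<phi> (z + axis i t)" "pderiv_var i \<phi> (z + axis i t)" 0 t] by simp
qed

section \<open>Cauchy's formula for partial derivatives\<close>

definition circ :: "real \<Rightarrow> real \<Rightarrow> complex"
  where "circ r s = of_real r * exp (2 * of_real pi * \<i> * of_real s)"

lemma circ_norm [simp]: "norm (circ r s) = \<bar>r\<bar>"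
  by (simp add: circ_def norm_mult)

lemma circ_neq_0: "r \<noteq> 0 \<Longrightarrow> circ r s \<noteq> 0"
  by (metis abs_0_eq circ_norm norm_zero)

lemma continuous_on_circ [continuous_intros]: "continuous_on S f \<Longrightarrow> continuous_on S (\<lambda>x. circ r (f x))"
  unfolding circ_def by (intro continuous_intros)

text \<open>Cauchy's formula for the first derivative on the complex line through \<open>z\<close>
  in direction \<open>i\<close>. The velocity of the circle cancels the factor 2 pi i and one of the
  two powers in the denominator; what remains is an integral over a fixed real interval, to which
  theorems on parameter integrals apply.\<close>

lemma cauchy_pderiv:
  fixes z :: "complex^'n::finite"
  assumes hol: "hol_on S \<phi>" and r: "r > 0" and sub: "\<And>t. norm t \<le> r \<Longrightarrow> z + axis i t \<in> S"
  shows "pderiv_var i \<phi> z = integral (cbox 0 1) (\<lambda>s. \<phi> (z + axis i (circ r s)) * inverse (circ r s))"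
proof -
  define f where "f t = \<phi> (z + axis i t)" for t
  have D: "(f has_field_derivative pderiv_var i \<phi> (z + axis i t)) (at t)" if "norm t \<le> r" for t
    unfolding f_def using hol_on_line[OF hol sub[OF that]] .
  have "continuous_on (cball 0 r) f"
  proof (intro continuous_at_imp_continuous_on ballI)
    fix t :: complex assume "t \<in> cball 0 r"
    thus "isCont f t" using DERIV_isCont[OF D[of t]] by simp
  qed
  moreover have "f holomorphic_on ball 0 r"
    unfolding holomorphic_on_open[OF open_ball] by (meson D less_imp_le mem_ball_0)
  ultimately have "(f has_field_derivative (1 / (2 * of_real pi * \<i>)
      * contour_integral (circlepath 0 r) (\<lambda>u. f u / (u - 0)^2))) (at 0)"
    using r by (intro Cauchy_derivative_integral_circlepath) auto
  moreover have "(f has_field_derivative pderiv_var i \<phi> z) (at 0)"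
    using D[of 0] r by (simp add: smult_axis[of 0, symmetric])
  ultimately have "pderiv_var i \<phi> z = 1 / (2 * of_real pi * \<i>)
      * contour_integral (circlepath 0 r) (\<lambda>u. f u / (u - 0)^2)"
    by (rule DERIV_unique[symmetric])
  also have "\<dots> = integral {0..1} (\<lambda>s. 1 / (2 * of_real pi * \<i>)
      * (f (circ r s) / (circ r s)^2 * (2 * of_real pi * \<i> * circ r s)))"
    unfolding contour_integral_integral vector_derivative_circlepath integral_mult_right[symmetric]
    by (simp add: circlepath circ_def mult.assoc)
  also have "\<dots> = integral {0..1} (\<lambda>s. f (circ r s) * inverse (circ r s))"
    by (rule integral_cong) (use circ_neq_0[of r] r in \<open>simp add: field_simps power2_eq_square\<close>)
  finally show ?thesis by (simp add: f_def)
qed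

text \<open>Doubling the radius leaves room for circles of the same radius \<open>r\<close> around
  all points of the smaller ball, so one integral formula serves a whole neighbourhood of
  \<open>p\<close>.\<close>

lemma cauchy_pderiv_ball:
  fixes p :: "complex^'n::finite"
  assumes "hol_on (ball p (2 * r)) \<phi>" "r > 0" "z \<in> ball p r"
  shows "pderiv_var i \<phi> z = integral (cbox 0 1) (\<lambda>s. \<phi> (z + axis i (circ r s)) * inverse (circ r s))"
proof (rule cauchy_pderiv[OF assms(1,2)])
  fix t :: complex assume t: "norm t \<le> r"
  have "dist p (z + axis i t) \<le> dist p z + norm (axis i t :: complex^'n)"
    by (metis add_diff_cancel_left' dist_norm dist_triangle dist_commute)
  thus "z + axis i t \<in> ball p (2 * r)"
    using t assms(3) by (simp add: norm_axis_complex)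
qed

lemma shift_circ_in_ball:
  fixes p :: "complex^'n::finite"
  assumes "r > 0" "z \<in> ball p r"
  shows "z + axis i (circ r s) \<in> ball p (2 * r)"
proof -
  have "dist p (z + axis i (circ r s)) \<le> dist p z + norm (axis i (circ r s) :: complex^'n)"
    by (metis add_diff_cancel_left' dist_norm dist_triangle dist_commute)
  thus ?thesis
    using assms by (simp add: norm_axis_complex)
qed

text \<open>Continuity is read off from the parameter integral. It has to precede differentiability
  of the partial derivatives, since differentiation under the integral sign requires a continuous
  derivative of the integrand.\<close>

lemma continuous_on_pderiv_ball:
  fixes p :: "complex^'n::finite"
  assumes "hol_on (ball p (2 * r)) \<phi>" "r > 0"
  shows "continuous_on (ball p r) (pderiv_var i \<phi>)"
proof -
  have "continuous_on (ball p r \<times> cbox 0 1) (\<lambda>x. \<phi> (fst x + axis i (circ r (snd x))) * inverse (circ r (snd x)))"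
    by (intro continuous_intros continuous_on_compose2[OF hol_on_imp_continuous_on[OF assms(1)]])
      (use assms(2) circ_neq_0 shift_circ_in_ball in auto)
  hence "continuous_on (ball p r) (\<lambda>z. integral (cbox 0 1) (\<lambda>s. \<phi> (z + axis i (circ r s)) * inverse (circ r s)))"
    by (intro integral_continuous_on_param) (simp add: case_prod_unfold)
  thus ?thesis
    by (rule continuous_on_eq) (simp add: cauchy_pderiv_ball[OF assms])
qed

lemma continuous_on_pderiv:
  fixes S :: "(complex^'n::finite) set"
  assumes "open S" "hol_on S \<phi>"
  shows "continuous_on S (pderiv_var i \<phi>)"
proof (intro continuous_at_imp_continuous_on ballI)
  fix p assume "p \<in> S"
  then obtain e where e: "e > 0" "ball p e \<subseteq> S"
    using openE[OF assms(1)] by metis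
  have "continuous_on (ball p (e / 2)) (pderiv_var i \<phi>)"
    using e hol_on_subset[OF assms(2)] by (intro continuous_on_pderiv_ball) auto
  thus "isCont (pderiv_var i \<phi>) p"
    using e by (simp add: continuous_on_eq_continuous_at)
qed

text \<open>Differentiation under the Cauchy integral.\<close>

lemma pderiv_has_derivative_ball:
  fixes p :: "complex^'n::finite"
  assumes hol: "hol_on (ball p (2 * r)) \<phi>" and r: "r > 0"
  shows "(pderiv_var i \<phi> has_derivative (\<lambda>v. \<Sum>j\<in>UNIV. v $ j *
    integral (cbox 0 1) (\<lambda>s. pderiv_var j \<phi> (p + axis i (circ r s)) * inverse (circ r s)))) (at p)"
proof -
  let ?B = "ball p r" and ?K = "cbox 0 1 :: real set"
  have shift: "p + axis j (circ r s) \<in> ball p (2 * r)" for j s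
    using r by (intro shift_circ_in_ball) auto
  define f where "f z s = \<phi> (z + axis i (circ r s)) * inverse (circ r s)" for z s
  define f' where "f' z s v = (\<Sum>j\<in>UNIV. v $ j * (pderiv_var j \<phi> (z + axis i (circ r s)) * inverse (circ r s)))"
    for z s v
  have blin: "bounded_linear (f' z s)" for z s
    unfolding f'_def
    by (intro bounded_linear_sum bounded_linear_compose[OF bounded_linear_mult_left bounded_linear_vec_nth])
  have app: "blinfun_apply (Blinfun (f' z s)) v = f' z s v" for z s v
    using blin by (simp add: bounded_linear_Blinfun_apply)
  have cont_pd: "continuous_on (ball p (2 * r)) (pderiv_var j \<phi>)" for j
    by (intro continuous_on_pderiv hol) auto
  have cont: "continuous_on (?B \<times> ?K)
      (\<lambda>x. pderiv_var j \<phi> (fst x + axis i (circ r (snd x))) * inverse (circ r (snd x)))" for j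
    by (intro continuous_intros continuous_on_compose2[OF cont_pd])
      (use r circ_neq_0 shift_circ_in_ball in auto)
  \<comment> \<open>The derivative appears here as an integral of linear operators; evaluating it at
    a vector \<open>v\<close> afterwards gives the stated sum.\<close>
  have "((\<lambda>z. integral ?K (f z)) has_derivative integral ?K (\<lambda>s. Blinfun (f' p s))) (at p within ?B)"
  proof (rule leibniz_rule[where fx = "\<lambda>z s. Blinfun (f' z s)"])
    fix z s assume z: "z \<in> ?B" "s \<in> ?K"
    have "(\<phi> has_derivative (\<lambda>v. \<Sum>j\<in>UNIV. v $ j * pderiv_var j \<phi> (z + axis i (circ r s))))
        (at (z + axis i (circ r s)))"
      using r z by (intro hol_on_has_derivative[OF hol] shift_circ_in_ball) auto
    hence "((\<lambda>z. \<phi> (z + axis i (circ r s))) has_derivative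
        (\<lambda>v. \<Sum>j\<in>UNIV. v $ j * pderiv_var j \<phi> (z + axis i (circ r s)))) (at z within ?B)"
      by (rule has_derivative_compose[rotated]) (auto intro!: derivative_eq_intros)
    from has_derivative_mult_left[OF this, of "inverse (circ r s)"]
    have "(((\<lambda>z. f z s)) has_derivative f' z s) (at z within ?B)"
      by (simp add: f_def f'_def[abs_def] sum_distrib_right mult.assoc)
    thus "((\<lambda>z. f z s) has_derivative blinfun_apply (Blinfun (f' z s))) (at z within ?B)"
      using blin by (simp add: bounded_linear_Blinfun_apply)
  next
    fix z assume "z \<in> ?B"
    thus "f z integrable_on ?K"
      unfolding f_def
      by (intro integrable_continuous continuous_intros continuous_on_compose2[OF hol_on_imp_continuous_on[OF hol]])
        (use r circ_neq_0 shift_circ_in_ball in auto)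
  next
    show "continuous_on (?B \<times> ?K) (\<lambda>(z, s). Blinfun (f' z s))"
      unfolding case_prod_unfold
    proof (rule continuous_on_blinfun_componentwise)
      fix v :: "complex^'n"
      show "continuous_on (?B \<times> ?K) (\<lambda>x. blinfun_apply (Blinfun (f' (fst x) (snd x))) v)"
        unfolding app unfolding f'_def by (intro continuous_intros cont)
    qed
  qed (use r in auto)
  moreover have "blinfun_apply (integral ?K (\<lambda>s. Blinfun (f' p s))) = (\<lambda>v. \<Sum>j\<in>UNIV. v $ j *
      integral ?K (\<lambda>s. pderiv_var j \<phi> (p + axis i (circ r s)) * inverse (circ r s)))"
  proof
    fix v
    have int: "(\<lambda>s. pderiv_var j \<phi> (p + axis i (circ r s)) * inverse (circ r s)) integrable_on ?K" for j
      by (intro integrable_continuous continuous_intros continuous_on_compose2[OF cont_pd])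
        (use r circ_neq_0 shift in auto)
    have "continuous_on ?K (\<lambda>s. Blinfun (f' p s))"
    proof (rule continuous_on_blinfun_componentwise)
      fix v :: "complex^'n"
      show "continuous_on ?K (\<lambda>s. blinfun_apply (Blinfun (f' p s)) v)"
        unfolding app unfolding f'_def
        by (intro continuous_intros continuous_on_compose2[OF cont_pd])
          (use r circ_neq_0 shift in auto)
    qed
    hence "(\<lambda>s. Blinfun (f' p s)) integrable_on ?K"
      by (rule integrable_continuous)
    hence "blinfun_apply (integral ?K (\<lambda>s. Blinfun (f' p s))) v = integral ?K (\<lambda>s. f' p s v)"
      by (subst blinfun_apply_integral) (simp_all only: app)
    also have "\<dots> = (\<Sum>j\<in>UNIV. integral ?K (\<lambda>s. v $ j * (pderiv_var j \<phi> (p + axis i (circ r s)) * inverse (circ r s))))"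
      unfolding f'_def by (rule integral_sum) (rule finite, rule integrable_on_mult_right, rule int)
    also have "\<dots> = (\<Sum>j\<in>UNIV. v $ j *
      integral ?K (\<lambda>s. pderiv_var j \<phi> (p + axis i (circ r s)) * inverse (circ r s)))"
      by simp
    finally show "blinfun_apply (integral ?K (\<lambda>s. Blinfun (f' p s))) v = \<dots>" .
  qed
  ultimately have "((\<lambda>z. integral ?K (f z)) has_derivative (\<lambda>v. \<Sum>j\<in>UNIV. v $ j *
      integral ?K (\<lambda>s. pderiv_var j \<phi> (p + axis i (circ r s)) * inverse (circ r s)))) (at p)"
    using r by (simp add: at_within_open[of p ?B])
  thus ?thesis
    by (rule has_derivative_transform_within_open[where s = ?B])
      (use r cauchy_pderiv_ball[OF hol r] in \<open>auto simp: f_def[abs_def]\<close>)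
qed

lemma hol_on_pderiv:
  fixes S :: "(complex^'n::finite) set"
  assumes "open S" "hol_on S \<phi>"
  shows "hol_on S (pderiv_var i \<phi>)"
  unfolding hol_on_def
proof
  fix p assume "p \<in> S"
  then obtain e where "e > 0" "ball p e \<subseteq> S"
    using openE[OF assms(1)] by metis
  hence e: "e > 0" "ball p (2 * (e / 2)) \<subseteq> S"
    by simp_all
  show "complex_differentiable_at (pderiv_var i \<phi>) p"
    by (rule complex_differentiable_atI(1), rule pderiv_has_derivative_ball[where r = "e / 2"])
      (use e hol_on_subset[OF assms(2)] in auto)
qed

text \<open>Both sides equal one Cauchy integral: differentiating the formula for the derivative in
  direction \<open>j\<close> under the integral sign, in direction \<open>i\<close>, gives Cauchy's
  formula in direction \<open>j\<close> for the function \<open>pderiv_var i \<phi>\<close>.\<close>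

lemma pderiv_commute:
  fixes S :: "(complex^'n::finite) set"
  assumes "open S" "hol_on S \<phi>" "p \<in> S"
  shows "pderiv_var i (pderiv_var j \<phi>) p = pderiv_var j (pderiv_var i \<phi>) p"
proof -
  obtain e where "e > 0" "ball p e \<subseteq> S"
    using openE[OF assms(1,3)] by metis
  hence e: "e > 0" "ball p (2 * (e / 2)) \<subseteq> S"
    by simp_all
  have hol: "hol_on (ball p (2 * (e / 2))) \<phi>"
    using e hol_on_subset[OF assms(2)] by blast
  have "pderiv_var i (pderiv_var j \<phi>) p = integral (cbox 0 1)
      (\<lambda>s. pderiv_var i \<phi> (p + axis j (circ (e / 2) s)) * inverse (circ (e / 2) s))"
    by (rule complex_differentiable_atI(2), rule pderiv_has_derivative_ball) (use e hol in auto)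
  also have "\<dots> = pderiv_var j (pderiv_var i \<phi>) p"
    by (rule cauchy_pderiv_ball[OF hol_on_pderiv[OF open_ball hol], symmetric])
      (use e(1) dist_self[of p] in auto)
  finally show ?thesis .
qed

lemma pderiv_cong_open:
  fixes S :: "(complex^'n::finite) set"
  assumes "open S" "\<And>z. z \<in> S \<Longrightarrow> \<phi> z = \<psi> z" "p \<in> S"
  shows "pderiv_var i \<phi> p = pderiv_var i \<psi> p"
  unfolding pderiv_var_def smult_axis
proof (rule deriv_cong_ev)
  have "continuous_on UNIV (\<lambda>t. p + axis i t)"
    by (intro continuous_intros)
  hence "open ((\<lambda>t. p + axis i t) -` S)"
    using assms(1) open_vimage by blast
  moreover have "0 \<in> (\<lambda>t. p + axis i t) -` S"
    using assms(3) by (simp add: smult_axis[of 0, symmetric])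
  ultimately show "\<forall>\<^sub>F t in nhds 0. \<phi> (p + axis i t) = \<psi> (p + axis i t)"
    using assms(2) by (auto simp: eventually_nhds)
qed simp

section \<open>Holomorphic functions as a module over the Weyl algebra\<close>

lemma nat_vec_induct [case_names zero axis]:
  fixes a :: "nat^'n::finite"
  assumes "R 0" "\<And>a i. R a \<Longrightarrow> R (a + axis i 1)"
  shows "R a"
proof (induction "vsum a" arbitrary: a)
  case 0
  hence "a = 0" by (simp add: vec_eq_iff)
  thus ?case using assms(1) by simp
next
  case (Suc n)
  then obtain i where "a $ i \<noteq> 0"
    by (metis sum.neutral Zero_not_Suc)
  hence eq: "a = (a - axis i 1) + axis i 1"
    by (auto simp: vec_eq_iff axis_def)
  have "vsum a = vsum (a - axis i 1) + vsum (axis i 1)"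
    by (subst eq) (simp add: sum.distrib)
  hence "n = vsum (a - axis i 1)"
    using Suc.hyps(2) by (simp add: axis_def)
  hence "R (a - axis i 1)" by (rule Suc.hyps(1))
  thus ?case using assms(2) eq by metis
qed

text \<open>Every term arises from a constant by left multiplication with derivatives followed by
  variables, so identities between operators need checking on generators only.\<close>

lemma weyl_generator_induct [case_names zero add const x d]:
  assumes "R 0" and add: "\<And>P Q. R P \<Longrightarrow> R Q \<Longrightarrow> R (P + Q)" and "\<And>c. R (wconst c)"
    and x: "\<And>P i. R P \<Longrightarrow> R (wx i * P)" and d: "\<And>P i. R P \<Longrightarrow> R (wd i * P)"
  shows "R P"
proof (induction P rule: weyl_induct)
  case (wterm c a b)
  have "R (wterm c 0 b)"
  proof (induction b rule: nat_vec_induct)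
    case zero
    show ?case using assms(3)[of c] by (simp add: wconst_def)
  next
    case (axis b i)
    thus ?case using d[of "wterm c 0 b" i] by (simp add: wd_mult_wterm)
  qed
  thus ?case
  proof (induction a rule: nat_vec_induct)
    case (axis a i)
    thus ?case using x[of "wterm c a b" i] by (simp add: wx_mult_wterm)
  qed
qed (use assms in auto)

lemma act_superset:
  assumes "finite S" "wsupp P \<subseteq> S"
  shows "act P \<phi> z = (\<Sum>m\<in>S. wcf P m * monom_eval (fst m) z * pderiv_multi (snd m) \<phi> z)"
  unfolding act_def case_prod_unfold wcf_def[symmetric] using assms
  by (intro sum.mono_neutral_left) (auto simp: wsupp_iff)

lemma act_zero [simp]: "act 0 \<phi> z = 0"
  by (simp add: act_def)

lemma act_add: "act (P + Q) \<phi> z = act P \<phi> z + act Q \<phi> z"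
  using act_superset[OF _ wsupp_add, of P Q \<phi> z]
    act_superset[of "wsupp P \<union> wsupp Q" P \<phi> z] act_superset[of "wsupp P \<union> wsupp Q" Q \<phi> z]
  by (simp add: algebra_simps sum.distrib)

lemma act_wscale: "act (wscale c P) \<phi> z = c * act P \<phi> z"
  by (induction P rule: weyl_induct)
    (simp_all add: weyl.scale_right_distrib act_add wscale_wterm act_wterm algebra_simps)

lemma monom_eval_axis: "monom_eval (a + axis i 1) z = z $ i * monom_eval a z"
proof -
  have "monom_eval (a + axis i 1) z = (\<Prod>j\<in>UNIV. (if j = i then z $ i else 1) * (z $ j) ^ (a $ j))"
    unfolding monom_eval_def by (rule prod.cong) (auto simp: axis_def power_add)
  thus ?thesis by (simp add: monom_eval_def prod.distrib)
qed

lemma act_wx_mult: "act (wx i * P) \<phi> z = z $ i * act P \<phi> z"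
  by (induction P rule: weyl_induct)
    (simp_all add: distrib_left act_add wx_mult_wterm act_wterm monom_eval_axis)

section \<open>Differentiation rules for holomorphic functions\<close>

lemma hol_on_mult:
  assumes f: "hol_on S f" and g: "hol_on S g"
  shows "hol_on S (\<lambda>z. f z * g z)"
    "z \<in> S \<Longrightarrow> pderiv_var i (\<lambda>z. f z * g z) z = f z * pderiv_var i g z + pderiv_var i f z * g z"
proof -
  have D: "((\<lambda>z. f z * g z) has_derivative
    (\<lambda>v. \<Sum>j\<in>UNIV. v $ j * (f z * pderiv_var j g z + pderiv_var j f z * g z))) (at z)" if "z \<in> S" for z
  proof -
    have "(\<lambda>v. f z * (\<Sum>j\<in>UNIV. v $ j * pderiv_var j g z) + (\<Sum>j\<in>UNIV. v $ j * pderiv_var j f z) * g z)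
        = (\<lambda>v. \<Sum>j\<in>UNIV. v $ j * (f z * pderiv_var j g z + pderiv_var j f z * g z))"
      by (rule ext) (simp add: sum_distrib_left sum_distrib_right sum.distrib algebra_simps)
    thus ?thesis
      using has_derivative_mult[OF hol_on_has_derivative[OF f that] hol_on_has_derivative[OF g that]] by metis
  qed
  show "hol_on S (\<lambda>z. f z * g z)"
    using complex_differentiable_atI(1)[OF D] by (auto simp: hol_on_def)
  show "z \<in> S \<Longrightarrow> pderiv_var i (\<lambda>z. f z * g z) z = f z * pderiv_var i g z + pderiv_var i f z * g z"
    by (rule complex_differentiable_atI(2)[OF D])
qed

lemma hol_on_add:
  assumes f: "hol_on S f" and g: "hol_on S g"
  shows "hol_on S (\<lambda>z. f z + g z)"
    "z \<in> S \<Longrightarrow> pderiv_var i (\<lambda>z. f z + g z) z = pderiv_var i f z + pderiv_var i g z"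
proof -
  have D: "((\<lambda>z. f z + g z) has_derivative
    (\<lambda>v. \<Sum>j\<in>UNIV. v $ j * (pderiv_var j f z + pderiv_var j g z))) (at z)" if "z \<in> S" for z
  proof -
    have "(\<lambda>v. (\<Sum>j\<in>UNIV. v $ j * pderiv_var j f z) + (\<Sum>j\<in>UNIV. v $ j * pderiv_var j g z))
        = (\<lambda>v. \<Sum>j\<in>UNIV. v $ j * (pderiv_var j f z + pderiv_var j g z))"
      by (rule ext) (simp add: sum.distrib algebra_simps)
    thus ?thesis
      using has_derivative_add[OF hol_on_has_derivative[OF f that] hol_on_has_derivative[OF g that]] by metis
  qed
  show "hol_on S (\<lambda>z. f z + g z)"
    using complex_differentiable_atI(1)[OF D] by (auto simp: hol_on_def)
  show "z \<in> S \<Longrightarrow> pderiv_var i (\<lambda>z. f z + g z) z = pderiv_var i f z + pderiv_var i g z"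
    by (rule complex_differentiable_atI(2)[OF D])
qed

lemma hol_on_const: "hol_on (S :: (complex^'n::finite) set) (\<lambda>z. c)" "pderiv_var i (\<lambda>z :: complex^'n::finite. c) z = 0"
proof -
  have "((\<lambda>z :: complex^'n. c) has_derivative (\<lambda>v. \<Sum>j\<in>UNIV. v $ j * 0)) (at z)" for z
    by simp
  note D = complex_differentiable_atI[OF this]
  show "hol_on (S :: (complex^'n) set) (\<lambda>z. c)" using D(1) by (auto simp: hol_on_def)
  show "pderiv_var i (\<lambda>z :: complex^'n::finite. c) z = 0" by (rule D(2))
qed

lemma hol_on_coordinate:
  "hol_on S (\<lambda>z :: complex^'n::finite. z $ j)"
  "pderiv_var i (\<lambda>z :: complex^'n::finite. z $ j) z = (if i = j then 1 else 0)"
proof -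
  have eq: "(\<lambda>v :: complex^'n. v $ j) = (\<lambda>v. \<Sum>i\<in>UNIV. v $ i * (if i = j then 1 else 0))"
    by (simp add: if_distrib cong: if_cong)
  have "((\<lambda>z :: complex^'n. z $ j) has_derivative (\<lambda>v. \<Sum>i\<in>UNIV. v $ i * (if i = j then 1 else 0))) (at z)" for z
    unfolding eq[symmetric] by (rule bounded_linear_imp_has_derivative[OF bounded_linear_vec_nth])
  note D = complex_differentiable_atI[OF this]
  show "hol_on S (\<lambda>z :: complex^'n. z $ j)" using D(1) by (auto simp: hol_on_def)
  show "pderiv_var i (\<lambda>z :: complex^'n::finite. z $ j) z = (if i = j then 1 else 0)" by (rule D(2))
qed

lemma hol_on_cmult:
  assumes "hol_on S f"
  shows "hol_on S (\<lambda>z. c * f z)" "z \<in> S \<Longrightarrow> pderiv_var i (\<lambda>z. c * f z) z = c * pderiv_var i f z"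
  using hol_on_mult[OF hol_on_const(1)[of S c] assms] by (simp_all add: hol_on_const(2))

section \<open>Mixed partial derivatives and compatibility of the action with products\<close>

lemma hol_on_pderiv_pow:
  assumes "open S" "hol_on S \<phi>"
  shows "hol_on S ((pderiv_var i ^^ k) \<phi>)"
  by (induction k) (use assms in \<open>auto intro: hol_on_pderiv\<close>)

lemma pderiv_pow_cong_open:
  assumes "open S" "\<And>z. z \<in> S \<Longrightarrow> \<phi> z = \<psi> z"
  shows "z \<in> S \<Longrightarrow> (pderiv_var i ^^ k) \<phi> z = (pderiv_var i ^^ k) \<psi> z"
proof (induction k arbitrary: z)
  case (Suc k)
  have "pderiv_var i ((pderiv_var i ^^ k) \<phi>) z = pderiv_var i ((pderiv_var i ^^ k) \<psi>) z"
    by (rule pderiv_cong_open[OF assms(1) Suc.IH Suc.prems])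
  thus ?case by simp
qed (use assms in simp)

lemma pderiv_pow_commute:
  assumes "open S" "hol_on S \<phi>"
  shows "z \<in> S \<Longrightarrow> pderiv_var i ((pderiv_var j ^^ k) \<phi>) z = (pderiv_var j ^^ k) (pderiv_var i \<phi>) z"
proof (induction k arbitrary: z)
  case (Suc k)
  have "pderiv_var i (pderiv_var j ((pderiv_var j ^^ k) \<phi>)) z
      = pderiv_var j (pderiv_var i ((pderiv_var j ^^ k) \<phi>)) z"
    by (rule pderiv_commute[OF assms(1) hol_on_pderiv_pow[OF assms] Suc.prems])
  also have "\<dots> = pderiv_var j ((pderiv_var j ^^ k) (pderiv_var i \<phi>)) z"
    by (rule pderiv_cong_open[OF assms(1) Suc.IH Suc.prems])
  finally show ?case by simp
qed simp

lemma hol_on_foldr_pderiv: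
  assumes "open S" "hol_on S \<phi>"
  shows "hol_on S (foldr (\<lambda>i. pderiv_var i ^^ (b $ i)) xs \<phi>)"
  by (induction xs) (use assms in \<open>auto intro: hol_on_pderiv_pow\<close>)

lemma hol_on_pderiv_multi:
  "open S \<Longrightarrow> hol_on S \<phi> \<Longrightarrow> hol_on S (pderiv_multi b \<phi>)"
  unfolding pderiv_multi_def by (rule hol_on_foldr_pderiv)

text \<open>\<open>pderiv_multi\<close> differentiates in a fixed order, so a new derivative has to
  be moved past the blocks of the other variables. As the list is distinct, it raises the exponent
  in exactly one block.\<close>

lemma pderiv_foldr:
  fixes b :: "nat^'n::finite"
  assumes S: "open S" "hol_on S \<phi>"
  shows "distinct xs \<Longrightarrow> i \<in> set xs \<Longrightarrow> z \<in> S \<Longrightarrow>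
    pderiv_var i (foldr (\<lambda>j. pderiv_var j ^^ (b $ j)) xs \<phi>) z
      = foldr (\<lambda>j. pderiv_var j ^^ ((b + axis i 1) $ j)) xs \<phi> z"
proof (induction xs arbitrary: z)
  case (Cons x xs)
  let ?F = "\<lambda>b. foldr (\<lambda>j. pderiv_var j ^^ (b $ j)) xs \<phi>"
  show ?case
  proof (cases "x = i")
    case True
    hence "i \<notin> set xs" using Cons.prems by simp
    hence "?F (b + axis i 1) = ?F b"
      by (intro foldr_cong) (auto simp: axis_def)
    thus ?thesis using True by (simp flip: Suc_eq_plus1)
  next
    case False
    hence xs: "distinct xs" "i \<in> set xs" using Cons.prems by auto
    have "pderiv_var i ((pderiv_var x ^^ (b $ x)) (?F b)) z = (pderiv_var x ^^ (b $ x)) (pderiv_var i (?F b)) z"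
      by (intro pderiv_pow_commute[OF S(1)] hol_on_foldr_pderiv S Cons.prems)
    also have "\<dots> = (pderiv_var x ^^ (b $ x)) (?F (b + axis i 1)) z"
      by (intro pderiv_pow_cong_open[OF S(1) Cons.IH[OF xs]] Cons.prems)
    finally show ?thesis using False by (simp add: axis_def)
  qed
qed simp

lemma var_list: "distinct (var_list :: 'n::finite list)" "set (var_list :: 'n list) = UNIV"
proof -
  have "\<exists>xs :: 'n list. distinct xs \<and> set xs = UNIV"
    using finite_distinct_list[of "UNIV :: 'n set"] by auto
  from someI_ex[OF this]
  show "distinct (var_list :: 'n list)" "set (var_list :: 'n list) = UNIV"
    unfolding var_list_def by blast+
qed

lemma pderiv_pderiv_multi:
  assumes "open S" "hol_on S \<phi>" "z \<in> S"
  shows "pderiv_var i (pderiv_multi b \<phi>) z = pderiv_multi (b + axis i 1) \<phi> z"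
  unfolding pderiv_multi_def
  by (rule pderiv_foldr[OF assms(1,2) var_list(1) _ assms(3)]) (simp add: var_list(2))

lemma pderiv_multi_cong_open:
  assumes "open S" "\<And>z. z \<in> S \<Longrightarrow> \<phi> z = \<psi> z" "z \<in> S"
  shows "pderiv_multi b \<phi> z = pderiv_multi b \<psi> z"
proof -
  have "foldr (\<lambda>i. pderiv_var i ^^ (b $ i)) xs \<phi> z = foldr (\<lambda>i. pderiv_var i ^^ (b $ i)) xs \<psi> z" if "z \<in> S" for xs z
    using that
  proof (induction xs arbitrary: z)
    case (Cons x xs)
    thus ?case using pderiv_pow_cong_open[OF assms(1) Cons.IH] by simp
  qed (use assms in simp)
  thus ?thesis using assms(3) by (simp add: pderiv_multi_def)
qed

lemma act_cong_open:
  assumes "open S" "\<And>z. z \<in> S \<Longrightarrow> \<phi> z = \<psi> z" "z \<in> S"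
  shows "act P \<phi> z = act P \<psi> z"
  unfolding act_def case_prod_unfold using pderiv_multi_cong_open[OF assms] by simp

lemma hol_on_act:
  fixes P :: "'n::finite weyl"
  assumes "open S" "hol_on S \<phi>"
  shows "hol_on S (act P \<phi>)"
proof (induction P rule: weyl_induct)
  case zero
  show ?case using hol_on_const(1)[of S 0] by (simp add: act_zero[abs_def])
next
  case (add P Q)
  thus ?case using hol_on_add(1)[of S "act P \<phi>" "act Q \<phi>"] by (simp add: act_add[abs_def])
next
  case (wterm c a b)
  show ?case
  proof (induction a rule: nat_vec_induct)
    case zero
    have "act (wterm c 0 b) \<phi> = (\<lambda>z. c * pderiv_multi b \<phi> z)"
      by (simp add: fun_eq_iff act_wterm monom_eval_def)
    thus ?case using hol_on_cmult(1)[OF hol_on_pderiv_multi[OF assms]] by simp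
  next
    case (axis a i)
    have "act (wterm c (a + axis i 1) b) \<phi> = (\<lambda>z. z $ i * act (wterm c a b) \<phi> z)"
      by (simp add: fun_eq_iff act_wx_mult flip: wx_mult_wterm)
    thus ?case using hol_on_mult(1)[OF hol_on_coordinate(1) axis] by simp
  qed
qed

text \<open>Induction on the power of the variables: the product rule for a coordinate function
  times the rest mirrors the commutation relation of \<open>wd i\<close> with
  \<open>wx j\<close>.\<close>

lemma act_wd_mult:
  fixes P :: "'n::finite weyl"
  assumes S: "open S" "hol_on S \<phi>" and z: "z \<in> S"
  shows "act (wd i * P) \<phi> z = pderiv_var i (act P \<phi>) z"
proof (induction P rule: weyl_induct)
  case zero
  show ?case using hol_on_const(2)[of i 0 z] by (simp add: act_zero[abs_def])
next
  case (add P Q)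
  have "pderiv_var i (act (P + Q) \<phi>) z = pderiv_var i (\<lambda>z. act P \<phi> z + act Q \<phi> z) z"
    by (simp add: act_add[abs_def])
  also have "\<dots> = pderiv_var i (act P \<phi>) z + pderiv_var i (act Q \<phi>) z"
    by (rule hol_on_add(2)[OF hol_on_act[OF S] hol_on_act[OF S] z])
  finally have "pderiv_var i (act (P + Q) \<phi>) z = act (wd i * (P + Q)) \<phi> z"
    using add by (simp only: distrib_left act_add)
  thus ?case by (rule sym)
next
  case (wterm c a b)
  show ?case
  proof (induction a rule: nat_vec_induct)
    case zero
    have "act (wterm c 0 b) \<phi> = (\<lambda>z. c * pderiv_multi b \<phi> z)"
      by (simp add: fun_eq_iff act_wterm monom_eval_def)
    hence "pderiv_var i (act (wterm c 0 b) \<phi>) z = c * pderiv_multi (b + axis i 1) \<phi> z"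
      using hol_on_cmult(2)[OF hol_on_pderiv_multi[OF S] z] pderiv_pderiv_multi[OF S z] by simp
    also have "\<dots> = act (wd i * wterm c 0 b) \<phi> z"
      by (simp add: wd_mult_wterm act_wterm monom_eval_def)
    finally show ?case by (rule sym)
  next
    case (axis a j)
    let ?Q = "wterm c a b"
    have "act (wx j * ?Q) \<phi> = (\<lambda>z. z $ j * act ?Q \<phi> z)"
      by (simp add: fun_eq_iff act_wx_mult)
    hence "pderiv_var i (act (wx j * ?Q) \<phi>) z
        = z $ j * pderiv_var i (act ?Q \<phi>) z + (if i = j then 1 else 0) * act ?Q \<phi> z"
      using hol_on_mult(2)[OF hol_on_coordinate(1) hol_on_act[OF S] z, of i j ?Q] by (simp add: hol_on_coordinate(2))
    also have "\<dots> = act (wx j * (wd i * ?Q) + (if i = j then 1 else 0) * ?Q) \<phi> z"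
      using axis by (simp add: act_add act_wx_mult)
    also have "wx j * (wd i * ?Q) + (if i = j then 1 else 0) * ?Q = wd i * (wx j * ?Q)"
      by (simp add: weyl_relations(3) distrib_right flip: mult.assoc)
    finally show ?case by (simp only: wx_mult_wterm)
  qed
qed

text \<open>This makes the holomorphic functions on \<open>S\<close> a left module over the Weyl
  algebra. The induction keeps \<open>z\<close> arbitrary in \<open>S\<close>, since in the case of
  \<open>wd i\<close> the hypothesis is differentiated and must hold on a neighbourhood.\<close>

lemma act_mult:
  fixes P Q :: "'n::finite weyl"
  assumes S: "open S" "hol_on S \<phi>" and z: "z \<in> S"
  shows "act (P * Q) \<phi> z = act P (act Q \<phi>) z"
  using z
proof (induction P arbitrary: z rule: weyl_generator_induct)
  case (const c)
  show ?case
    using act_wscale[of c Q \<phi> z] by (simp add: wscale_def wconst_def act_wterm pderiv_multi_zero monom_eval_def)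
next
  case (d P i)
  have "act (wd i * P * Q) \<phi> z = pderiv_var i (act (P * Q) \<phi>) z"
    using act_wd_mult[OF S d.prems, of i "P * Q"] by (simp add: mult.assoc)
  also have "\<dots> = pderiv_var i (act P (act Q \<phi>)) z"
    by (rule pderiv_cong_open[OF S(1) d.IH d.prems])
  also have "\<dots> = act (wd i * P) (act Q \<phi>) z"
    by (rule act_wd_mult[OF S(1) hol_on_act[OF S] d.prems, symmetric])
  finally show ?case .
qed (simp_all add: distrib_right act_add act_wx_mult mult.assoc)

section \<open>Analytic continuation and annihilators\<close>

lemma bounded_linear_smult_right: "bounded_linear (\<lambda>t :: complex. t *s (v :: complex^'n::finite))"
  unfolding linear_conv_bounded_linear[symmetric]
  by (rule linearI) (simp_all add: vec_eq_iff algebra_simps)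

lemma germ_eq_openI:
  assumes "open S" "p \<in> S" "\<And>z. z \<in> S \<Longrightarrow> \<phi> z = \<psi> z"
  shows "germ_eq p \<phi> \<psi>"
  unfolding germ_eq_def eventually_nhds using assms by (intro exI[of _ S]) simp

lemma germ_eq_openE:
  assumes "germ_eq p \<phi> \<psi>"
  obtains S where "open S" "p \<in> S" "\<And>z. z \<in> S \<Longrightarrow> \<phi> z = \<psi> z"
proof -
  obtain S where "open S \<and> p \<in> S \<and> (\<forall>z\<in>S. \<phi> z = \<psi> z)"
    using assms unfolding germ_eq_def eventually_nhds by (rule exE)
  thus ?thesis by (intro that[of S]) simp_all
qed

text \<open>Restriction to the complex line through \<open>q\<close> and \<open>z\<close> reduces
  the claim to one variable; the line meets the ball in a convex and hence connected set.\<close>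

lemma identity_theorem_ball:
  fixes p :: "complex^'n::finite"
  assumes hol: "hol_on (ball p r) \<phi>" and q: "q \<in> ball p r" and zero: "germ_eq q \<phi> (\<lambda>_. 0)"
    and z: "z \<in> ball p r"
  shows "\<phi> z = 0"
proof -
  define line where "line t = q + t *s (z - q)" for t
  define T where "T = line -` ball p r"
  have deriv: "(line has_derivative (\<lambda>t. t *s (z - q))) (at t)" for t
    using has_derivative_add[OF has_derivative_const[of q]
      bounded_linear_imp_has_derivative[OF bounded_linear_smult_right[of "z - q"]], of "at t"]
    by (simp add: line_def[abs_def])
  hence cont: "continuous_on UNIV line"
    by (intro continuous_at_imp_continuous_on ballI has_derivative_continuous) auto
  have open_T: "open T"
    unfolding T_def using cont by (intro open_vimage) auto
  have "convex T"
  proof (rule convexI)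
    fix s t :: complex and u v :: real
    assume st: "s \<in> T" "t \<in> T" and uv: "0 \<le> u" "0 \<le> v" "u + v = 1"
    have "line (u *\<^sub>R s + v *\<^sub>R t) = u *\<^sub>R line s + v *\<^sub>R line t"
    proof -
      have v: "v = 1 - u" using uv(3) by simp
      show ?thesis
        unfolding line_def v
        by (simp add: vec_eq_iff) (simp add: scaleR_conv_of_real algebra_simps)
    qed
    thus "u *\<^sub>R s + v *\<^sub>R t \<in> T"
      using st uv convexD[OF convex_ball[of p r], of "line s" "line t" u v] by (simp add: T_def)
  qed
  hence conn: "connected T" by (rule convex_connected)
  have field: "((\<lambda>t. \<phi> (line t)) has_field_derivative (\<Sum>j\<in>UNIV. (z - q) $ j * pderiv_var j \<phi> (line t))) (at t)"
    if "t \<in> T" for t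
  proof -
    have "((\<lambda>t. \<phi> (line t)) has_derivative
        (\<lambda>s. \<Sum>j\<in>UNIV. (s *s (z - q)) $ j * pderiv_var j \<phi> (line t))) (at t)"
      using has_derivative_compose[OF deriv hol_on_has_derivative[OF hol]] that by (simp add: T_def)
    moreover have "(\<lambda>s. \<Sum>j\<in>UNIV. (s *s (z - q)) $ j * pderiv_var j \<phi> (line t))
        = (*) (\<Sum>j\<in>UNIV. (z - q) $ j * pderiv_var j \<phi> (line t))"
      by (rule ext) (simp add: sum_distrib_left algebra_simps)
    ultimately show ?thesis by (simp only: has_field_derivative_def)
  qed
  have "(\<lambda>t. \<phi> (line t)) holomorphic_on T"
    unfolding holomorphic_on_open[OF open_T] using field by blast
  moreover obtain N where N: "open N" "q \<in> N" "\<And>w. w \<in> N \<Longrightarrow> \<phi> w = 0"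
    using germ_eq_openE[OF zero] by metis
  moreover have "open (line -` N \<inter> T)"
    using cont N open_T by (intro open_Int open_vimage) auto
  moreover have ends: "0 \<in> T" "0 \<in> line -` N" "1 \<in> T"
    using q z N by (simp_all add: T_def line_def)
  ultimately have "\<phi> (line 1) = 0"
    using analytic_continuation_open[of "line -` N \<inter> T" T "\<lambda>t. \<phi> (line t)" "\<lambda>_. 0" 1] open_T conn
    by (auto simp: holomorphic_on_const)
  thus ?thesis by (simp add: line_def)
qed

lemma germ_eq_refl [simp]: "germ_eq p \<phi> \<phi>"
  by (simp add: germ_eq_def)

lemma germ_eq_sym: "germ_eq p \<phi> \<psi> \<Longrightarrow> germ_eq p \<psi> \<phi>"
  by (simp add: germ_eq_def eq_commute)

lemma germ_eq_trans:
  assumes "germ_eq p \<phi> \<psi>" "germ_eq p \<psi> \<rho>"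
  shows "germ_eq p \<phi> \<rho>"
  using eventually_conj[OF assms[unfolded germ_eq_def]]
  unfolding germ_eq_def by (rule eventually_mono) simp

lemma germ_eq_act:
  fixes P :: "'n::finite weyl"
  assumes "germ_eq p \<phi> \<psi>"
  shows "germ_eq p (act P \<phi>) (act P \<psi>)"
proof -
  obtain S where S: "open S" "p \<in> S" "\<And>z. z \<in> S \<Longrightarrow> \<phi> z = \<psi> z"
    using germ_eq_openE[OF assms] by metis
  show ?thesis
    by (rule germ_eq_openI[OF S(1,2)], rule act_cong_open[OF S(1,3)])
qed

lemma holomorphic_near_open:
  "holomorphic_near p \<phi> \<longleftrightarrow> (\<exists>S. open S \<and> p \<in> S \<and> hol_on S \<phi>)"
  by (auto simp: holomorphic_near_def hol_on_def eventually_nhds)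

lemma germ_eq_act_mult:
  fixes P Q :: "'n::finite weyl"
  assumes "holomorphic_near p \<phi>"
  shows "germ_eq p (act (P * Q) \<phi>) (act P (act Q \<phi>))"
proof -
  obtain S where S: "open S" "p \<in> S" "hol_on S \<phi>"
    using assms holomorphic_near_open by blast
  show ?thesis
    by (rule germ_eq_openI[OF S(1,2)], rule act_mult[OF S(1,3)])
qed

lemma act_zero_function: "act P (\<lambda>_. 0) = (\<lambda>_. 0 :: complex)"
proof
  fix z :: "complex^'a"
  have "act P (act 0 (\<lambda>_. 0)) z = act (P * 0) (\<lambda>_. 0) z"
    by (rule act_mult[symmetric, OF open_UNIV hol_on_const(1) UNIV_I])
  thus "act P (\<lambda>_. 0) z = 0" by (simp add: act_zero[abs_def])
qed

text \<open>By the identity theorem, the times at which \<open>P\<close> annihilates the branch form a clopen set.\<close>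

lemma continuation_act_zero:
  fixes P :: "'n::finite weyl"
  assumes path: "path \<gamma>" and cont: "continuation_along \<gamma> \<Phi>"
    and end_zero: "germ_eq (\<gamma> 1) (act P (\<Phi> 1)) (\<lambda>_. 0)"
  shows "germ_eq (\<gamma> 0) (act P (\<Phi> 0)) (\<lambda>_. 0)"
proof (rule connected_induction_simple[where S = "{0..1}" and a = 1 and b = 0
      and P = "\<lambda>t. germ_eq (\<gamma> t) (act P (\<Phi> t)) (\<lambda>_. 0)"])
  fix t :: real assume t: "t \<in> {0..1}"
  have "holomorphic_near (\<gamma> t) (\<Phi> t)"
    using cont t by (simp add: continuation_along_def)
  then obtain S where S: "open S" "\<gamma> t \<in> S" "hol_on S (\<Phi> t)"
    using holomorphic_near_open by blast
  obtain r where r: "r > 0" "ball (\<gamma> t) r \<subseteq> S"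
    using openE[OF S(1,2)] by metis
  have hol: "hol_on (ball (\<gamma> t) r) (act P (\<Phi> t))"
    by (intro hol_on_act hol_on_subset[OF S(3)] r) auto
  have "continuous_on {0..1} \<gamma>"
    using path by (simp add: path_def)
  hence "(\<gamma> \<longlongrightarrow> \<gamma> t) (at t within {0..1})"
    using t by (simp add: continuous_on_def)
  hence "\<forall>\<^sub>F s in at t within {0..1}. \<gamma> s \<in> ball (\<gamma> t) r"
    using r(1) by (intro topological_tendstoD) auto
  moreover have "\<forall>\<^sub>F s in at t within {0..1}. germ_eq (\<gamma> s) (\<Phi> s) (\<Phi> t)"
    using cont t by (simp add: continuation_along_def)
  ultimately have "\<forall>\<^sub>F s in at t within {0..1}. \<gamma> s \<in> ball (\<gamma> t) r \<and> germ_eq (\<gamma> s) (\<Phi> s) (\<Phi> t)"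
    by (rule eventually_conj)
  then obtain N where N: "open N" "t \<in> N"
    "\<And>s. s \<in> N \<Longrightarrow> s \<noteq> t \<Longrightarrow> s \<in> {0..1} \<Longrightarrow> \<gamma> s \<in> ball (\<gamma> t) r \<and> germ_eq (\<gamma> s) (\<Phi> s) (\<Phi> t)"
    unfolding eventually_at_topological by blast
  \<comment> \<open>The filter at \<open>t\<close> leaves out \<open>t\<close> itself, which is
    covered by reflexivity of germ equality.\<close>
  have near: "\<gamma> s \<in> ball (\<gamma> t) r" "germ_eq (\<gamma> s) (\<Phi> s) (\<Phi> t)" if "s \<in> N \<inter> {0..1}" for s
    using N(3)[of s] that r(1) by (cases "s = t"; auto)+
  \<comment> \<open>On a short time interval all branches come from the single function
    \<open>\<Phi> t\<close> on one ball. Annihilation at any one of these times means that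
    \<open>act P (\<Phi> t)\<close> vanishes on the whole ball, a condition independent of
    \<open>s\<close>.\<close>
  have iff: "germ_eq (\<gamma> s) (act P (\<Phi> s)) (\<lambda>_. 0) \<longleftrightarrow> (\<forall>z\<in>ball (\<gamma> t) r. act P (\<Phi> t) z = 0)"
    if s: "s \<in> N \<inter> {0..1}" for s
  proof
    assume "germ_eq (\<gamma> s) (act P (\<Phi> s)) (\<lambda>_. 0)"
    hence "germ_eq (\<gamma> s) (act P (\<Phi> t)) (\<lambda>_. 0)"
      using germ_eq_trans[OF germ_eq_sym[OF germ_eq_act[OF near(2)[OF s]]]] by blast
    thus "\<forall>z\<in>ball (\<gamma> t) r. act P (\<Phi> t) z = 0"
      using identity_theorem_ball[OF hol near(1)[OF s]] by blast
  next
    assume "\<forall>z\<in>ball (\<gamma> t) r. act P (\<Phi> t) z = 0"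
    hence "germ_eq (\<gamma> s) (act P (\<Phi> t)) (\<lambda>_. 0)"
      by (intro germ_eq_openI[OF open_ball near(1)[OF s]]) simp
    thus "germ_eq (\<gamma> s) (act P (\<Phi> s)) (\<lambda>_. 0)"
      using germ_eq_trans[OF germ_eq_act[OF near(2)[OF s]]] by blast
  qed
  have "openin (top_of_set {0..1}) (N \<inter> {0..1})"
    by (metis Int_commute openin_open_Int N(1))
  moreover have "t \<in> N \<inter> {0..1}" using N(2) t by blast
  ultimately show "\<exists>T. openin (top_of_set {0..1}) T \<and> t \<in> T \<and>
      (\<forall>x\<in>T. \<forall>y\<in>T. germ_eq (\<gamma> x) (act P (\<Phi> x)) (\<lambda>_. 0) \<longrightarrow> germ_eq (\<gamma> y) (act P (\<Phi> y)) (\<lambda>_. 0))"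
    by (intro exI[of _ "N \<inter> {0..1}"]) (simp add: iff)
qed (use end_zero in auto)

section \<open>Annihilators of multi-valued functions\<close>

lemma branch_continues:
  assumes "multivalued_holomorphic_on U F" "p \<in> U" "\<phi> \<in> F p" "q \<in> U"
  shows "\<exists>\<psi>\<in>F q. continues_to U p \<phi> q \<psi>"
  using assms unfolding multivalued_holomorphic_on_def by blast

lemma branch_holomorphic:
  assumes "multivalued_holomorphic_on U F" "p \<in> U" "\<phi> \<in> F p"
  shows "holomorphic_near p \<phi>"
proof -
  have "\<exists>\<psi>\<in>F p. continues_to U p \<phi> p \<psi>"
    by (rule branch_continues[OF assms assms(2)])
  then obtain \<gamma> \<Phi> where "continuation_along \<gamma> \<Phi>" "pathstart \<gamma> = p" "\<Phi> 0 = \<phi>"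
    unfolding continues_to_def by blast
  thus ?thesis
    unfolding continuation_along_def pathstart_def by force
qed

text \<open>Phrased branch by branch, which is convenient for computing, whereas
  \<open>act_multi\<close> compares sets of germs. The two views agree because a multi-valued
  holomorphic function has a branch at every point of \<open>U\<close>.\<close>

definition annihilator :: "(complex^'n::finite) set \<Rightarrow> 'n multifun \<Rightarrow> 'n weyl set"
  where "annihilator U F = {P. \<forall>p\<in>U. \<forall>\<phi>\<in>F p. germ_eq p (act P \<phi>) (\<lambda>_. 0)}"

lemma left_ideal_annihilator:
  assumes F: "multivalued_holomorphic_on U F"
  shows "left_ideal (annihilator U F)"
  unfolding left_ideal_def
proof (intro conjI ballI allI)
  show "0 \<in> annihilator U F"
    by (simp add: annihilator_def act_zero[abs_def])
next
  fix P Q assume PQ: "P \<in> annihilator U F" "Q \<in> annihilator U F"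
  have "germ_eq p (act (P + Q) \<phi>) (\<lambda>_. 0)" if "p \<in> U" "\<phi> \<in> F p" for p \<phi>
  proof -
    have "germ_eq p (act P \<phi>) (\<lambda>_. 0)" "germ_eq p (act Q \<phi>) (\<lambda>_. 0)"
      using PQ that by (auto simp: annihilator_def)
    thus ?thesis
      unfolding germ_eq_def by (rule eventually_elim2) (simp add: act_add)
  qed
  thus "P + Q \<in> annihilator U F" by (simp add: annihilator_def)
next
  fix P Q assume Q: "Q \<in> annihilator U F"
  have "germ_eq p (act (P * Q) \<phi>) (\<lambda>_. 0)" if p: "p \<in> U" "\<phi> \<in> F p" for p \<phi>
  proof -
    have "germ_eq p (act P (act Q \<phi>)) (act P (\<lambda>_. 0))"
      using Q p by (intro germ_eq_act) (auto simp: annihilator_def)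
    thus ?thesis
      using germ_eq_trans[OF germ_eq_act_mult[OF branch_holomorphic[OF F p]]]
      unfolding act_zero_function by blast
  qed
  thus "P * Q \<in> annihilator U F" by (simp add: annihilator_def)
qed

lemma annihilator_iff:
  assumes F: "multivalued_holomorphic_on U F"
  shows "P \<in> annihilator U F \<longleftrightarrow> multifun_eq_on U (act_multi P F) zero_multifun"
proof
  assume P: "P \<in> annihilator U F"
  have "act_multi P F p = zero_multifun p" if p: "p \<in> U" for p
  proof -
    have "germ_eq p \<psi> (act P \<phi>) \<longleftrightarrow> germ_eq p \<psi> (\<lambda>_. 0)" if "\<phi> \<in> F p" for \<phi> \<psi>
      using P p that unfolding annihilator_def by (blast intro: germ_eq_trans germ_eq_sym)
    moreover have "F p \<noteq> {}"
      using F p by (auto simp: multivalued_holomorphic_on_def)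
    ultimately show ?thesis
      unfolding act_multi_def zero_multifun_def by blast
  qed
  thus "multifun_eq_on U (act_multi P F) zero_multifun"
    by (simp add: multifun_eq_on_def)
next
  assume eq: "multifun_eq_on U (act_multi P F) zero_multifun"
  have "germ_eq p (act P \<phi>) (\<lambda>_. 0)" if "p \<in> U" "\<phi> \<in> F p" for p \<phi>
  proof -
    have "act P \<phi> \<in> act_multi P F p"
      unfolding act_multi_def using that germ_eq_refl by blast
    thus ?thesis
      using eq that by (simp add: multifun_eq_on_def zero_multifun_def)
  qed
  thus "P \<in> annihilator U F" by (simp add: annihilator_def)
qed

text \<open>Every branch at any point continues to some branch at \<open>q\<close>, and the
  vanishing there is carried back along the path. Hence a relation known on a part of
  \<open>U\<close> determines membership in the annihilator.\<close>

lemma annihilator_of_open_part: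
  assumes F: "multivalued_holomorphic_on U F" and q: "q \<in> U"
    and zero: "\<And>\<psi>. \<psi> \<in> F q \<Longrightarrow> germ_eq q (act P \<psi>) (\<lambda>_. 0)"
  shows "P \<in> annihilator U F"
  unfolding annihilator_def
proof (intro CollectI ballI)
  fix p \<phi> assume p: "p \<in> U" "\<phi> \<in> F p"
  obtain \<psi> \<gamma> \<Phi> where "\<psi> \<in> F q" "path \<gamma>" "pathstart \<gamma> = p" "pathfinish \<gamma> = q"
    "continuation_along \<gamma> \<Phi>" "\<Phi> 0 = \<phi>" "\<Phi> 1 = \<psi>"
    using branch_continues[OF F p q] unfolding continues_to_def by blast
  thus "germ_eq p (act P \<phi>) (\<lambda>_. 0)"
    using continuation_act_zero[of \<gamma> \<Phi> P] zero[of \<psi>] by (simp add: pathstart_def pathfinish_def)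
qed

section \<open>Overlap of Zariski open sets\<close>

lemma mpoly_on_line:
  fixes p v :: "complex^'n::finite"
  shows "\<exists>r. \<forall>t. mpoly_eval q (p + t *s v) = poly r t"
proof -
  define r where "r = (\<Sum>a\<in>Poly_Mapping.keys q. smult (Poly_Mapping.lookup q a) (\<Prod>i\<in>UNIV. [:p $ i, v $ i:] ^ (a $ i)))"
  have "mpoly_eval q (p + t *s v) = poly r t" for t
    by (simp add: mpoly_eval_def monom_eval_def r_def poly_sum poly_prod)
  thus ?thesis by blast
qed

text \<open>Along the line through a point of each set, at parameters 0 and 1, each set contains the
  points where some univariate polynomial is nonzero. Neither polynomial is zero, so their product
  has only finitely many roots.\<close>

lemma zariski_open_Int_nonempty:
  fixes U V :: "(complex^'n::finite) set"
  assumes "zariski_open U" "zariski_open V" "U \<noteq> {}" "V \<noteq> {}"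
  shows "U \<inter> V \<noteq> {}"
proof -
  have basic: "\<exists>p q. mpoly_eval q p \<noteq> 0 \<and> (\<forall>z. mpoly_eval q z \<noteq> 0 \<longrightarrow> z \<in> W)"
    if "zariski_open W" "W \<noteq> {}" for W :: "(complex^'n) set"
    using that unfolding zariski_open_def by blast
  obtain p1 q1 where 1: "mpoly_eval q1 p1 \<noteq> 0" "\<And>z. mpoly_eval q1 z \<noteq> 0 \<Longrightarrow> z \<in> U"
    using basic[OF assms(1,3)] by blast
  obtain p2 q2 where 2: "mpoly_eval q2 p2 \<noteq> 0" "\<And>z. mpoly_eval q2 z \<noteq> 0 \<Longrightarrow> z \<in> V"
    using basic[OF assms(2,4)] by blast
  obtain r1 where r1: "\<And>t. mpoly_eval q1 (p1 + t *s (p2 - p1)) = poly r1 t"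
    using mpoly_on_line by blast
  obtain r2 where r2: "\<And>t. mpoly_eval q2 (p1 + t *s (p2 - p1)) = poly r2 t"
    using mpoly_on_line by blast
  have "r1 * r2 \<noteq> 0"
    using r1[of 0] r2[of 1] 1(1) 2(1) by auto
  hence "finite {t. poly (r1 * r2) t = 0}" by (rule poly_roots_finite)
  then obtain t where "poly (r1 * r2) t \<noteq> 0"
    using infinite_UNIV_char_0[where 'a = complex] by (metis (mono_tags, lifting) UNIV_I ex_new_if_finite mem_Collect_eq)
  hence "p1 + t *s (p2 - p1) \<in> U" "p1 + t *s (p2 - p1) \<in> V"
    using 1(2) 2(2) r1[of t] r2[of t] by simp_all
  thus ?thesis by blast
qed

text \<open>At a common point of \<open>U\<close> and \<open>V\<close> the germs of \<open>E\<close>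
  applied to \<open>f\<close> are branches of \<open>g\<close>, hence killed by \<open>P\<close>;
  continuation within \<open>U\<close> does the rest. In module terms, the submodule generated by
  \<open>E\<close> in D modulo the annihilator of \<open>f\<close> is a quotient of D modulo the
  annihilator of \<open>g\<close>.\<close>

lemma annihilator_mult_right:
  fixes g f :: "'n::finite multifun"
  assumes f: "multivalued_holomorphic_on U f" and g: "multivalued_holomorphic_on V g"
    and "zariski_open U" "zariski_open V"
    and eq: "multifun_eq_on (U \<inter> V) (act_multi E f) g" and P: "P \<in> annihilator V g"
  shows "P * E \<in> annihilator U f"
proof -
  have "U \<noteq> {}" "V \<noteq> {}"
    using f g by (simp_all add: multivalued_holomorphic_on_def)
  then obtain q where q: "q \<in> U" "q \<in> V"
    using zariski_open_Int_nonempty assms(3,4) by blast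
  show ?thesis
  proof (rule annihilator_of_open_part[OF f q(1)])
    fix \<psi> assume \<psi>: "\<psi> \<in> f q"
    hence "act E \<psi> \<in> act_multi E f q"
      unfolding act_multi_def using germ_eq_refl by blast
    hence "act E \<psi> \<in> g q"
      using eq q by (simp add: multifun_eq_on_def)
    hence "germ_eq q (act P (act E \<psi>)) (\<lambda>_. 0)"
      using P q by (simp add: annihilator_def)
    thus "germ_eq q (act (P * E) \<psi>) (\<lambda>_. 0)"
      using germ_eq_trans[OF germ_eq_act_mult[OF branch_holomorphic[OF f q(1) \<psi>]]] by blast
  qed
qed

section \<open>Holonomic growth\<close>

text \<open>
  In contrast to the definition of holonomicity, no Hilbert polynomial is required, and the
  elements spanning the image of \<open>F\<^sub>k\<close> in \<open>D/I\<close> may have arbitrary degree.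
\<close>

definition holonomic_growth :: "'n::finite weyl set \<Rightarrow> bool"
  where "holonomic_growth I \<longleftrightarrow> (\<exists>C. \<forall>k. \<exists>W. finite W \<and> card W \<le> C * (k + 1) ^ CARD('n) \<and>
    (\<forall>P\<in>bernstein k. \<exists>S\<in>weyl.span W. P - S \<in> I))"

lemma holonomic_growthE:
  fixes I :: "'n::finite weyl set"
  assumes "holonomic_growth I"
  obtains C W where "\<And>k. finite (W k)" "\<And>k. card (W k) \<le> C * (k + 1) ^ CARD('n)"
    "\<And>k P. P \<in> bernstein k \<Longrightarrow> \<exists>S\<in>weyl.span (W k). P - S \<in> I"
proof -
  obtain C where "\<forall>k. \<exists>W. finite W \<and> card W \<le> C * (k + 1) ^ CARD('n) \<and>
    (\<forall>P\<in>bernstein k. \<exists>S\<in>weyl.span W. P - S \<in> I)"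
    using assms unfolding holonomic_growth_def by (rule exE)
  then obtain W where "\<forall>k. finite (W k) \<and> card (W k) \<le> C * (k + 1) ^ CARD('n) \<and>
    (\<forall>P\<in>bernstein k. \<exists>S\<in>weyl.span (W k). P - S \<in> I)"
    by (rule choice[THEN exE])
  thus ?thesis by (intro that[of W C]) simp_all
qed

text \<open>Standard monomials are independent modulo \<open>I\<close>, and this passes to any
  representatives \<open>w m\<close> chosen in the span of \<open>W\<close>. The degrees of the
  elements of \<open>W\<close> never enter.\<close>

lemma card_std_monoms_le:
  assumes I: "left_ideal I" and W: "finite W" "\<And>P. P \<in> bernstein k \<Longrightarrow> \<exists>S\<in>weyl.span W. P - S \<in> I"
  shows "card (std_monoms I k) \<le> card W"
proof -
  note sub = left_ideal_subspace[OF I]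
  have "\<exists>S. S \<in> weyl.span W \<and> wmon m - S \<in> I" if "m \<in> std_monoms I k" for m
    using W(2)[OF wmon_in_bernstein[of m k]] that unfolding std_monoms_def by blast
  then obtain w where w: "\<And>m. m \<in> std_monoms I k \<Longrightarrow> w m \<in> weyl.span W \<and> wmon m - w m \<in> I"
    by metis
  have fin: "finite (std_monoms I k)" by (rule finite_std_monoms)
  have indep: "u m = 0" if "(\<Sum>m\<in>std_monoms I k. wscale (u m) (w m)) = 0" "m \<in> std_monoms I k" for u m
  proof -
    let ?S = "\<Sum>m\<in>std_monoms I k. wscale (u m) (wmon m)"
    have "(\<Sum>m\<in>std_monoms I k. wscale (u m) (wmon m - w m)) \<in> I"
      using w by (intro weyl.subspace_sum[OF sub] weyl.subspace_scale[OF sub]) auto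
    hence "?S \<in> I"
      using that(1) by (simp add: weyl.scale_right_diff_distrib sum_subtractf)
    moreover have "?S \<in> weyl.span (wmon ` std_monoms I k)"
      by (rule weyl.span_sum, rule weyl.span_scale, rule weyl.span_base) simp
    ultimately have "?S = 0" by (intro std_independent_mod)
    hence "wcf ?S m = 0" by simp
    thus ?thesis
      using that(2) fin by (simp add: wcf_sum wcf_wmon if_distrib cong: if_cong)
  qed
  have inj: "inj_on w (std_monoms I k)"
  proof (rule inj_onI)
    fix p q assume pq: "p \<in> std_monoms I k" "q \<in> std_monoms I k" "w p = w q"
    show "p = q"
    proof (rule ccontr)
      assume ne: "p \<noteq> q"
      define u where "u m = (if m = p then 1 else if m = q then -1 else 0 :: complex)" for m
      have "(\<Sum>m\<in>std_monoms I k. wscale (u m) (w m)) = (\<Sum>m\<in>{p, q}. wscale (u m) (w m))"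
        using pq by (intro sum.mono_neutral_right fin) (auto simp: u_def)
      also have "\<dots> = 0"
        using ne pq(3) by (simp add: u_def)
      finally have "u p = 0" using indep pq(1) by blast
      thus False by (simp add: u_def)
    qed
  qed
  have "weyl.independent (w ` std_monoms I k)"
  proof
    assume "weyl.dependent (w ` std_monoms I k)"
    then obtain u v where u: "v \<in> w ` std_monoms I k" "u v \<noteq> 0" "(\<Sum>v\<in>w ` std_monoms I k. wscale (u v) v) = 0"
      using weyl.dependent_finite[of "w ` std_monoms I k"] fin by auto
    have "(\<Sum>m\<in>std_monoms I k. wscale (u (w m)) (w m)) = 0"
      using u(3) by (simp add: sum.reindex[OF inj])
    thus False
      using indep[of "\<lambda>m. u (w m)"] u(1,2) by auto
  qed
  moreover have "w ` std_monoms I k \<subseteq> weyl.span W" using w by auto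
  ultimately have "card (w ` std_monoms I k) \<le> card W"
    using weyl.independent_span_bound[OF W(1)] by blast
  thus ?thesis by (simp add: card_image[OF inj])
qed

text \<open>The standard monomials are the smallest possible choice of \<open>W\<close>, so growth
  becomes a bound on the Hilbert function.\<close>

lemma holonomic_growth_iff_std:
  fixes I :: "'n::finite weyl set"
  assumes I: "left_ideal I"
  shows "holonomic_growth I \<longleftrightarrow> (\<exists>C. \<forall>k. card (std_monoms I k) \<le> C * (k + 1) ^ CARD('n))"
proof
  assume "holonomic_growth I"
  then obtain C W where W: "\<And>k. finite (W k)" "\<And>k. card (W k) \<le> C * (k + 1) ^ CARD('n)"
    "\<And>k P. P \<in> bernstein k \<Longrightarrow> \<exists>S\<in>weyl.span (W k). P - S \<in> I"
    using holonomic_growthE by metis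
  have "card (std_monoms I k) \<le> C * (k + 1) ^ CARD('n)" for k
    using card_std_monoms_le[OF I W(1,3)] W(2) le_trans by blast
  thus "\<exists>C. \<forall>k. card (std_monoms I k) \<le> C * (k + 1) ^ CARD('n)" by blast
next
  assume "\<exists>C. \<forall>k. card (std_monoms I k) \<le> C * (k + 1) ^ CARD('n)"
  then obtain C where C: "\<forall>k. card (std_monoms I k) \<le> C * (k + 1) ^ CARD('n)" by (rule exE)
  have "finite (wmon ` std_monoms I k) \<and> card (wmon ` std_monoms I k) \<le> C * (k + 1) ^ CARD('n) \<and>
    (\<forall>P\<in>bernstein k. \<exists>S\<in>weyl.span (wmon ` std_monoms I k). P - S \<in> I)" for k
    using C std_reduction[OF I] by (simp add: finite_std_monoms card_image[OF inj_on_subset[OF inj_wmon]])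
  thus "holonomic_growth I"
    unfolding holonomic_growth_def by (intro exI[of _ C] allI) (rule exI)
qed

section \<open>Growth in extensions\<close>

definition adjoin :: "'n::finite weyl set \<Rightarrow> 'n weyl \<Rightarrow> 'n weyl set"
  where "adjoin I E = {P + Q * E | P Q. P \<in> I}"

lemma left_ideal_adjoin:
  assumes I: "left_ideal I"
  shows "left_ideal (adjoin I E)"
  unfolding left_ideal_def
proof (intro conjI ballI allI)
  show "0 \<in> adjoin I E"
    unfolding adjoin_def using I by (intro CollectI exI[of _ 0]) (simp add: left_ideal_def)
next
  fix P Q assume "P \<in> adjoin I E" "Q \<in> adjoin I E"
  then obtain P1 P2 Q1 Q2 where *: "P = P1 + P2 * E" "P1 \<in> I" "Q = Q1 + Q2 * E" "Q1 \<in> I"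
    unfolding adjoin_def by blast
  have "P + Q = (P1 + Q1) + (P2 + Q2) * E" "P1 + Q1 \<in> I"
    using * I by (simp_all add: algebra_simps left_ideal_def)
  thus "P + Q \<in> adjoin I E" unfolding adjoin_def by blast
next
  fix P Q assume "Q \<in> adjoin I E"
  then obtain Q1 Q2 where *: "Q = Q1 + Q2 * E" "Q1 \<in> I"
    unfolding adjoin_def by blast
  have "P * Q = P * Q1 + (P * Q2) * E" "P * Q1 \<in> I"
    using * I by (simp_all add: distrib_left mult.assoc left_ideal_def)
  thus "P * Q \<in> adjoin I E" unfolding adjoin_def by blast
qed

lemma adjoin_superset: "I \<subseteq> adjoin I E"
proof
  fix P assume "P \<in> I"
  hence "P = P + 0 * E \<and> P \<in> I" by simp
  thus "P \<in> adjoin I E" unfolding adjoin_def by blast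
qed

lemma adjoin_self: "left_ideal I \<Longrightarrow> E \<in> adjoin I E"
  unfolding adjoin_def by (intro CollectI exI[of _ 0] exI[of _ 1]) (simp add: left_ideal_def)

lemma span_mult_right:
  assumes "S \<in> weyl.span W"
  shows "S * E \<in> weyl.span ((\<lambda>w. w * E) ` W)"
  using assms
proof (induction rule: weyl.span_induct_alt)
  case (step c x y)
  have "(wscale c x + y) * E = wscale c (x * E) + y * E"
    by (simp add: distrib_right wscale_mult_left)
  moreover have "x * E \<in> weyl.span ((\<lambda>w. w * E) ` W)"
    using step by (intro weyl.span_base) auto
  ultimately show ?case
    using step by (simp add: weyl.span_add weyl.span_scale)
qed (simp add: weyl.span_zero)

text \<open>
  Extensions of modules of holonomic growth: \<open>D/I\<close> is an extension of
  \<open>D/(I + DE)\<close> by the submodule generated by \<open>E\<close>. Generators of \<open>I + DE\<close>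
  that are compatible with the filtration control the filtration induced on this submodule.
\<close>

lemma holonomic_growth_extension:
  fixes I K :: "'n::finite weyl set"
  assumes I: "left_ideal I" and quot: "holonomic_growth (adjoin I E)"
    and K: "holonomic_growth K" "\<And>P. P \<in> K \<Longrightarrow> P * E \<in> I"
  shows "holonomic_growth I"
proof -
  let ?J = "adjoin I E"
  have J: "left_ideal ?J" by (rule left_ideal_adjoin[OF I])
  note sub = left_ideal_subspace[OF I]
  obtain C1 where C1: "\<forall>k. card (std_monoms ?J k) \<le> C1 * (k + 1) ^ CARD('n)"
    using quot unfolding holonomic_growth_iff_std[OF J] by (rule exE)
  obtain C2 W where W: "\<And>k. finite (W k)" "\<And>k. card (W k) \<le> C2 * (k + 1) ^ CARD('n)"
    "\<And>k P. P \<in> bernstein k \<Longrightarrow> \<exists>S\<in>weyl.span (W k). P - S \<in> K"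
    using holonomic_growthE[OF K(1)] by metis
  obtain G where G: "finite G" "G \<subseteq> ?J"
    "\<And>k P. P \<in> ?J \<Longrightarrow> P \<in> bernstein k \<Longrightarrow> \<exists>R. (\<forall>g\<in>G. R g \<in> bernstein k) \<and> P = (\<Sum>g\<in>G. R g * g)"
    using filtered_generators[OF J] by (metis IntI)
  have "\<exists>P Q. P \<in> I \<and> g = P + Q * E" if "g \<in> G" for g
    using G(2) that unfolding adjoin_def by blast
  then obtain A B where AB: "\<And>g. g \<in> G \<Longrightarrow> A g \<in> I \<and> g = A g + B g * E"
    by metis
  have "\<forall>g. \<exists>k. B g \<in> bernstein k" using exists_bernstein by blast
  then obtain d where d: "\<And>g. B g \<in> bernstein (d g)" by metis
  \<comment> \<open>A bound for the degrees of the cofactors of \<open>E\<close> in the finitely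
    many generators, independent of \<open>k\<close>. An element of degree \<open>k\<close> then
    needs a cofactor of degree at most \<open>k + c\<close>, which costs only a constant factor in
    the growth.\<close>
  define c where "c = (\<Sum>g\<in>G. d g)"
  have c: "B g \<in> bernstein c" if "g \<in> G" for g
    using d[of g] bernstein_mono[of "d g" c] member_le_sum[of g G d] that G(1) by (auto simp: c_def)
  \<comment> \<open>The two layers of the extension: standard monomials for the quotient, and
    multiples of \<open>E\<close> for the submodule generated by it.\<close>
  define V where "V k = wmon ` std_monoms ?J k \<union> (\<lambda>w. w * E) ` W (k + c)" for k
  have fin: "finite (V k)" for k
    by (simp add: V_def finite_std_monoms W(1))
  have card: "card (V k) \<le> (C1 + C2 * (c + 1) ^ CARD('n)) * (k + 1) ^ CARD('n)" for k
  proof -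
    have "card (V k) \<le> card (std_monoms ?J k) + card (W (k + c))"
      unfolding V_def using card_Un_le card_image_le finite_std_monoms W(1)
      by (meson add_mono le_trans)
    also have "\<dots> \<le> C1 * (k + 1) ^ CARD('n) + C2 * (k + c + 1) ^ CARD('n)"
      using C1 W(2) by (intro add_mono) auto
    also have "\<dots> \<le> C1 * (k + 1) ^ CARD('n) + C2 * ((c + 1) * (k + 1)) ^ CARD('n)"
      by (intro add_mono mult_le_mono power_mono) (simp_all add: algebra_simps)
    also have "\<dots> = (C1 + C2 * (c + 1) ^ CARD('n)) * (k + 1) ^ CARD('n)"
      unfolding power_mult_distrib by (simp add: distrib_right mult.assoc)
    finally show ?thesis .
  qed
  have cover: "\<exists>S\<in>weyl.span (V k). P - S \<in> I" if P: "P \<in> bernstein k" for P k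
  proof -
    obtain S1 where S1: "S1 \<in> weyl.span (wmon ` std_monoms ?J k)" "P - S1 \<in> ?J"
      using std_reduction[OF J P] by blast
    have "S1 \<in> bernstein k"
      using wsupp_span_wmon[OF S1(1)] by (auto simp: bernstein_iff std_monoms_def)
    hence "P - S1 \<in> bernstein k"
      using P weyl.subspace_diff[OF subspace_bernstein] by blast
    then obtain R where R: "\<forall>g\<in>G. R g \<in> bernstein k" "P - S1 = (\<Sum>g\<in>G. R g * g)"
      using G(3)[OF S1(2)] by metis
    define T where "T = (\<Sum>g\<in>G. R g * B g)"
    have "T \<in> bernstein (k + c)"
      unfolding T_def using R(1) c by (intro weyl.subspace_sum[OF subspace_bernstein] mult_bernstein) auto
    then obtain S2 where S2: "S2 \<in> weyl.span (W (k + c))" "T - S2 \<in> K"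
      using W(3) by blast
    have "(\<Sum>g\<in>G. R g * g) = (\<Sum>g\<in>G. R g * A g + R g * B g * E)"
      using AB by (intro sum.cong) (metis distrib_left mult.assoc)+
    hence "P - S1 = (\<Sum>g\<in>G. R g * A g) + T * E"
      using R(2) by (simp add: sum.distrib T_def sum_distrib_right)
    hence "P - (S1 + S2 * E) = (\<Sum>g\<in>G. R g * A g) + (T - S2) * E"
      by (simp add: algebra_simps)
    moreover have "(\<Sum>g\<in>G. R g * A g) \<in> I"
      using AB left_ideal_mult[OF I] by (intro weyl.subspace_sum[OF sub]) auto
    ultimately have "P - (S1 + S2 * E) \<in> I"
      using K(2)[OF S2(2)] weyl.subspace_add[OF sub] by metis
    moreover have "S1 + S2 * E \<in> weyl.span (V k)"
      using S1(1) span_mult_right[OF S2(1), of E] unfolding V_def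
      by (intro weyl.span_add) (meson Un_upper1 Un_upper2 subsetD weyl.span_mono)+
    ultimately show ?thesis by blast
  qed
  have "finite (V k) \<and> card (V k) \<le> (C1 + C2 * (c + 1) ^ CARD('n)) * (k + 1) ^ CARD('n) \<and>
    (\<forall>P\<in>bernstein k. \<exists>S\<in>weyl.span (V k). P - S \<in> I)" for k
    using fin card cover by blast
  thus ?thesis
    unfolding holonomic_growth_def by (intro exI[of _ "C1 + C2 * (c + 1) ^ CARD('n)"] allI) (rule exI)
qed

text \<open>The elements \<open>E x\<close> are adjoined one at a time; the ideal \<open>K\<close>
  belonging to \<open>x\<close> keeps its property when \<open>I\<close> grows. Quantifying over all
  left ideals \<open>J\<close> above \<open>I\<close> avoids writing down the ideal generated at the
  end of the chain.\<close>

lemma holonomic_growth_finite_extension: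
  fixes I :: "'n::finite weyl set"
  assumes "finite X" "left_ideal I"
    and "\<And>x. x \<in> X \<Longrightarrow> \<exists>K. holonomic_growth K \<and> (\<forall>P\<in>K. P * E x \<in> I)"
    and "\<And>J. left_ideal J \<Longrightarrow> I \<subseteq> J \<Longrightarrow> \<forall>x\<in>X. E x \<in> J \<Longrightarrow> holonomic_growth J"
  shows "holonomic_growth I"
  using assms
proof (induction X arbitrary: I rule: finite_induct)
  case empty
  thus ?case by blast
next
  case (insert x X)
  let ?J = "adjoin I (E x)"
  have J: "left_ideal ?J" using insert.prems(1) by (rule left_ideal_adjoin)
  have "holonomic_growth ?J"
  proof (rule insert.IH[OF J])
    fix y assume "y \<in> X"
    then obtain K where "holonomic_growth K" "\<forall>P\<in>K. P * E y \<in> I"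
      using insert.prems(2)[of y] by auto
    thus "\<exists>K. holonomic_growth K \<and> (\<forall>P\<in>K. P * E y \<in> ?J)"
      using adjoin_superset by blast
  next
    fix J' assume J': "left_ideal J'" "?J \<subseteq> J'" "\<forall>x\<in>X. E x \<in> J'"
    moreover have "E x \<in> J'"
      using adjoin_self[OF insert.prems(1)] J'(2) by blast
    ultimately show "holonomic_growth J'"
      using adjoin_superset[of I "E x"] by (intro insert.prems(3)) auto
  qed
  moreover obtain K where "holonomic_growth K" "\<forall>P\<in>K. P * E x \<in> I"
    using insert.prems(2)[of x] by auto
  ultimately show ?case
    using holonomic_growth_extension[OF insert.prems(1)] by blast
qed

section \<open>Bernstein's inequality\<close>

text \<open>Elimination with pivot \<open>c e b\<close>: the equation \<open>b\<close> removes the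
  unknown \<open>e\<close>, and back substitution recovers its value. It provides the dimension
  count behind Bernstein's inequality.\<close>

lemma homogeneous_system_solution:
  fixes c :: "'a \<Rightarrow> 'b \<Rightarrow> 'c::field"
  assumes "finite B" "finite A" "card B < card A"
  shows "\<exists>x. (\<exists>a\<in>A. x a \<noteq> 0) \<and> (\<forall>b\<in>B. (\<Sum>a\<in>A. c a b * x a) = 0)"
  using assms
proof (induction B arbitrary: A c rule: finite_induct)
  case empty
  then obtain a where "a \<in> A" by fastforce
  thus ?case by (intro exI[of _ "\<lambda>_. 1"]) auto
next
  case (insert b B)
  show ?case
  proof (cases "\<forall>a\<in>A. c a b = 0")
    case True
    obtain x where "(\<exists>a\<in>A. x a \<noteq> 0) \<and> (\<forall>b\<in>B. (\<Sum>a\<in>A. c a b * x a) = 0)"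
      using insert.IH[of A c] insert.prems insert.hyps by auto
    thus ?thesis using True by (intro exI[of _ x]) simp
  next
    case False
    then obtain e where e: "e \<in> A" "c e b \<noteq> 0" by blast
    let ?A = "A - {e}"
    define c' where "c' a b' = c a b' - c e b' * c a b / c e b" for a b'
    have "card B < card ?A"
      using insert.prems insert.hyps e(1) by simp
    then obtain y where y: "\<exists>a\<in>?A. y a \<noteq> 0" "\<forall>b\<in>B. (\<Sum>a\<in>?A. c' a b * y a) = 0"
      using insert.IH[of ?A c'] insert.prems by auto
    define x where "x = y(e := - (\<Sum>a\<in>?A. c a b * y a) / c e b)"
    have split: "(\<Sum>a\<in>A. c a b' * x a) = c e b' * x e + (\<Sum>a\<in>?A. c a b' * y a)" for b'
    proof -
      have "(\<Sum>a\<in>A. c a b' * x a) = c e b' * x e + (\<Sum>a\<in>?A. c a b' * x a)"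
        using e(1) insert.prems(1) by (intro sum.remove)
      also have "(\<Sum>a\<in>?A. c a b' * x a) = (\<Sum>a\<in>?A. c a b' * y a)"
        by (rule sum.cong) (auto simp: x_def)
      finally show ?thesis .
    qed
    have "(\<Sum>a\<in>A. c a b * x a) = 0"
      unfolding split using e(2) by (simp add: x_def)
    moreover have "(\<Sum>a\<in>A. c a b' * x a) = 0" if "b' \<in> B" for b'
    proof -
      have "(\<Sum>a\<in>?A. c' a b' * y a) = (\<Sum>a\<in>?A. c a b' * y a) - c e b' * (\<Sum>a\<in>?A. c a b * y a) / c e b"
        by (simp add: c'_def left_diff_distrib sum_subtractf sum_distrib_left sum_divide_distrib mult.assoc)
      thus ?thesis
        unfolding split using y(2) that by (simp add: x_def)
    qed
    moreover have "\<exists>a\<in>A. x a \<noteq> 0"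
      using y(1) by (auto simp: x_def)
    ultimately show ?thesis by blast
  qed
qed

lemma wterm_const_in_proper_ideal:
  assumes I: "left_ideal I" "1 \<notin> I" and P: "P \<in> I" "P \<in> bernstein 0"
  shows "P = 0"
proof (rule ccontr)
  assume "P \<noteq> 0"
  have "P = wscale (wcf P (0, 0)) 1"
  proof (rule weyl_eqI)
    fix m
    show "wcf P m = wcf (wscale (wcf P (0, 0)) 1) m"
    proof (cases "m = (0, 0)")
      case True
      thus ?thesis by (simp add: one_weyl_def wcf_wterm)
    next
      case False
      hence "tdeg m \<noteq> 0"
        by (auto simp: tdeg_def prod_eq_iff vec_eq_iff)
      hence "wcf P m = 0"
        using P(2) unfolding bernstein_iff_wcf by fastforce
      thus ?thesis using False by (simp add: one_weyl_def wcf_wterm)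
    qed
  qed
  moreover from this have "wcf P (0, 0) \<noteq> 0"
    using \<open>P \<noteq> 0\<close> by auto
  ultimately have "1 = wscale (inverse (wcf P (0, 0))) P"
    by (metis field_class.field_inverse weyl.scale_one weyl.scale_scale)
  thus False
    using I P(1) weyl.subspace_scale[OF left_ideal_subspace[OF I(1)]] by metis
qed

text \<open>The commutators of \<open>P\<close> with the generators have lower degree.\<close>

lemma bernstein_action_faithful:
  fixes P :: "'n::finite weyl"
  assumes I: "left_ideal I" "1 \<notin> I"
  shows "P \<in> bernstein k \<Longrightarrow> (\<And>Q. Q \<in> bernstein k \<Longrightarrow> P * Q \<in> I) \<Longrightarrow> P = 0"
proof (induction k arbitrary: P)
  case 0
  have "(1 :: 'n weyl) \<in> bernstein 0"
    by (simp add: one_weyl_def wterm_in_bernstein tdeg_def)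
  hence "P \<in> I" using "0.prems"(2)[of 1] by simp
  thus ?case using wterm_const_in_proper_ideal[OF I] "0.prems"(1) by blast
next
  case (Suc k)
  note sub = left_ideal_subspace[OF I(1)]
  have up: "Q \<in> bernstein (Suc k)" "wx i * Q \<in> bernstein (Suc k)" "wd i * Q \<in> bernstein (Suc k)"
    if "Q \<in> bernstein k" for Q :: "'n weyl" and i
  proof -
    show "Q \<in> bernstein (Suc k)" using that bernstein_mono[of k "Suc k"] by auto
    have "wx i \<in> (bernstein 1 :: 'n weyl set)" "wd i \<in> (bernstein 1 :: 'n weyl set)"
      unfolding wx_def wd_def by (rule wterm_in_bernstein; simp add: tdeg_def axis_def)+
    thus "wx i * Q \<in> bernstein (Suc k)" "wd i * Q \<in> bernstein (Suc k)"
      using mult_bernstein[OF _ that, of _ 1] by (simp_all only: Suc_eq_plus1_left)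
  qed
  \<comment> \<open>The induction hypothesis applies to the commutator, as its product with
    \<open>Q\<close> is \<open>P * (wx i * Q) - wx i * (P * Q)\<close>, and \<open>wx i * Q\<close>
    still has degree at most \<open>Suc k\<close>.\<close>
  have "P * wx i - wx i * P = 0" for i
  proof (rule Suc.IH)
    show "P * wx i - wx i * P \<in> bernstein k"
      unfolding bernstein_iff_wcf
    proof (intro allI impI)
      fix m assume m: "wcf (P * wx i - wx i * P) m \<noteq> 0"
      obtain a b where ab: "m = (a, b)" by (cases m)
      have "wcf P (a, b + axis i 1) \<noteq> 0"
        using m unfolding ab wcf_commutator_wx by simp
      hence "tdeg (a, b + axis i 1) \<le> Suc k"
        using Suc.prems(1) unfolding bernstein_iff_wcf by blast
      thus "tdeg m \<le> k" by (simp add: ab)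
    qed
  next
    fix Q :: "'n weyl" assume Q: "Q \<in> bernstein k"
    have "P * (wx i * Q) - wx i * (P * Q) \<in> I"
      by (intro weyl.subspace_diff[OF sub] left_ideal_mult[OF I(1)] Suc.prems(2) up Q)
    thus "(P * wx i - wx i * P) * Q \<in> I"
      by (simp add: left_diff_distrib mult.assoc)
  qed
  hence x: "wcf P (a, b + axis i 1) = 0" for a b i
    using wcf_commutator_wx[of P i a b] by (simp del: of_nat_add)
  have "wd i * P - P * wd i = 0" for i
  proof (rule Suc.IH)
    show "wd i * P - P * wd i \<in> bernstein k"
      unfolding bernstein_iff_wcf
    proof (intro allI impI)
      fix m assume m: "wcf (wd i * P - P * wd i) m \<noteq> 0"
      obtain a b where ab: "m = (a, b)" by (cases m)
      have "wcf P (a + axis i 1, b) \<noteq> 0"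
        using m unfolding ab wcf_commutator_wd by simp
      hence "tdeg (a + axis i 1, b) \<le> Suc k"
        using Suc.prems(1) unfolding bernstein_iff_wcf by blast
      thus "tdeg m \<le> k" by (simp add: ab)
    qed
  next
    fix Q :: "'n weyl" assume Q: "Q \<in> bernstein k"
    have "wd i * (P * Q) - P * (wd i * Q) \<in> I"
      by (intro weyl.subspace_diff[OF sub] left_ideal_mult[OF I(1)] Suc.prems(2) up Q)
    thus "(wd i * P - P * wd i) * Q \<in> I"
      by (simp add: left_diff_distrib mult.assoc)
  qed
  hence d: "wcf P (a + axis i 1, b) = 0" for a b i
    using wcf_commutator_wd[of i P a b] by (simp del: of_nat_add)
  have "P \<in> bernstein 0"
    unfolding bernstein_iff_wcf
  proof (intro allI impI)
    fix m assume m: "wcf P m \<noteq> 0"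
    obtain a b where ab: "m = (a, b)" by (cases m)
    have "a $ i = 0" for i
    proof (rule ccontr)
      assume "a $ i \<noteq> 0"
      hence "a = (a - axis i 1) + axis i 1" by (auto simp: vec_eq_iff axis_def)
      thus False using d[of "a - axis i 1" i b] m ab by simp
    qed
    moreover have "b $ i = 0" for i
    proof (rule ccontr)
      assume "b $ i \<noteq> 0"
      hence "b = (b - axis i 1) + axis i 1" by (auto simp: vec_eq_iff axis_def)
      thus False using x[of a "b - axis i 1" i] m ab by simp
    qed
    ultimately show "tdeg m \<le> 0" by (simp add: ab tdeg_def)
  qed
  moreover have "P \<in> I"
    using Suc.prems(2)[of 1] wterm_in_bernstein[of 0 0 "Suc k" 1] by (simp add: one_weyl_def[symmetric] tdeg_def)
  ultimately show ?case using wterm_const_in_proper_ideal[OF I] by blast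
qed

text \<open>Joseph's argument: left multiplication maps operators of degree at most \<open>k\<close>
  to linear maps from the degree \<open>k\<close> part of D/I to its degree \<open>2 * k\<close>
  part. If the bound failed, a nonzero operator would induce the zero map, contrary to
  faithfulness.\<close>

lemma bernstein_inequality:
  fixes I :: "'n::finite weyl set"
  assumes I: "left_ideal I" "1 \<notin> I"
  shows "card {m :: 'n exponent. tdeg m \<le> k} \<le> card (std_monoms I k) * card (std_monoms I (2 * k))"
proof (rule ccontr)
  note sub = left_ideal_subspace[OF I(1)]
  let ?A = "{m :: 'n exponent. tdeg m \<le> k}" and ?B = "std_monoms I k \<times> std_monoms I (2 * k)"
  assume "\<not> ?thesis"
  hence less: "card ?B < card ?A" by (simp add: card_cartesian_product)
  have "\<exists>S. S \<in> weyl.span (wmon ` std_monoms I (2 * k)) \<and> wmon m * wmon s - S \<in> I"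
    if "m \<in> ?A" "s \<in> std_monoms I k" for m s
  proof -
    have "wmon m * wmon s \<in> bernstein (k + k)"
      using that by (intro mult_bernstein wmon_in_bernstein) (auto simp: std_monoms_def)
    thus ?thesis
      using std_reduction[OF I(1), of _ "2 * k"] unfolding mult_2 by blast
  qed
  \<comment> \<open>For fixed \<open>m\<close>, the coefficients of the \<open>nf m s\<close> form
    the matrix of left multiplication by \<open>wmon m\<close> in terms of standard monomials. Each
    matrix position gives one linear condition on the coefficients \<open>x m\<close> of the
    operator \<open>P\<close>.\<close>
  then obtain nf where nf: "\<And>m s. m \<in> ?A \<Longrightarrow> s \<in> std_monoms I k \<Longrightarrow>
      nf m s \<in> weyl.span (wmon ` std_monoms I (2 * k)) \<and> wmon m * wmon s - nf m s \<in> I"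
    by metis
  obtain x where x: "\<exists>m\<in>?A. x m \<noteq> 0" "\<forall>b\<in>?B. (\<Sum>m\<in>?A. wcf (nf m (fst b)) (snd b) * x m) = 0"
    using homogeneous_system_solution[OF _ finite_tdeg_le less, of "\<lambda>m b. wcf (nf m (fst b)) (snd b)"]
    by (auto simp: finite_std_monoms)
  define P where "P = (\<Sum>m\<in>?A. wscale (x m) (wmon m))"
  have P_k: "P \<in> bernstein k"
    unfolding P_def by (rule weyl.subspace_sum[OF subspace_bernstein],
        rule weyl.subspace_scale[OF subspace_bernstein], rule wmon_in_bernstein) simp
  have std_mon: "P * wmon s \<in> I" if s: "s \<in> std_monoms I k" for s
  proof -
    have zero: "(\<Sum>m\<in>?A. wscale (x m) (nf m s)) = 0"
    proof (rule weyl_eqI)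
      fix t
      show "wcf (\<Sum>m\<in>?A. wscale (x m) (nf m s)) t = wcf 0 t"
      proof (cases "t \<in> std_monoms I (2 * k)")
        case True
        thus ?thesis
          using x(2)[rule_format, of "(s, t)"] s by (simp add: wcf_sum mult.commute)
      next
        case False
        hence "wcf (nf m s) t = 0" if "m \<in> ?A" for m
          using wsupp_span_wmon[of "nf m s"] nf[OF that s] wsupp_iff by blast
        thus ?thesis by (simp add: wcf_sum)
      qed
    qed
    have "P * wmon s = (\<Sum>m\<in>?A. wscale (x m) (wmon m * wmon s - nf m s))"
      using zero by (simp add: P_def sum_distrib_right wscale_mult_left weyl.scale_right_diff_distrib sum_subtractf)
    also have "\<dots> \<in> I"
      using nf s by (intro weyl.subspace_sum[OF sub] weyl.subspace_scale[OF sub]) blast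
    finally show ?thesis .
  qed
  have std: "P * S \<in> I" if "S \<in> weyl.span (wmon ` std_monoms I k)" for S
    using that
  proof (induction rule: weyl.span_induct_alt)
    case base
    show ?case using weyl.subspace_0[OF sub] by simp
  next
    case (step c y z)
    have "P * (wscale c y + z) = wscale c (P * y) + P * z"
      by (simp add: distrib_left wscale_mult_right)
    moreover have "P * y \<in> I" using step(1) std_mon by blast
    ultimately show ?case
      using step weyl.subspace_add[OF sub] weyl.subspace_scale[OF sub] by auto
  qed
  have "P = 0"
  proof (rule bernstein_action_faithful[OF I P_k])
    fix Q :: "'n weyl" assume "Q \<in> bernstein k"
    then obtain S where S: "S \<in> weyl.span (wmon ` std_monoms I k)" "Q - S \<in> I"
      using std_reduction[OF I(1)] by blast
    have "P * (Q - S) + P * S \<in> I"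
      by (intro weyl.subspace_add[OF sub] left_ideal_mult[OF I(1)] S std)
    thus "P * Q \<in> I" by (simp add: right_diff_distrib)
  qed
  moreover have "wcf P m = x m" if "m \<in> ?A" for m
    using that finite_tdeg_le[of k, where 'n = 'n]
    by (simp add: P_def wcf_sum wcf_wmon if_distrib cong: if_cong)
  ultimately show False using x(1) by force
qed

section \<open>The Hilbert polynomial\<close>

text \<open>Splitting off the value \<open>t\<close> of the exponent at a new index \<open>j\<close>
  leaves a sum of binomial coefficients, which the hockey-stick identity evaluates.\<close>

lemma exponents_with_support_count:
  fixes \<sigma> :: "'i::finite set"
  shows "finite {s :: 'i \<Rightarrow> nat. (\<forall>i. i \<notin> \<sigma> \<longrightarrow> s i = 0) \<and> (\<Sum>i\<in>UNIV. s i) \<le> k} \<and>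
    card {s :: 'i \<Rightarrow> nat. (\<forall>i. i \<notin> \<sigma> \<longrightarrow> s i = 0) \<and> (\<Sum>i\<in>UNIV. s i) \<le> k} = (k + card \<sigma>) choose card \<sigma>"
  using finite[of \<sigma>]
proof (induction \<sigma> arbitrary: k rule: finite_induct)
  case empty
  have "{s :: 'i \<Rightarrow> nat. (\<forall>i. i \<notin> {} \<longrightarrow> s i = 0) \<and> (\<Sum>i\<in>UNIV. s i) \<le> k} = {\<lambda>_. 0}"
    by auto
  thus ?case by simp
next
  case (insert j \<sigma>)
  let ?N = "\<lambda>\<sigma> k. {s :: 'i \<Rightarrow> nat. (\<forall>i. i \<notin> \<sigma> \<longrightarrow> s i = 0) \<and> (\<Sum>i\<in>UNIV. s i) \<le> k}"
  let ?S = "SIGMA t:{..k}. ?N \<sigma> (k - t)"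
  have sum_upd: "(\<Sum>i\<in>UNIV. (s(j := t)) i) + s j = (\<Sum>i\<in>UNIV. s i) + t" for s :: "'i \<Rightarrow> nat" and t
  proof -
    have 1: "(\<Sum>i\<in>UNIV. s i) = s j + (\<Sum>i\<in>UNIV - {j}. s i)"
      by (rule sum.remove) auto
    have 2: "(\<Sum>i\<in>UNIV. (s(j := t)) i) = (s(j := t)) j + (\<Sum>i\<in>UNIV - {j}. (s(j := t)) i)"
      by (rule sum.remove) auto
    have 3: "(\<Sum>i\<in>UNIV - {j}. (s(j := t)) i) = (\<Sum>i\<in>UNIV - {j}. s i)"
      by (rule sum.cong) auto
    show ?thesis using 1 2 3 by simp
  qed
  have bij: "bij_betw (\<lambda>(t, s). s(j := t)) ?S (?N (insert j \<sigma>) k)"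
  proof (rule bij_betw_byWitness[where f' = "\<lambda>s. (s j, s(j := 0))"])
    show "\<forall>a\<in>?S. (\<lambda>s. (s j, s(j := 0))) ((\<lambda>(t, s). s(j := t)) a) = a"
      using insert.hyps by (auto simp: fun_eq_iff)
    show "\<forall>a'\<in>?N (insert j \<sigma>) k. (\<lambda>(t, s). s(j := t)) ((\<lambda>s. (s j, s(j := 0))) a') = a'"
      by auto
    show "(\<lambda>(t, s). s(j := t)) ` ?S \<subseteq> ?N (insert j \<sigma>) k"
    proof (rule image_subsetI)
      fix x assume x: "x \<in> ?S"
      obtain t s where ts: "x = (t, s)" by (cases x)
      have s: "t \<in> {..k}" "\<forall>i. i \<notin> \<sigma> \<longrightarrow> s i = 0" "(\<Sum>i\<in>UNIV. s i) \<le> k - t"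
        using x by (simp_all add: ts)
      hence "s j = 0" using insert.hyps by simp
      hence "(\<Sum>i\<in>UNIV. (s(j := t)) i) \<le> k"
        using sum_upd[of s t] s by simp
      thus "(\<lambda>(t, s). s(j := t)) x \<in> ?N (insert j \<sigma>) k"
        using s(2) by (simp add: ts)
    qed
    show "(\<lambda>s. (s j, s(j := 0))) ` ?N (insert j \<sigma>) k \<subseteq> ?S"
    proof (rule image_subsetI)
      fix s assume s: "s \<in> ?N (insert j \<sigma>) k"
      have "s j \<le> (\<Sum>i\<in>UNIV. s i)" by (rule member_le_sum) auto
      thus "(s j, s(j := 0)) \<in> ?S"
        using s sum_upd[of s 0] by auto
    qed
  qed
  have fin: "finite (?N \<sigma> i)" and card: "card (?N \<sigma> i) = (i + card \<sigma>) choose card \<sigma>" for i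
    using insert.IH[of i] by auto
  have "finite ?S" using fin by (intro finite_SigmaI) auto
  hence "finite (?N (insert j \<sigma>) k)"
    using bij_betw_finite[OF bij] by simp
  moreover have "card (?N (insert j \<sigma>) k) = (\<Sum>t\<le>k. (k - t + card \<sigma>) choose card \<sigma>)"
  proof -
    have "card ?S = (\<Sum>t\<le>k. card (?N \<sigma> (k - t)))"
      using fin by (intro card_SigmaI) auto
    thus ?thesis
      using bij_betw_same_card[OF bij] by (simp only: card)
  qed
  moreover have "(\<Sum>t\<le>k. (k - t + card \<sigma>) choose card \<sigma>) = (\<Sum>t\<le>k. (t + card \<sigma>) choose card \<sigma>)"
    by (rule sum.reindex_bij_witness[where i = "\<lambda>t. k - t" and j = "\<lambda>t. k - t"]) auto
  moreover have "(\<Sum>t\<le>k. (t + m) choose m) = (k + Suc m) choose Suc m" for m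
    by (induction k) auto
  ultimately show ?case
    using insert.hyps by simp
qed

lemma binomial_is_poly: "\<exists>p :: real poly. \<forall>k. real ((k + m) choose m) = poly p (real k)"
proof (induction m)
  case 0
  show ?case by (intro exI[of _ 1]) simp
next
  case (Suc m)
  then obtain p :: "real poly" where p: "\<forall>k. real ((k + m) choose m) = poly p (real k)" by blast
  have "real ((k + Suc m) choose Suc m) = poly (smult (1 / real (Suc m)) ([:real (Suc m), 1:] * p)) (real k)" for k
  proof -
    have "Suc (k + m) * ((k + m) choose m) = ((k + Suc m) choose Suc m) * Suc m"
      using Suc_times_binomial_eq[of "k + m" m] by simp
    hence "real (Suc (k + m)) * real ((k + m) choose m) = real ((k + Suc m) choose Suc m) * real (Suc m)"
      by (metis of_nat_mult)
    thus ?thesis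
      using p by (simp add: field_simps)
  qed
  thus ?case by blast
qed

text \<open>
  By Dickson's lemma, membership in an upward closed set depends only on the capped
  exponent \<open>min x M\<close>, and each fibre of capping is a translated orthant.
\<close>

lemma down_set_count_is_poly:
  fixes U :: "('i::finite \<Rightarrow> nat) set"
  assumes up: "\<And>x y. x \<in> U \<Longrightarrow> x \<le> y \<Longrightarrow> y \<in> U"
  shows "\<exists>p :: real poly. \<forall>\<^sub>F k in sequentially.
    real (card {x. (\<Sum>i\<in>UNIV. x i) \<le> k \<and> x \<notin> U}) = poly p (real k)"
proof -
  obtain G where G: "finite G" "G \<subseteq> U" "\<And>x. x \<in> U \<Longrightarrow> \<exists>g\<in>G. g \<le> x"
    using dickson[of U] by auto
  define M where "M = (\<Sum>g\<in>G. \<Sum>i\<in>UNIV. g i)"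
  have M: "g i \<le> M" if "g \<in> G" for g i
  proof -
    have "g i \<le> (\<Sum>i\<in>UNIV. g i)" by (rule member_le_sum) auto
    also have "\<dots> \<le> M" unfolding M_def by (rule member_le_sum) (use that G(1) in auto)
    finally show ?thesis .
  qed
  define cap where "cap x = (\<lambda>i. min (x i) M)" for x :: "'i \<Rightarrow> nat"
  have cap_U: "cap x \<in> U \<longleftrightarrow> x \<in> U" for x
  proof
    assume "cap x \<in> U"
    moreover have "cap x \<le> x" by (simp add: cap_def le_fun_def)
    ultimately show "x \<in> U" by (rule up)
  next
    assume "x \<in> U"
    then obtain g where g: "g \<in> G" "g \<le> x" using G(3) by blast
    hence "g \<le> cap x" using M by (simp add: cap_def le_fun_def)
    moreover have "g \<in> U" using g G(2) by blast
    ultimately show "cap x \<in> U" using up by blast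
  qed
  define T where "T = {c. (\<forall>i. c i \<le> M) \<and> c \<notin> U}"
  have fin_T: "finite T"
  proof (rule finite_subset)
    show "T \<subseteq> PiE UNIV (\<lambda>_. {..M})" by (simp add: T_def PiE_iff subset_iff)
    show "finite (PiE (UNIV :: 'i set) (\<lambda>_. {..M}))" by (rule finite_PiE) simp_all
  qed
  define fib where "fib k c = {x. (\<Sum>i\<in>UNIV. x i) \<le> k \<and> cap x = c}" for k c
  \<comment> \<open>The coordinates at which \<open>c\<close> reaches the cap are the free
    directions of the orthant over \<open>c\<close>; the others are determined by
    \<open>c\<close>.\<close>
  define \<sigma> where "\<sigma> c = {i. c i = M}" for c :: "'i \<Rightarrow> nat"
  have union: "{x. (\<Sum>i\<in>UNIV. x i) \<le> k \<and> x \<notin> U} = (\<Union>c\<in>T. fib k c)" for k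
  proof -
    have "cap x \<in> T" if "x \<notin> U" for x
      unfolding T_def using that cap_U by (simp add: cap_def)
    moreover have "x \<notin> U" if "cap x \<in> T" for x
      using that cap_U[of x] by (simp add: T_def)
    ultimately show ?thesis
      unfolding fib_def by blast
  qed
  have fib_bij: "bij_betw (\<lambda>s i. c i + s i)
      {s. (\<forall>i. i \<notin> \<sigma> c \<longrightarrow> s i = 0) \<and> (\<Sum>i\<in>UNIV. s i) \<le> k - (\<Sum>i\<in>UNIV. c i)} (fib k c)"
    if c: "c \<in> T" and k: "k \<ge> (\<Sum>i\<in>UNIV. c i)" for k c
  proof (rule bij_betw_byWitness[where f' = "\<lambda>x i. x i - c i"])
    have cM: "c i \<le> M" for i using c by (simp add: T_def)
    show "(\<lambda>s i. c i + s i) ` {s. (\<forall>i. i \<notin> \<sigma> c \<longrightarrow> s i = 0) \<and> (\<Sum>i\<in>UNIV. s i) \<le> k - (\<Sum>i\<in>UNIV. c i)} \<subseteq> fib k c"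
    proof (rule image_subsetI)
      fix s assume s: "s \<in> {s. (\<forall>i. i \<notin> \<sigma> c \<longrightarrow> s i = 0) \<and> (\<Sum>i\<in>UNIV. s i) \<le> k - (\<Sum>i\<in>UNIV. c i)}"
      have "min (c i + s i) M = c i" for i
        using s cM[of i] by (cases "i \<in> \<sigma> c") (auto simp: \<sigma>_def)
      moreover have "(\<Sum>i\<in>UNIV. c i + s i) \<le> k"
        using s k by (auto simp: sum.distrib)
      ultimately show "(\<lambda>i. c i + s i) \<in> fib k c"
        by (simp add: fib_def cap_def)
    qed
    have fib: "c i \<le> x i" "i \<notin> \<sigma> c \<Longrightarrow> x i = c i" if "x \<in> fib k c" for x i
    proof -
      have "min (x i) M = c i"
        using that by (auto simp: fib_def cap_def)
      thus "c i \<le> x i" "i \<notin> \<sigma> c \<Longrightarrow> x i = c i"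
        by (auto simp: \<sigma>_def min_def split: if_splits)
    qed
    show "(\<lambda>x i. x i - c i) ` fib k c \<subseteq> {s. (\<forall>i. i \<notin> \<sigma> c \<longrightarrow> s i = 0) \<and> (\<Sum>i\<in>UNIV. s i) \<le> k - (\<Sum>i\<in>UNIV. c i)}"
    proof (rule image_subsetI)
      fix x assume x: "x \<in> fib k c"
      have "(\<Sum>i\<in>UNIV. x i - c i) = (\<Sum>i\<in>UNIV. x i) - (\<Sum>i\<in>UNIV. c i)"
        using fib(1)[OF x] by (intro sum_subtractf_nat) auto
      thus "(\<lambda>i. x i - c i) \<in> {s. (\<forall>i. i \<notin> \<sigma> c \<longrightarrow> s i = 0) \<and> (\<Sum>i\<in>UNIV. s i) \<le> k - (\<Sum>i\<in>UNIV. c i)}"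
        using x fib(2)[OF x] by (simp add: fib_def diff_le_mono)
    qed
    show "\<forall>a\<in>fib k c. (\<lambda>i. c i + (a i - c i)) = a"
      using fib(1) by simp
  qed auto
  have "\<exists>p :: real poly. \<forall>k\<ge>(\<Sum>i\<in>UNIV. c i). finite (fib k c) \<and> real (card (fib k c)) = poly p (real k)"
    if c: "c \<in> T" for c
  proof -
    let ?d = "\<Sum>i\<in>UNIV. c i"
    obtain q :: "real poly" where q: "\<forall>k. real ((k + card (\<sigma> c)) choose card (\<sigma> c)) = poly q (real k)"
      using binomial_is_poly by blast
    have "finite (fib k c) \<and> real (card (fib k c)) = poly (pcompose q [:- real ?d, 1:]) (real k)"
      if k: "k \<ge> ?d" for k
    proof -
      have "finite (fib k c)"
        using bij_betw_finite[OF fib_bij[OF c k]] exponents_with_support_count[of "\<sigma> c" "k - ?d"] by blast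
      moreover have "card (fib k c) = (k - ?d + card (\<sigma> c)) choose card (\<sigma> c)"
        using bij_betw_same_card[OF fib_bij[OF c k]] exponents_with_support_count[of "\<sigma> c" "k - ?d"] by metis
      hence "real (card (fib k c)) = poly q (real (k - ?d))"
        using q by (simp only:)
      ultimately show ?thesis
        using k by (simp add: poly_pcompose of_nat_diff)
    qed
    thus ?thesis by blast
  qed
  then obtain p :: "('i \<Rightarrow> nat) \<Rightarrow> real poly" where
    p: "\<And>c k. c \<in> T \<Longrightarrow> k \<ge> (\<Sum>i\<in>UNIV. c i) \<Longrightarrow> finite (fib k c) \<and> real (card (fib k c)) = poly (p c) (real k)"
    by metis
  \<comment> \<open>Beyond this threshold the subtraction \<open>k - (\<Sum>i\<in>UNIV. c i)\<close>
    is exact for every \<open>c\<close> in \<open>T\<close>, so all fibres follow their polynomials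
    simultaneously.\<close>
  have "real (card {x. (\<Sum>i\<in>UNIV. x i) \<le> k \<and> x \<notin> U}) = poly (\<Sum>c\<in>T. p c) (real k)"
    if k: "k \<ge> (\<Sum>c\<in>T. \<Sum>i\<in>UNIV. c i)" for k
  proof -
    have kc: "k \<ge> (\<Sum>i\<in>UNIV. c i)" if "c \<in> T" for c
      using k member_le_sum[OF that, of "\<lambda>c. \<Sum>i\<in>UNIV. c i"] fin_T by simp
    have "card {x. (\<Sum>i\<in>UNIV. x i) \<le> k \<and> x \<notin> U} = (\<Sum>c\<in>T. card (fib k c))"
      unfolding union using p kc by (intro card_UN_disjoint fin_T) (auto simp: fib_def)
    thus ?thesis
      using p kc by (simp add: poly_sum)
  qed
  thus ?thesis
    unfolding eventually_sequentially by blast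
qed

text \<open>Leading monomials are closed under adding exponents, so standard monomials are the
  complement of an upward closed set. The encoding \<open>h\<close> as functions on a disjoint sum
  turns total degree into the coordinate sum.\<close>

lemma hilbert_polynomial_exists:
  fixes I :: "'n::finite weyl set"
  assumes I: "left_ideal I"
  shows "\<exists>p :: real poly. \<forall>\<^sub>F k in sequentially. real (card (std_monoms I k)) = poly p (real k)"
proof -
  define h :: "'n exponent \<Rightarrow> 'n + 'n \<Rightarrow> nat" where
    "h m = case_sum (vec_nth (fst m)) (vec_nth (snd m))" for m
  define h' :: "('n + 'n \<Rightarrow> nat) \<Rightarrow> 'n exponent" where
    "h' x = (\<chi> i. x (Inl i), \<chi> i. x (Inr i))" for x
  have h': "h' (h m) = m" for m
    by (simp add: h_def h'_def)
  have h: "h (h' x) = x" for x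
    by (rule ext) (simp add: h_def h'_def split: sum.split)
  have sum_h: "(\<Sum>i\<in>UNIV. h m i) = tdeg m" for m
    by (simp add: h_def tdeg_def UNIV_Plus_UNIV[symmetric] sum.Plus del: UNIV_Plus_UNIV)
  let ?U = "h ` lead_monoms I"
  have "y \<in> ?U" if x: "x \<in> ?U" "x \<le> y" for x y
  proof -
    obtain m where m: "x = h m" "m \<in> lead_monoms I"
      using x(1) by (rule imageE)
    have "fst m $ i \<le> y (Inl i)" "snd m $ i \<le> y (Inr i)" for i
      using le_funD[OF x(2), of "Inl i"] le_funD[OF x(2), of "Inr i"] by (simp_all add: m(1) h_def)
    hence "h' y = h' (\<lambda>i. y i - x i) + m"
      by (simp add: m(1) h'_def prod_eq_iff vec_eq_iff h_def)
    moreover have "h' (\<lambda>i. y i - x i) + m \<in> lead_monoms I"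
      by (rule lead_monoms_add[OF I m(2)])
    ultimately have "h (h' y) \<in> ?U" by simp
    thus ?thesis by (simp only: h)
  qed
  then obtain p :: "real poly" where
    p: "\<forall>\<^sub>F k in sequentially. real (card {x. (\<Sum>i\<in>UNIV. x i) \<le> k \<and> x \<notin> ?U}) = poly p (real k)"
    using down_set_count_is_poly[of ?U] by blast
  have "bij_betw h (std_monoms I k) {x. (\<Sum>i\<in>UNIV. x i) \<le> k \<and> x \<notin> ?U}" for k
  proof (rule bij_betw_byWitness[where f' = h'])
    show "h ` std_monoms I k \<subseteq> {x. (\<Sum>i\<in>UNIV. x i) \<le> k \<and> x \<notin> ?U}"
    proof (rule image_subsetI)
      fix m assume m: "m \<in> std_monoms I k"
      have "h m \<notin> ?U"
      proof
        assume "h m \<in> ?U"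
        then obtain m' where m': "h m = h m'" "m' \<in> lead_monoms I" by (rule imageE)
        have "m = m'" using arg_cong[OF m'(1), of h'] by (simp only: h')
        thus False using m m'(2) by (simp add: std_monoms_def)
      qed
      thus "h m \<in> {x. (\<Sum>i\<in>UNIV. x i) \<le> k \<and> x \<notin> ?U}"
        using m by (simp add: sum_h std_monoms_def)
    qed
    show "h' ` {x. (\<Sum>i\<in>UNIV. x i) \<le> k \<and> x \<notin> ?U} \<subseteq> std_monoms I k"
    proof (rule image_subsetI)
      fix x assume x: "x \<in> {x. (\<Sum>i\<in>UNIV. x i) \<le> k \<and> x \<notin> ?U}"
      have "h' x \<notin> lead_monoms I"
      proof
        assume "h' x \<in> lead_monoms I"
        hence "h (h' x) \<in> ?U" by (rule imageI)
        thus False using x by (simp add: h)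
      qed
      thus "h' x \<in> std_monoms I k"
        using x sum_h[of "h' x"] by (simp add: std_monoms_def h)
    qed
  qed (simp_all add: h h')
  hence "card (std_monoms I k) = card {x. (\<Sum>i\<in>UNIV. x i) \<le> k \<and> x \<notin> ?U}" for k
    by (rule bij_betw_same_card)
  thus ?thesis using p by auto
qed

text \<open>The cube of exponents bounded by \<open>k\<close> in all \<open>2 * CARD('n)\<close>
  coordinates fits into this degree. The crude bound has the right order of growth, which is all
  that matters for degrees of polynomials.\<close>

lemma card_exponents_ge: "(k + 1) ^ (2 * CARD('n::finite)) \<le> card {m :: 'n exponent. tdeg m \<le> 2 * CARD('n) * k}"
proof -
  let ?B = "{a :: nat^'n. \<forall>i. a $ i \<le> (\<chi> i. k) $ i}"
  have "card ?B = (k + 1) ^ CARD('n)"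
    using bij_betw_same_card[OF bij_betw_le_vec[of "\<chi> i. k :: nat^'n"]] by (simp add: card_PiE Suc_eq_plus1)
  hence "(k + 1) ^ (2 * CARD('n)) = card (?B \<times> ?B)"
    by (simp add: card_cartesian_product power_add mult_2)
  also have "\<dots> \<le> card {m :: 'n exponent. tdeg m \<le> 2 * CARD('n) * k}"
  proof (rule card_mono[OF finite_tdeg_le])
    have vs: "vsum a \<le> CARD('n) * k" if "a \<in> ?B" for a :: "nat^'n"
      using sum_bounded_above[of UNIV "\<lambda>i. a $ i" k] that by simp
    have "tdeg (a, b) \<le> 2 * CARD('n) * k" if "a \<in> ?B" "b \<in> ?B" for a b :: "nat^'n"
      using add_mono[OF vs[OF that(1)] vs[OF that(2)]] by (simp add: tdeg_def)
    thus "?B \<times> ?B \<subseteq> {m :: 'n exponent. tdeg m \<le> 2 * CARD('n) * k}"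
      by blast
  qed
  finally show ?thesis .
qed

section \<open>Degree bounds for polynomials from their growth\<close>

lemma poly_eventually_nonneg_imp:
  fixes p :: "real poly"
  assumes "\<forall>\<^sub>F k in sequentially. poly p (real k) \<ge> 0" "p \<noteq> 0"
  shows "lead_coeff p > 0"
proof (rule ccontr)
  assume "\<not> ?thesis"
  hence neg: "lead_coeff (- p) > 0"
    using assms(2) by (simp add: not_less le_less)
  then obtain x0 where x0: "\<forall>x\<ge>x0. poly (- p) x \<ge> lead_coeff (- p)"
    using poly_pinfty_gt_lc by blast
  obtain N where N: "\<forall>k\<ge>N. poly p (real k) \<ge> 0"
    using assms(1) unfolding eventually_sequentially by blast
  define k where "k = max N (nat \<lceil>x0\<rceil>)"
  have "real k \<ge> x0" unfolding k_def by linarith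
  hence "poly (- p) (real k) > 0" using x0 neg by fastforce
  moreover have "poly p (real k) \<ge> 0" using N by (simp add: k_def)
  ultimately show False by simp
qed

text \<open>If the degree exceeded \<open>n\<close>, the difference between the bound and
  \<open>p\<close> would have a negative leading coefficient although it is eventually
  nonnegative.\<close>

lemma degree_le_of_growth:
  fixes p :: "real poly"
  assumes "\<forall>\<^sub>F k in sequentially. 0 \<le> poly p (real k) \<and> poly p (real k) \<le> C * (real k + 1) ^ n"
  shows "degree p \<le> n"
proof (rule ccontr)
  assume "\<not> ?thesis"
  hence deg: "n < degree p" by simp
  let ?q = "smult C ([:1, 1:] ^ n)"
  have deg_pow: "degree ([:1, 1:] ^ n :: real poly) = n" by (simp add: degree_power_eq)
  hence deg_q: "degree ?q < degree p" using deg degree_smult_le[of C "[:1, 1:] ^ n"] by linarith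
  have pos: "lead_coeff p > 0"
    using assms deg by (intro poly_eventually_nonneg_imp) (auto elim: eventually_mono)
  have "lead_coeff (?q - p) = - lead_coeff p"
  proof -
    have "degree (?q + - p) = degree p"
      using degree_add_eq_right[of ?q "- p"] deg_q by simp
    thus ?thesis using deg deg_pow by (simp add: coeff_eq_0)
  qed
  moreover have "lead_coeff (?q - p) > 0"
  proof (rule poly_eventually_nonneg_imp)
    show "\<forall>\<^sub>F k in sequentially. poly (?q - p) (real k) \<ge> 0"
      using assms by (rule eventually_mono) (simp add: add.commute)
    show "?q - p \<noteq> 0" using deg_q by auto
  qed
  ultimately show False using pos by simp
qed

text \<open>If the degree were below \<open>n\<close>, the product on the right would have degree
  below \<open>2 * n\<close>, and its difference to the left side would have leading coefficient
  \<open>- 1\<close>. The factors \<open>a\<close> and \<open>b\<close> accommodate the two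
  different arguments in Bernstein's inequality.\<close>

lemma degree_ge_of_growth:
  fixes p :: "real poly"
  assumes "a > 0" "b > 0"
    and "\<forall>\<^sub>F k in sequentially. (real k + 1) ^ (2 * n) \<le> poly p (real (a * k)) * poly p (real (b * k))"
  shows "n \<le> degree p"
proof (rule ccontr)
  assume "\<not> ?thesis"
  hence deg: "degree p < n" by simp
  let ?q = "pcompose p [:0, real a:] * pcompose p [:0, real b:]"
  have "degree ?q \<le> degree (pcompose p [:0, real a:]) + degree (pcompose p [:0, real b:])"
    by (rule degree_mult_le)
  also have "\<dots> = 2 * degree p"
    using assms(1,2) by (simp add: degree_pcompose)
  finally have deg_q: "degree ?q < 2 * n" using deg by simp
  let ?r = "[:1, 1:] ^ (2 * n) :: real poly"
  have deg_r: "degree ?r = 2 * n" by (simp add: degree_power_eq)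
  have "lead_coeff ?r = 1" by (simp add: lead_coeff_power)
  hence "lead_coeff (?q - ?r) = - 1"
  proof -
    have "degree (?q + - ?r) = degree ?r"
      using degree_add_eq_right[of ?q "- ?r"] deg_q deg_r by simp
    thus ?thesis using \<open>lead_coeff ?r = 1\<close> deg_q deg_r by (simp add: coeff_eq_0)
  qed
  moreover have "lead_coeff (?q - ?r) > 0"
  proof (rule poly_eventually_nonneg_imp)
    show "\<forall>\<^sub>F k in sequentially. poly (?q - ?r) (real k) \<ge> 0"
      using assms(3) by (rule eventually_mono) (simp add: poly_pcompose add.commute mult.commute)
    show "?q - ?r \<noteq> 0" using deg_q deg_r by auto
  qed
  ultimately show False by simp
qed

lemma holonomic_quotient_of_growth:
  fixes I :: "'n::finite weyl set"
  assumes I: "left_ideal I" and growth: "holonomic_growth I"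
  shows "holonomic_quotient I"
proof (cases "1 \<in> I")
  case True
  have "P \<in> I" for P using left_ideal_mult[OF I True, of P] by simp
  thus ?thesis by (auto simp: holonomic_quotient_def)
next
  case False
  let ?N = "\<lambda>k. card (std_monoms I k)"
  obtain p :: "real poly" where p: "\<forall>\<^sub>F k in sequentially. real (?N k) = poly p (real k)"
    using hilbert_polynomial_exists[OF I] by blast
  obtain C where C: "\<forall>k. ?N k \<le> C * (k + 1) ^ CARD('n)"
    using growth unfolding holonomic_growth_iff_std[OF I] by (rule exE)
  have "degree p \<le> CARD('n)"
  proof (rule degree_le_of_growth[where C = "real C"])
    have "real (?N k) \<le> real C * (real k + 1) ^ CARD('n)" for k
    proof -
      have "real (?N k) \<le> real (C * (k + 1) ^ CARD('n))" using C by (simp only: of_nat_le_iff)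
      thus ?thesis by (simp add: add.commute)
    qed
    thus "\<forall>\<^sub>F k in sequentially. 0 \<le> poly p (real k) \<and> poly p (real k) \<le> real C * (real k + 1) ^ CARD('n)"
      using p by (auto elim!: eventually_mono) (metis of_nat_0_le_iff)
  qed
  moreover have "CARD('n) \<le> degree p"
  \<comment> \<open>The cube of exponents up to \<open>k\<close> lies in degree
    \<open>2 * CARD('n) * k\<close>, and Bernstein's inequality pairs this degree with its
    double.\<close>
  proof (rule degree_ge_of_growth[where a = "2 * CARD('n)" and b = "4 * CARD('n)"])
    have "(k + 1) ^ (2 * CARD('n)) \<le> ?N (2 * CARD('n) * k) * ?N (4 * CARD('n) * k)" for k
      using card_exponents_ge[of k, where 'n = 'n] bernstein_inequality[OF I False, of "2 * CARD('n) * k"]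
      by (simp add: mult.assoc)
    hence le: "(real k + 1) ^ (2 * CARD('n)) \<le> real (?N (2 * CARD('n) * k)) * real (?N (4 * CARD('n) * k))" for k
      by (metis of_nat_le_iff of_nat_mult of_nat_power of_nat_add of_nat_1)
    obtain K where K: "\<And>k. k \<ge> K \<Longrightarrow> real (?N k) = poly p (real k)"
      using p unfolding eventually_sequentially by blast
    have "(real k + 1) ^ (2 * CARD('n)) \<le> poly p (real (2 * CARD('n) * k)) * poly p (real (4 * CARD('n) * k))"
      if k: "k \<ge> K" for k
    proof -
      have "1 \<le> 2 * CARD('n)" "1 \<le> 4 * CARD('n)"
        using zero_less_card_finite[where 'a = 'n] by linarith+
      hence "1 * k \<le> 2 * CARD('n) * k" "1 * k \<le> 4 * CARD('n) * k"
        by (simp_all only: mult_le_mono1)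
      hence "2 * CARD('n) * k \<ge> K" "4 * CARD('n) * k \<ge> K"
        using k unfolding mult_1 by linarith+
      thus ?thesis using le[of k] K by metis
    qed
    thus "\<forall>\<^sub>F k in sequentially. (real k + 1) ^ (2 * CARD('n))
        \<le> poly p (real (2 * CARD('n) * k)) * poly p (real (4 * CARD('n) * k))"
      unfolding eventually_sequentially by blast
  qed simp_all
  ultimately show ?thesis
    unfolding holonomic_quotient_def hilbert_function_eq_card[OF I] using p by (auto intro!: exI[of _ p])
qed

lemma holonomic_growth_of_quotient:
  fixes I :: "'n::finite weyl set"
  assumes I: "left_ideal I" and quot: "holonomic_quotient I"
  shows "holonomic_growth I"
proof (cases "I = UNIV")
  case True
  have "\<exists>S\<in>weyl.span {}. P - S \<in> I" for P :: "'n weyl"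
    using True by simp
  thus ?thesis
    unfolding holonomic_growth_def by (intro exI[of _ 0] allI exI[of _ "{}"]) auto
next
  case False
  let ?N = "\<lambda>k. card (std_monoms I k)"
  obtain p :: "real poly" where p: "degree p = CARD('n)"
    "\<forall>\<^sub>F k in sequentially. real (?N k) = poly p (real k)"
    using quot False unfolding holonomic_quotient_def hilbert_function_eq_card[OF I] by blast
  then obtain K where K: "\<And>k. k \<ge> K \<Longrightarrow> real (?N k) = poly p (real k)"
    unfolding eventually_sequentially by blast
  define B where "B = nat \<lceil>\<Sum>i\<le>degree p. \<bar>coeff p i\<bar>\<rceil>"
  \<comment> \<open>The second summand absorbs the finitely many values at which the Hilbert
    function may differ from its polynomial.\<close>
  define C where "C = B + (\<Sum>k<K. ?N k)"
  have "?N k \<le> C * (k + 1) ^ CARD('n)" for k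
  proof (cases "k < K")
    case True
    hence "?N k \<le> (\<Sum>k<K. ?N k)" by (intro member_le_sum) auto
    also have "\<dots> \<le> C" by (simp add: C_def)
    also have "\<dots> \<le> C * (k + 1) ^ CARD('n)" by simp
    finally show ?thesis .
  next
    case False
    hence "real (?N k) = (\<Sum>i\<le>degree p. coeff p i * real k ^ i)"
      using K by (simp add: poly_altdef)
    also have "\<dots> \<le> (\<Sum>i\<le>degree p. \<bar>coeff p i\<bar> * (real k + 1) ^ CARD('n))"
    proof (rule sum_mono)
      fix i assume i: "i \<in> {..degree p}"
      have "real k ^ i \<le> (real k + 1) ^ i" by (intro power_mono) auto
      also have "\<dots> \<le> (real k + 1) ^ CARD('n)" using i p(1) by (intro power_increasing) auto
      finally have "\<bar>coeff p i\<bar> * real k ^ i \<le> \<bar>coeff p i\<bar> * (real k + 1) ^ CARD('n)"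
        by (intro mult_left_mono) auto
      moreover have "coeff p i * real k ^ i \<le> \<bar>coeff p i\<bar> * real k ^ i"
        by (intro mult_right_mono) auto
      ultimately show "coeff p i * real k ^ i \<le> \<bar>coeff p i\<bar> * (real k + 1) ^ CARD('n)" by simp
    qed
    also have "\<dots> = (\<Sum>i\<le>degree p. \<bar>coeff p i\<bar>) * (real k + 1) ^ CARD('n)"
      by (simp add: sum_distrib_right)
    also have "\<dots> \<le> real C * (real k + 1) ^ CARD('n)"
    proof (intro mult_right_mono)
      have "(\<Sum>i\<le>degree p. \<bar>coeff p i\<bar>) \<le> real B" unfolding B_def by linarith
      moreover have "real B \<le> real C" by (simp only: C_def of_nat_le_iff le_add1)
      ultimately show "(\<Sum>i\<le>degree p. \<bar>coeff p i\<bar>) \<le> real C" by linarith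
    qed simp
    also have "\<dots> = real (C * (k + 1) ^ CARD('n))" by simp
    finally show ?thesis by (simp only: of_nat_le_iff)
  qed
  thus ?thesis
    unfolding holonomic_growth_iff_std[OF I] by blast
qed

section \<open>The A-hypergeometric ideal\<close>

text \<open>Fraction-free Gaussian elimination.\<close>

lemma integer_columns_dichotomy:
  fixes A :: "'d::finite \<Rightarrow> 'n \<Rightarrow> int"
  assumes "finite \<sigma>"
  shows "(\<exists>z. (\<exists>l\<in>\<sigma>. z l \<noteq> 0) \<and> (\<forall>i. (\<Sum>l\<in>\<sigma>. A i l * z l) = 0)) \<or>
    (\<exists>D \<eta>. D \<noteq> 0 \<and> (\<forall>l\<in>\<sigma>. \<forall>m\<in>\<sigma>. (\<Sum>i\<in>UNIV. \<eta> l i * A i m) = (if l = m then D else 0)))"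
  using assms
proof (induction rule: finite_induct)
  case empty
  show ?case by (intro disjI2 exI[of _ 1]) simp
next
  case (insert j \<sigma>)
  show ?case
  proof (cases "\<exists>z. (\<exists>l\<in>\<sigma>. z l \<noteq> 0) \<and> (\<forall>i. (\<Sum>l\<in>\<sigma>. A i l * z l) = 0)")
    case True
    then obtain z where z: "\<exists>l\<in>\<sigma>. z l \<noteq> 0" "\<forall>i. (\<Sum>l\<in>\<sigma>. A i l * z l) = 0"
      by (elim exE conjE) (rule that)
    define z' where "z' = z(j := 0)"
    have eq: "z' l = z l" if "l \<in> \<sigma>" for l using that insert.hyps by (auto simp: z'_def)
    have "(\<Sum>l\<in>insert j \<sigma>. A i l * z' l) = 0" for i
      using z(2) insert.hyps eq by (simp add: z'_def)
    moreover have "\<exists>l\<in>insert j \<sigma>. z' l \<noteq> 0" using z(1) eq by auto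
    ultimately show ?thesis by (intro disjI1 exI[of _ z'] conjI allI)
  next
    case False
    with insert.IH have "\<exists>D \<eta>. D \<noteq> 0 \<and>
        (\<forall>l\<in>\<sigma>. \<forall>m\<in>\<sigma>. (\<Sum>i\<in>UNIV. \<eta> l i * A i m) = (if l = m then D else 0))"
      unfolding disj_imp by (rule mp)
    then obtain D \<eta> where D: "D \<noteq> 0"
      and "\<forall>l\<in>\<sigma>. \<forall>m\<in>\<sigma>. (\<Sum>i\<in>UNIV. \<eta> l i * A i m) = (if l = m then D else 0)"
      by (elim exE conjE) (rule that)
    hence dual: "(\<Sum>i\<in>UNIV. \<eta> l i * A i m) = (if l = m then D else 0)" if "l \<in> \<sigma>" "m \<in> \<sigma>" for l m
      using that by simp
    define c where "c l = (\<Sum>i\<in>UNIV. \<eta> l i * A i j)" for l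
    \<comment> \<open>The remainder, scaled by \<open>D\<close>, of column \<open>j\<close> after
      subtracting the combination of the columns in \<open>\<sigma>\<close> suggested by the dual
      vectors. If it vanishes, \<open>D\<close> and the \<open>- c l\<close> form a
      relation.\<close>
    define r where "r i = D * A i j - (\<Sum>l\<in>\<sigma>. c l * A i l)" for i
    show ?thesis
    proof (cases "\<forall>i. r i = 0")
      case True
      define z where "z l = (if l = j then D else - c l)" for l
      have "(\<Sum>l\<in>insert j \<sigma>. A i l * z l) = 0" for i
      proof -
        have "(\<Sum>l\<in>\<sigma>. A i l * z l) = - (\<Sum>l\<in>\<sigma>. c l * A i l)"
          using insert.hyps unfolding sum_negf[symmetric] by (intro sum.cong) (auto simp: z_def)
        moreover have "A i j * z j = D * A i j" by (simp add: z_def)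
        moreover have "D * A i j - (\<Sum>l\<in>\<sigma>. c l * A i l) = 0" using True by (simp add: r_def)
        ultimately show ?thesis unfolding sum.insert[OF insert.hyps] by linarith
      qed
      moreover have "\<exists>l\<in>insert j \<sigma>. z l \<noteq> 0" using D by (auto simp: z_def)
      ultimately show ?thesis by (intro disjI1 exI[of _ z] conjI allI)
    next
      case False
      then obtain k where k: "r k \<noteq> 0" by blast
      \<comment> \<open>\<open>D\<close> times the \<open>k\<close>-th coordinate functional,
        corrected so as to vanish on the columns in \<open>\<sigma>\<close>. On column
        \<open>j\<close> it takes the nonzero value \<open>r k\<close>.\<close>
      define \<mu> where "\<mu> i = (if i = k then D else 0) - (\<Sum>l\<in>\<sigma>. A k l * \<eta> l i)" for i
      have \<mu>_dot: "(\<Sum>i\<in>UNIV. \<mu> i * A i m) = D * A k m - (\<Sum>l\<in>\<sigma>. A k l * (\<Sum>i\<in>UNIV. \<eta> l i * A i m))" for m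
      proof -
        have "(\<Sum>i\<in>UNIV. \<mu> i * A i m)
            = (\<Sum>i\<in>UNIV. (if i = k then D * A i m else 0) - (\<Sum>l\<in>\<sigma>. A k l * (\<eta> l i * A i m)))"
          by (rule sum.cong) (auto simp: \<mu>_def left_diff_distrib sum_distrib_right mult.assoc)
        also have "\<dots> = D * A k m - (\<Sum>i\<in>UNIV. \<Sum>l\<in>\<sigma>. A k l * (\<eta> l i * A i m))"
          by (simp add: sum_subtractf)
        also have "(\<Sum>i\<in>UNIV. \<Sum>l\<in>\<sigma>. A k l * (\<eta> l i * A i m)) = (\<Sum>l\<in>\<sigma>. A k l * (\<Sum>i\<in>UNIV. \<eta> l i * A i m))"
          by (subst sum.swap) (simp add: sum_distrib_left)
        finally show ?thesis .
      qed
      have \<mu>_\<sigma>: "(\<Sum>i\<in>UNIV. \<mu> i * A i m) = 0" if m: "m \<in> \<sigma>" for m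
      proof -
        have "(\<Sum>l\<in>\<sigma>. A k l * (\<Sum>i\<in>UNIV. \<eta> l i * A i m)) = (\<Sum>l\<in>\<sigma>. if l = m then A k l * D else 0)"
          using m by (intro sum.cong) (auto simp: dual)
        thus ?thesis
          unfolding \<mu>_dot using m insert.hyps by simp
      qed
      have \<mu>_j: "(\<Sum>i\<in>UNIV. \<mu> i * A i j) = r k"
        unfolding \<mu>_dot r_def c_def by (simp add: mult.commute)
      \<comment> \<open>The old dual vectors are scaled by \<open>r k\<close> and corrected by
        \<open>\<mu>\<close> to vanish on column \<open>j\<close>; the common diagonal value becomes
        \<open>D * r k\<close>.\<close>
      define \<eta>' where "\<eta>' l i = (if l = j then D * \<mu> i else r k * \<eta> l i - c l * \<mu> i)" for l i
      have "(\<Sum>i\<in>UNIV. \<eta>' l i * A i m) = (if l = m then D * r k else 0)"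
        if l: "l \<in> insert j \<sigma>" and m: "m \<in> insert j \<sigma>" for l m
      proof (cases "l = j")
        case True
        have "(\<Sum>i\<in>UNIV. \<eta>' l i * A i m) = D * (\<Sum>i\<in>UNIV. \<mu> i * A i m)"
          by (simp add: True \<eta>'_def sum_distrib_left mult.assoc)
        thus ?thesis
          using m True \<mu>_j \<mu>_\<sigma> insert.hyps by auto
      next
        case False
        have eq: "(\<Sum>i\<in>UNIV. \<eta>' l i * A i m)
            = r k * (\<Sum>i\<in>UNIV. \<eta> l i * A i m) - c l * (\<Sum>i\<in>UNIV. \<mu> i * A i m)"
          using False by (simp add: \<eta>'_def left_diff_distrib sum_subtractf sum_distrib_left mult.assoc)
        have l': "l \<in> \<sigma>" using l False by simp
        show ?thesis
        proof (cases "m = j")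
          case True
          thus ?thesis using False unfolding eq by (simp add: \<mu>_j c_def)
        next
          case m_ne: False
          hence "m \<in> \<sigma>" using m by simp
          thus ?thesis using l' unfolding eq by (simp add: \<mu>_\<sigma> dual)
        qed
      qed
      moreover have "D * r k \<noteq> 0" using D k by simp
      ultimately show ?thesis
        by (intro disjI2 exI[of _ "D * r k"] exI[of _ \<eta>'] conjI ballI)
    qed
  qed
qed

text \<open>Linear dependence over the rationals with denominators cleared, since exponents of a box
  operator are to be read off from the coefficients.\<close>

definition dependent_columns :: "int^'n^'d \<Rightarrow> 'n set \<Rightarrow> bool"
  where "dependent_columns A \<sigma> \<longleftrightarrow> (\<exists>z. (\<exists>l\<in>\<sigma>. z l \<noteq> 0) \<and> (\<forall>i. (\<Sum>l\<in>\<sigma>. A $ i $ l * z l) = 0))"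

text \<open>The positive and negative parts of an integer relation among the columns in
  \<open>\<sigma>\<close> serve as \<open>u\<close> and \<open>v\<close>.\<close>

lemma toric_relation:
  fixes A :: "int^'n::finite^'d::finite"
  assumes "dependent_columns A \<sigma>"
  shows "\<exists>u v. u \<noteq> v \<and> (\<forall>i. i \<notin> \<sigma> \<longrightarrow> u $ i = 0 \<and> v $ i = 0) \<and> A *v nat_vec_to_int u = A *v nat_vec_to_int v"
proof -
  obtain z where z: "\<exists>l\<in>\<sigma>. z l \<noteq> 0" "\<And>i. (\<Sum>l\<in>\<sigma>. A $ i $ l * z l) = 0"
    using assms unfolding dependent_columns_def by (elim exE conjE) (rule that, auto)
  define u :: "nat^'n" where "u = (\<chi> l. if l \<in> \<sigma> then nat (z l) else 0)"
  define v :: "nat^'n" where "v = (\<chi> l. if l \<in> \<sigma> then nat (- z l) else 0)"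
  obtain l where l: "l \<in> \<sigma>" "z l \<noteq> 0" using z(1) by blast
  have "u $ l \<noteq> v $ l" using l by (simp add: u_def v_def)
  hence "u \<noteq> v" by auto
  moreover have "(A *v nat_vec_to_int u) $ i = (A *v nat_vec_to_int v) $ i" for i
  proof -
    have "(A *v nat_vec_to_int u) $ i - (A *v nat_vec_to_int v) $ i
        = (\<Sum>l\<in>UNIV. A $ i $ l * (int (u $ l) - int (v $ l)))"
      by (simp add: matrix_vector_mult_def nat_vec_to_int_def right_diff_distrib sum_subtractf)
    also have "\<dots> = (\<Sum>l\<in>UNIV. if l \<in> \<sigma> then A $ i $ l * z l else 0)"
      by (rule sum.cong) (auto simp: u_def v_def)
    also have "\<dots> = 0" using z(2)[of i] by (simp add: sum.If_cases)
    finally show ?thesis by simp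
  qed
  ultimately show ?thesis
    by (intro exI[of _ u] exI[of _ v]) (simp add: vec_eq_iff u_def v_def)
qed

text \<open>\<open>\<eta>\<close> gives the coefficients of a combination of Euler operators in
  which, among the x_l d_l with \<open>l\<close> in \<open>\<sigma>\<close>, only the one for
  \<open>j\<close> survives.\<close>

lemma independent_columns_dual:
  fixes A :: "int^'n::finite^'d::finite"
  assumes "\<not> dependent_columns A \<sigma>" "j \<in> \<sigma>"
  shows "\<exists>\<eta> :: 'd \<Rightarrow> complex. \<forall>l\<in>\<sigma>. (\<Sum>i\<in>UNIV. \<eta> i * of_int (A $ i $ l)) = (if l = j then 1 else 0)"
proof -
  have "\<exists>D \<eta>. D \<noteq> 0 \<and> (\<forall>l\<in>\<sigma>. \<forall>m\<in>\<sigma>. (\<Sum>i\<in>UNIV. \<eta> l i * A $ i $ m) = (if l = m then D else 0))"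
    using integer_columns_dichotomy[OF finite[of \<sigma>], of "\<lambda>i l. A $ i $ l"] assms(1)
    unfolding dependent_columns_def disj_imp by (rule mp)
  then obtain D \<eta> where D: "D \<noteq> 0"
    "\<forall>l\<in>\<sigma>. \<forall>m\<in>\<sigma>. (\<Sum>i\<in>UNIV. \<eta> l i * A $ i $ m) = (if l = m then D else 0)"
    by (elim exE conjE) (rule that)
  have "(\<Sum>i\<in>UNIV. of_int (\<eta> j i) / of_int D * of_int (A $ i $ l)) = (if l = j then 1 else 0 :: complex)"
    if "l \<in> \<sigma>" for l
  proof -
    have "(\<Sum>i\<in>UNIV. of_int (\<eta> j i) / of_int D * of_int (A $ i $ l) :: complex)
        = of_int (\<Sum>i\<in>UNIV. \<eta> j i * A $ i $ l) / of_int D"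
      by (simp add: sum_divide_distrib)
    also have "\<dots> = (if l = j then 1 else 0)"
      using D(1) D(2)[rule_format, OF assms(2) that] by auto
    finally show ?thesis .
  qed
  thus ?thesis by (intro exI[of _ "\<lambda>i. of_int (\<eta> j i) / of_int D"] ballI)
qed

text \<open>Each \<open>z\<close> is read as the coefficient vector of a nonzero univariate
  polynomial. A positive integer that is no root of their product supplies the weights, namely its
  powers.\<close>

lemma separating_weight:
  fixes Z :: "('n::finite \<Rightarrow> int) set"
  assumes "finite Z" "\<And>z. z \<in> Z \<Longrightarrow> \<exists>i. z i \<noteq> 0"
  shows "\<exists>w :: 'n \<Rightarrow> nat. (\<forall>i. w i > 0) \<and> (\<forall>z\<in>Z. (\<Sum>i\<in>UNIV. z i * int (w i)) \<noteq> 0)"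
proof -
  define q where "q z = (\<Sum>i\<in>UNIV. monom (z i) (var_index i))" for z :: "'n \<Rightarrow> int"
  have inj: "var_index i = var_index j \<longleftrightarrow> i = j" for i j :: 'n
    using var_index(1) by (auto dest: injD)
  have coeff: "coeff (q z) (var_index i) = z i" for z i
    by (simp add: q_def coeff_sum inj)
  have "q z \<noteq> 0" if "z \<in> Z" for z
    using assms(2)[OF that] coeff by (metis coeff_0)
  hence "(\<Prod>z\<in>Z. q z) \<noteq> 0"
    using assms(1) by simp
  hence "finite {x. poly (\<Prod>z\<in>Z. q z) x = 0}" by (rule poly_roots_finite)
  moreover have "infinite {x :: int. x > 0}"
    by (simp add: infinite_Ioi flip: greaterThan_def)
  ultimately obtain x where x: "x > 0" "poly (\<Prod>z\<in>Z. q z) x \<noteq> 0"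
    using finite_subset[of "{x :: int. x > 0}" "{x. poly (\<Prod>z\<in>Z. q z) x = 0}"] by blast
  define w :: "'n \<Rightarrow> nat" where "w i = nat x ^ var_index i" for i
  have "(\<Sum>i\<in>UNIV. z i * int (w i)) \<noteq> 0" if "z \<in> Z" for z
  proof -
    have "(\<Sum>i\<in>UNIV. z i * int (w i)) = poly (q z) x"
      using x(1) by (simp add: q_def poly_sum poly_monom w_def)
    also have "\<dots> \<noteq> 0"
      using x(2) that assms(1) by (simp add: poly_prod)
    finally show ?thesis .
  qed
  moreover have "w i > 0" for i using x(1) by (simp add: w_def)
  ultimately show ?thesis by (intro exI[of _ w] conjI allI ballI)
qed

text \<open>
  A monomial \<open>x\<^sup>a \<partial>\<^sup>b\<close> with \<open>a\<^sub>j > 0\<close> and \<open>b\<^sub>j > M\<close> for some \<open>j\<close> is rewritten according to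
  \<open>\<sigma> = {l. b\<^sub>l \<ge> M}\<close>. If the columns in \<open>\<sigma>\<close> are dependent, then a box operator supported on
  \<open>\<sigma>\<close> lowers the weight. Otherwise a combination of the Euler operators expresses
  \<open>x\<^sub>j \<partial>\<^sub>j\<close> by the \<open>x\<^sub>l \<partial>\<^sub>l\<close> with \<open>l \<notin> \<sigma>\<close> and a constant; as each \<open>x\<^sub>l \<partial>\<^sub>l\<close> has
  weight \<open>K\<close>, this preserves the weight up to lower terms, and it increases the sum of
  the \<open>min b\<^sub>l M\<close>.
\<close>

lemma hypergeometric_ideal_growth:
  fixes A :: "int^'n::finite^'d::finite" and H :: "'n weyl set"
  assumes H: "left_ideal H"
    and box: "\<And>u v. A *v nat_vec_to_int u = A *v nat_vec_to_int v \<Longrightarrow> box_op u v \<in> H"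
    and euler: "\<And>i. euler_op A \<beta> i \<in> H"
  shows "holonomic_growth H"
proof -
  note sub = left_ideal_subspace[OF H]
  define rel where "rel \<sigma> p q \<longleftrightarrow> p \<noteq> q \<and> (\<forall>i. i \<notin> \<sigma> \<longrightarrow> p $ i = 0 \<and> q $ i = 0)
      \<and> A *v nat_vec_to_int p = A *v nat_vec_to_int q" for \<sigma> and p q :: "nat^'n"
  have "\<forall>\<sigma>. \<exists>p q. dependent_columns A \<sigma> \<longrightarrow> rel \<sigma> p q"
    using toric_relation unfolding rel_def by blast
  from choice[OF this] obtain u where "\<forall>\<sigma>. \<exists>q. dependent_columns A \<sigma> \<longrightarrow> rel \<sigma> (u \<sigma>) q"
    by (rule exE)
  from choice[OF this] obtain v where v: "\<forall>\<sigma>. dependent_columns A \<sigma> \<longrightarrow> rel \<sigma> (u \<sigma>) (v \<sigma>)"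
    by (rule exE)
  have uv: "u \<sigma> \<noteq> v \<sigma>" "i \<notin> \<sigma> \<Longrightarrow> u \<sigma> $ i = 0" "i \<notin> \<sigma> \<Longrightarrow> v \<sigma> $ i = 0"
      "A *v nat_vec_to_int (u \<sigma>) = A *v nat_vec_to_int (v \<sigma>)" if "dependent_columns A \<sigma>" for \<sigma> i
    using v[rule_format, OF that] unfolding rel_def by blast+
  \<comment> \<open>Bounds every exponent in the chosen box operators. If \<open>b\<close> is at
    least \<open>M\<close> on \<open>\<sigma>\<close>, then both terms of the operator for
    \<open>\<sigma>\<close> divide the derivative with exponent \<open>b\<close>.\<close>
  define M where "M = (\<Sum>\<sigma>\<in>UNIV. vsum (u \<sigma>) + vsum (v \<sigma>))"
  have uvM: "u \<sigma> $ i \<le> M" "v \<sigma> $ i \<le> M" for \<sigma> i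
  proof -
    have "u \<sigma> $ i \<le> vsum (u \<sigma>)" "v \<sigma> $ i \<le> vsum (v \<sigma>)"
      by (rule member_le_sum; simp)+
    moreover have "vsum (u \<sigma>) + vsum (v \<sigma>) \<le> M"
      unfolding M_def by (rule member_le_sum[of \<sigma> UNIV "\<lambda>\<sigma>. vsum (u \<sigma>) + vsum (v \<sigma>)"]) simp_all
    ultimately show "u \<sigma> $ i \<le> M" "v \<sigma> $ i \<le> M" by simp_all
  qed
  define Z where "Z = (\<lambda>\<sigma> i. int (u \<sigma> $ i) - int (v \<sigma> $ i)) ` {\<sigma>. dependent_columns A \<sigma>}"
  have nonzero: "\<exists>i. z i \<noteq> 0" if z: "z \<in> Z" for z
  proof -
    obtain \<sigma> where \<sigma>: "z = (\<lambda>i. int (u \<sigma> $ i) - int (v \<sigma> $ i))" "dependent_columns A \<sigma>"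
      using z unfolding Z_def by blast
    have "\<exists>i. u \<sigma> $ i \<noteq> v \<sigma> $ i" using uv(1)[OF \<sigma>(2)] by (simp add: vec_eq_iff)
    thus ?thesis by (simp add: \<sigma>(1))
  qed
  have "finite Z" by (simp add: Z_def)
  then obtain w :: "'n \<Rightarrow> nat" where
    "(\<forall>i. w i > 0) \<and> (\<forall>z\<in>Z. (\<Sum>i\<in>UNIV. z i * int (w i)) \<noteq> 0)"
    by (rule exE[OF separating_weight[OF _ nonzero]])
  hence w_pos: "w i > 0" and w_sep: "z \<in> Z \<Longrightarrow> (\<Sum>i\<in>UNIV. z i * int (w i)) \<noteq> 0" for i z
    by simp_all
  have w_sep': "(\<Sum>i\<in>UNIV. w i * u \<sigma> $ i) \<noteq> (\<Sum>i\<in>UNIV. w i * v \<sigma> $ i)" if "dependent_columns A \<sigma>" for \<sigma>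
  proof
    assume eq: "(\<Sum>i\<in>UNIV. w i * u \<sigma> $ i) = (\<Sum>i\<in>UNIV. w i * v \<sigma> $ i)"
    have "(\<Sum>i\<in>UNIV. (int (u \<sigma> $ i) - int (v \<sigma> $ i)) * int (w i))
        = int (\<Sum>i\<in>UNIV. w i * u \<sigma> $ i) - int (\<Sum>i\<in>UNIV. w i * v \<sigma> $ i)"
      by (simp add: algebra_simps sum_subtractf)
    hence "(\<Sum>i\<in>UNIV. (int (u \<sigma> $ i) - int (v \<sigma> $ i)) * int (w i)) = 0" using eq by simp
    moreover have "(\<lambda>i. int (u \<sigma> $ i) - int (v \<sigma> $ i)) \<in> Z" using that by (auto simp: Z_def)
    ultimately show False using w_sep by blast
  qed
  \<comment> \<open>The summand \<open>1\<close> makes each weight \<open>K - w i\<close> of a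
    variable positive, so that a bound on the weight bounds all exponents.\<close>
  define K where "K = (\<Sum>i\<in>UNIV. w i) + 1"
  have wK: "w i < K" for i
    using member_le_sum[of i UNIV w] by (simp add: K_def)
  define wt where "wt m = (\<Sum>i\<in>UNIV. (K - w i) * fst m $ i + w i * snd m $ i)" for m :: "'n exponent"
  define cap where "cap m = (\<Sum>i\<in>UNIV. min (snd m $ i) M)" for m :: "'n exponent"
  have wt_theta: "wt (a + axis l 1, b + axis l 1) = wt (a, b) + K" for a b l
  proof -
    have "wt (a + axis l 1, b + axis l 1)
        = (\<Sum>i\<in>UNIV. ((K - w i) * a $ i + w i * b $ i) + (if i = l then K else 0))"
      unfolding wt_def by (rule sum.cong) (use wK in \<open>auto simp: axis_def distrib_left less_imp_le\<close>)
    thus ?thesis by (simp add: wt_def sum.distrib)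
  qed
  have cap_le: "cap m \<le> CARD('n) * M" for m
    using sum_bounded_above[of UNIV "\<lambda>i. min (snd m $ i) M" M] by (simp add: cap_def)
  define irr where "irr t = {m. wt m \<le> t \<and> (\<forall>j. fst m $ j = 0 \<or> snd m $ j \<le> M)}" for t
  define Red where "Red t = {P. \<exists>S\<in>weyl.span (wmon ` irr t). P - S \<in> H}" for t
  have Red_H: "P \<in> Red t" if "P \<in> H" for P t
    unfolding Red_def using that weyl.span_zero[of "wmon ` irr t"] by (intro CollectI bexI[of _ 0]) auto
  have Red_add: "P + Q \<in> Red t" if "P \<in> Red t" "Q \<in> Red t" for P Q t
  proof -
    obtain S T where ST: "S \<in> weyl.span (wmon ` irr t)" "P - S \<in> H" "T \<in> weyl.span (wmon ` irr t)" "Q - T \<in> H"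
      using \<open>P \<in> Red t\<close> \<open>Q \<in> Red t\<close> unfolding Red_def by blast
    have "P + Q - (S + T) = (P - S) + (Q - T)" by simp
    hence "P + Q - (S + T) \<in> H" using weyl.subspace_add[OF sub ST(2,4)] by metis
    thus ?thesis
      unfolding Red_def using weyl.span_add[OF ST(1,3)] by blast
  qed
  have Red_scale: "wscale c P \<in> Red t" if "P \<in> Red t" for c P t
  proof -
    obtain S where S: "S \<in> weyl.span (wmon ` irr t)" "P - S \<in> H"
      using \<open>P \<in> Red t\<close> unfolding Red_def by blast
    have "wscale c P - wscale c S \<in> H"
      using weyl.subspace_scale[OF sub S(2), of c] by (simp add: weyl.scale_right_diff_distrib)
    thus ?thesis
      unfolding Red_def using weyl.span_scale[OF S(1)] by blast
  qed
  have Red_sum: "(\<Sum>x\<in>X. P x) \<in> Red t" if "\<And>x. x \<in> X \<Longrightarrow> P x \<in> Red t" for X t and P :: "'x \<Rightarrow> 'n weyl"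
    using that
  proof (induction X rule: infinite_finite_induct)
    case (insert x X)
    thus ?case by (simp add: Red_add)
  qed (simp_all add: Red_H weyl.subspace_0[OF sub])
  have Red_mono: "P \<in> Red t" if "P \<in> Red s" "s \<le> t" for P s t
  proof -
    have "irr s \<subseteq> irr t" using that(2) by (auto simp: irr_def)
    hence "weyl.span (wmon ` irr s) \<subseteq> weyl.span (wmon ` irr t)"
      by (intro weyl.span_mono image_mono)
    thus ?thesis using that(1) unfolding Red_def by blast
  qed
  have reduce: "wmon m \<in> Red (wt m)" for m
  \<comment> \<open>A lexicographic induction packed into one number: the weight comes before the
    distance of \<open>cap m\<close> from its maximum, and the factor
    \<open>CARD('n) * M + 1\<close> exceeds every such distance.\<close>
  proof (induction "wt m * (CARD('n) * M + 1) + (CARD('n) * M - cap m)" arbitrary: m rule: less_induct)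
    case less
    have IH: "wmon m' \<in> Red (wt m)" if "wt m' < wt m \<or> wt m' = wt m \<and> cap m' > cap m" for m'
    proof -
      have "wt m' * (CARD('n) * M + 1) + (CARD('n) * M - cap m') < wt m * (CARD('n) * M + 1) + (CARD('n) * M - cap m)"
      proof (cases "wt m' < wt m")
        case True
        hence "(wt m' + 1) * (CARD('n) * M + 1) \<le> wt m * (CARD('n) * M + 1)"
          by (intro mult_le_mono1) simp
        thus ?thesis by (simp add: distrib_right)
      next
        case False
        hence eq: "wt m' = wt m" and "cap m < cap m'" using that by simp_all
        hence "CARD('n) * M - cap m' < CARD('n) * M - cap m" using cap_le[of m'] by linarith
        thus ?thesis unfolding eq by (rule add_strict_left_mono)
      qed
      hence "wmon m' \<in> Red (wt m')" by (rule less.hyps)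
      moreover have "wt m' \<le> wt m" using that by linarith
      ultimately show ?thesis by (rule Red_mono)
    qed
    obtain a b where ab: "m = (a, b)" by (cases m)
    show ?case
    proof (cases "m \<in> irr (wt m)")
      case True
      hence "wmon m \<in> weyl.span (wmon ` irr (wt m))" by (intro weyl.span_base imageI)
      thus ?thesis
        unfolding Red_def using weyl.subspace_0[OF sub] by (intro CollectI bexI[of _ "wmon m"]) simp_all
    next
      case False
      then obtain j where j: "a $ j \<noteq> 0" "b $ j > M"
        by (auto simp: irr_def ab not_le)
      define \<sigma> where "\<sigma> = {l. b $ l \<ge> M}"
      show ?thesis
      proof (cases "dependent_columns A \<sigma>")
        case True
        define W where "W p = (\<Sum>i\<in>UNIV. w i * p $ i)" for p :: "nat^'n"
        \<comment> \<open>The term of larger weight is replaced by the one of smaller weight. Either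
          of \<open>u \<sigma>\<close> and \<open>v \<sigma>\<close> may be the heavier one, so the
          step is stated for both directions at once.\<close>
        have step: ?thesis
          if p: "\<And>i. p $ i \<le> b $ i" and Wpq: "W q < W p" and Apq: "A *v nat_vec_to_int p = A *v nat_vec_to_int q"
          for p q
        proof -
          have b: "b = (b - p) + p" using p by (simp add: vec_eq_iff)
          have "wterm 1 a (b - p) * box_op p q = wmon (a, b) - wmon (a, (b - p) + q)"
            by (simp add: box_op_def wd_pow_def right_diff_distrib wterm_mult_dpow wmon_def b[symmetric])
          hence "wmon (a, b) - wmon (a, (b - p) + q) \<in> H"
            using left_ideal_mult[OF H box[OF Apq]] by metis
          moreover have "wmon (a, (b - p) + q) \<in> Red (wt m)"
          proof (rule IH)
            have "wt (a, (b - p) + r) = (\<Sum>i\<in>UNIV. (K - w i) * a $ i + w i * (b - p) $ i) + W r" for r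
              by (simp add: wt_def W_def distrib_left sum.distrib)
            from this[of p] this[of q] have "wt (a, (b - p) + q) < wt (a, b)"
              using Wpq by (simp add: b[symmetric])
            thus "wt (a, (b - p) + q) < wt m \<or> wt (a, (b - p) + q) = wt m \<and> cap (a, (b - p) + q) > cap m"
              by (simp add: ab)
          qed
          ultimately show ?thesis
            using Red_add[OF Red_H, of "wmon (a, b) - wmon (a, (b - p) + q)" "wmon (a, (b - p) + q)"] by (simp add: ab)
        qed
        have le: "u \<sigma> $ i \<le> b $ i" "v \<sigma> $ i \<le> b $ i" for i
        proof -
          have "i \<in> \<sigma> \<Longrightarrow> M \<le> b $ i" by (simp add: \<sigma>_def)
          thus "u \<sigma> $ i \<le> b $ i" "v \<sigma> $ i \<le> b $ i"
            using uv(2,3)[OF True, of i] uvM[of \<sigma> i] by (cases "i \<in> \<sigma>"; simp)+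
        qed
        have "W (u \<sigma>) \<noteq> W (v \<sigma>)"
          using w_sep'[OF True] by (simp add: W_def)
        then consider "W (u \<sigma>) < W (v \<sigma>)" | "W (v \<sigma>) < W (u \<sigma>)" by linarith
        thus ?thesis
        proof cases
          case 1
          show ?thesis by (rule step[OF le(2) 1 uv(4)[OF True, symmetric]])
        next
          case 2
          show ?thesis by (rule step[OF le(1) 2 uv(4)[OF True]])
        qed
      next
        case False
        have "j \<in> \<sigma>" using j by (simp add: \<sigma>_def)
        obtain \<eta> :: "'d \<Rightarrow> complex" where
          "\<forall>l\<in>\<sigma>. (\<Sum>i\<in>UNIV. \<eta> i * of_int (A $ i $ l)) = (if l = j then 1 else 0)"
          using independent_columns_dual[OF False \<open>j \<in> \<sigma>\<close>] by (rule exE)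
        hence \<eta>: "(\<Sum>i\<in>UNIV. \<eta> i * of_int (A $ i $ l)) = (if l = j then 1 else 0)" if "l \<in> \<sigma>" for l
          using that by simp
        define c where "c l = (\<Sum>i\<in>UNIV. \<eta> i * of_int (A $ i $ l))" for l
        define a' where "a' = a - axis j 1"
        define b' where "b' = b - axis j 1"
        have a: "a = a' + axis j 1" and b: "b = b' + axis j 1"
          using j by (auto simp: a'_def b'_def vec_eq_iff axis_def)
        define T where "T l = wmon (a' + axis l 1, b' + axis l 1)" for l
        have euler_mult: "wmon (a', b') * euler_op A \<beta> i
            = (\<Sum>l\<in>UNIV. wscale (of_int (A $ i $ l)) (T l))
              + wscale ((\<Sum>l\<in>UNIV. of_int (A $ i $ l) * of_nat (b' $ l)) - \<beta> $ i) (wmon (a', b'))" for i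
        proof -
          have "wmon (a', b') * (wconst x * wx l * wd l)
              = wscale x (T l) + wscale (x * of_nat (b' $ l)) (wmon (a', b'))" for x l
          proof -
            have "wmon (a', b') * (wconst x * wx l * wd l) = wscale x (wmon (a', b') * (wx l * wd l))"
              by (simp add: wscale_mult_left wscale_mult_right mult.assoc flip: wscale_def)
            thus ?thesis
              by (simp add: wmon_def wterm_mult_theta weyl.scale_right_distrib wscale_wterm T_def)
          qed
          moreover have "wmon (a', b') * wconst x = wscale x (wmon (a', b'))" for x
            by (simp add: wscale_def wconst_central)
          ultimately show ?thesis
            by (simp add: euler_op_def right_diff_distrib sum_distrib_left sum.distrib
                weyl.scale_left_diff_distrib weyl.scale_sum_left)
        qed
        \<comment> \<open>Collects the multiples of the lower monomial that come from commuting
          derivatives past variables and from the parameters \<open>\<beta>\<close>.\<close>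
        define d where "d = (\<Sum>i\<in>UNIV. \<eta> i * ((\<Sum>l\<in>UNIV. of_int (A $ i $ l) * of_nat (b' $ l)) - \<beta> $ i))"
        have "(\<Sum>i\<in>UNIV. wscale (\<eta> i) (wmon (a', b') * euler_op A \<beta> i)) \<in> H"
          by (intro weyl.subspace_sum[OF sub] weyl.subspace_scale[OF sub] left_ideal_mult[OF H] euler)
        also have "(\<Sum>i\<in>UNIV. wscale (\<eta> i) (wmon (a', b') * euler_op A \<beta> i))
            = (\<Sum>l\<in>UNIV. wscale (c l) (T l)) + wscale d (wmon (a', b'))"
        proof -
          have "(\<Sum>i\<in>UNIV. wscale (\<eta> i) (\<Sum>l\<in>UNIV. wscale (of_int (A $ i $ l)) (T l)))
              = (\<Sum>i\<in>UNIV. \<Sum>l\<in>UNIV. wscale (\<eta> i * of_int (A $ i $ l)) (T l))"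
            by (simp add: weyl.scale_sum_right)
          also have "\<dots> = (\<Sum>l\<in>UNIV. wscale (c l) (T l))"
            by (subst sum.swap) (simp add: c_def weyl.scale_sum_left)
          finally show ?thesis
            by (simp add: euler_mult weyl.scale_right_distrib sum.distrib d_def weyl.scale_sum_left)
        qed
        finally have rel: "(\<Sum>l\<in>UNIV. wscale (c l) (T l)) + wscale d (wmon (a', b')) \<in> H" .
        have "(\<Sum>l\<in>UNIV. wscale (c l) (T l)) = wmon m + (\<Sum>l\<in>-\<sigma>. wscale (c l) (T l))"
        proof -
          have "(\<Sum>l\<in>UNIV. wscale (c l) (T l)) = (\<Sum>l\<in>\<sigma>. wscale (c l) (T l)) + (\<Sum>l\<in>-\<sigma>. wscale (c l) (T l))"
            using sum.union_disjoint[of \<sigma> "-\<sigma>" "\<lambda>l. wscale (c l) (T l)"] by simp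
          also have "(\<Sum>l\<in>\<sigma>. wscale (c l) (T l)) = (\<Sum>l\<in>\<sigma>. if l = j then T l else 0)"
            by (rule sum.cong) (auto simp: c_def \<eta>)
          also have "\<dots> = T j" using \<open>j \<in> \<sigma>\<close> by simp
          also have "T j = wmon m" by (simp add: T_def ab flip: a b)
          finally show ?thesis .
        qed
        hence eq: "wmon m = ((\<Sum>l\<in>UNIV. wscale (c l) (T l)) + wscale d (wmon (a', b')))
            + ((\<Sum>l\<in>-\<sigma>. wscale (- c l) (T l)) + wscale (- d) (wmon (a', b')))"
          by (simp add: sum_negf)
        have wt_m: "wt m = wt (a', b') + K"
          using wt_theta[of a' j b'] by (simp add: ab flip: a b)
        have "wmon (a', b') \<in> Red (wt m)"
          by (rule IH) (simp add: wt_m K_def)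
        moreover have "T l \<in> Red (wt m)" if l: "l \<in> - \<sigma>" for l
          unfolding T_def
        proof (rule IH)
          have bl: "b $ l < M" using l by (simp add: \<sigma>_def not_le)
          have "l \<noteq> j" using bl j by auto
          \<comment> \<open>The strict inequality \<open>b $ j > M\<close> matters: lowering the
            exponent at \<open>j\<close> by one leaves the minimum there at \<open>M\<close>. At
            \<open>l\<close> the exponent is below \<open>M\<close>, so the minimum grows by
            one.\<close>
          have "cap (a' + axis l 1, b' + axis l 1) = (\<Sum>i\<in>UNIV. min (b $ i) M + (if i = l then 1 else 0))"
            unfolding cap_def
          proof (rule sum.cong)
            fix i
            show "min (snd (a' + axis l 1, b' + axis l 1) $ i) M = min (b $ i) M + (if i = l then 1 else 0)"
              using bl j(2) \<open>l \<noteq> j\<close> by (cases "i = j"; cases "i = l") (auto simp: b'_def axis_def)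
          qed simp
          also have "\<dots> = cap m + 1" by (simp add: sum.distrib cap_def ab)
          finally have "cap m < cap (a' + axis l 1, b' + axis l 1)" by simp
          moreover have "wt (a' + axis l 1, b' + axis l 1) = wt m"
            by (simp only: wt_theta wt_m)
          ultimately show "wt (a' + axis l 1, b' + axis l 1) < wt m
              \<or> wt (a' + axis l 1, b' + axis l 1) = wt m \<and> cap (a' + axis l 1, b' + axis l 1) > cap m"
            by simp
        qed
        ultimately show ?thesis
          by (subst eq) (intro Red_add[OF Red_H[OF rel]] Red_add Red_sum Red_scale)
      qed
    qed
  qed
  \<comment> \<open>For each variable the pair of exponents lies in an L-shaped set of size linear
    in \<open>t\<close>: either the second entry is at most \<open>M\<close> or the first is
    \<open>0\<close>. This gives order \<open>CARD('n)\<close> in \<open>t\<close>, half of what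
    unrestricted pairs would give.\<close>
  have irr_card: "finite (irr t) \<and> card (irr t) \<le> ((t + 1) * (M + 2)) ^ CARD('n)" for t
  proof -
    let ?B = "{..t} \<times> {..M} \<union> {0} \<times> {..t}"
    define f where "f m = (\<lambda>i. (fst m $ i, snd m $ i))" for m :: "'n exponent"
    have inj: "inj f"
      by (rule injI) (simp add: f_def fun_eq_iff prod_eq_iff vec_eq_iff)
    have sub: "f ` irr t \<subseteq> PiE UNIV (\<lambda>_. ?B)"
    proof (rule image_subsetI)
      fix m assume m: "m \<in> irr t"
      have bound: "fst m $ i \<le> t \<and> snd m $ i \<le> t" for i
      proof -
        have "(K - w i) * fst m $ i + w i * snd m $ i \<le> wt m"
          unfolding wt_def by (rule member_le_sum[of i UNIV "\<lambda>i. (K - w i) * fst m $ i + w i * snd m $ i"]) simp_all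
        moreover have "1 * fst m $ i \<le> (K - w i) * fst m $ i" "1 * snd m $ i \<le> w i * snd m $ i"
          using wK[of i] w_pos[of i] by (intro mult_le_mono1; simp)+
        moreover have "wt m \<le> t" using m by (simp add: irr_def)
        ultimately show ?thesis unfolding mult_1 by linarith
      qed
      have "f m i \<in> ?B" for i
      proof -
        have "fst m $ i = 0 \<or> snd m $ i \<le> M" using m by (simp add: irr_def)
        thus ?thesis using bound[of i] by (auto simp: f_def)
      qed
      thus "f m \<in> PiE UNIV (\<lambda>_. ?B)" by (simp add: PiE_iff)
    qed
    have fin: "finite (PiE (UNIV :: 'n set) (\<lambda>_. ?B))" by (rule finite_PiE) simp_all
    have "finite (irr t)"
      using finite_subset[OF sub fin] inj by (simp add: finite_image_iff inj_on_subset)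
    moreover have "card (irr t) \<le> card (PiE (UNIV :: 'n set) (\<lambda>_. ?B))"
      using card_mono[OF fin sub] inj by (simp add: card_image inj_on_subset)
    moreover have "card (PiE (UNIV :: 'n set) (\<lambda>_. ?B)) = card ?B ^ CARD('n)"
      by (simp add: card_PiE)
    moreover have "card ?B \<le> (t + 1) * (M + 2)"
      using card_Un_le[of "{..t} \<times> {..M}" "{0} \<times> {..t}"] by (simp add: card_cartesian_product algebra_simps)
    ultimately show ?thesis
      using power_mono[of "card ?B" "(t + 1) * (M + 2)" "CARD('n)"] by linarith
  qed
  \<comment> \<open>No generator weighs more than \<open>K\<close>, so monomials of degree at most
    \<open>k\<close> have weight at most \<open>K * k\<close>. The irreducible monomials of this
    weight may have degree above \<open>k\<close>, as \<open>holonomic_growth\<close>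
    permits.\<close>
  have "finite (wmon ` irr (K * k)) \<and>
      card (wmon ` irr (K * k)) \<le> ((K + 1) * (M + 2)) ^ CARD('n) * (k + 1) ^ CARD('n) \<and>
      (\<forall>P\<in>bernstein k. \<exists>S\<in>weyl.span (wmon ` irr (K * k)). P - S \<in> H)" for k
  proof (intro conjI ballI)
    show "finite (wmon ` irr (K * k))" using irr_card by simp
    have "card (wmon ` irr (K * k)) \<le> card (irr (K * k))" using irr_card by (intro card_image_le) simp
    also have "\<dots> \<le> ((K * k + 1) * (M + 2)) ^ CARD('n)" using irr_card by simp
    also have "\<dots> \<le> ((K + 1) * (M + 2) * (k + 1)) ^ CARD('n)"
    proof (rule power_mono)
      have "(K * k + 1) * (M + 2) \<le> ((K + 1) * (k + 1)) * (M + 2)"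
        by (intro mult_le_mono1) (simp add: algebra_simps)
      thus "(K * k + 1) * (M + 2) \<le> (K + 1) * (M + 2) * (k + 1)" by (simp only: mult_ac)
    qed simp
    finally show "card (wmon ` irr (K * k)) \<le> ((K + 1) * (M + 2)) ^ CARD('n) * (k + 1) ^ CARD('n)"
      by (simp only: power_mult_distrib)
  next
    fix P :: "'n weyl" assume P: "P \<in> bernstein k"
    have "wmon m \<in> Red (K * k)" if m: "m \<in> wsupp P" for m
    proof (rule Red_mono[OF reduce])
      have "wt m \<le> (\<Sum>i\<in>UNIV. K * fst m $ i + K * snd m $ i)"
        unfolding wt_def using wK by (intro sum_mono add_mono mult_le_mono1) (auto simp: less_imp_le)
      also have "\<dots> = K * tdeg m"
        by (simp add: tdeg_def sum.distrib sum_distrib_left distrib_left)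
      also have "\<dots> \<le> K * k"
        using P m by (intro mult_le_mono2) (simp add: bernstein_iff)
      finally show "wt m \<le> K * k" .
    qed
    hence "P \<in> Red (K * k)"
      by (subst weyl_expansion_wmon) (intro Red_sum Red_scale)
    thus "\<exists>S\<in>weyl.span (wmon ` irr (K * k)). P - S \<in> H"
      by (simp add: Red_def)
  qed
  thus ?thesis
    unfolding holonomic_growth_def by (intro exI[of _ "((K + 1) * (M + 2)) ^ CARD('n)"] allI) (rule exI)
qed

section \<open>Solutions of incomplete A-hypergeometric systems\<close>

theorem theorem1:
  fixes A :: "int^'n::finite^'d::finite"
    and \<beta> :: "complex^'d"
    and V :: "'d \<Rightarrow> (complex^'n) set"
    and g :: "'d \<Rightarrow> 'n multifun"
    and U :: "(complex^'n) set"
    and f :: "'n multifun"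
  assumes columns_span: "\<forall>z :: int^'d. \<exists>c :: 'n \<Rightarrow> int. z = (\<Sum>j\<in>UNIV. c j *s column j A)"
    and g_holonomic: "\<forall>i. holonomic_function (V i) (g i)"
    and U_open: "zariski_open U"
    and f_holomorphic: "multivalued_holomorphic_on U f"
    and f_solution: "solves_incomplete_hypergeometric A \<beta> V g U f"
  shows "holonomic_function U f"
proof -
  let ?I = "annihilator U f"
  have I: "left_ideal ?I" by (rule left_ideal_annihilator[OF f_holomorphic])
  have "holonomic_growth ?I"
  proof (rule holonomic_growth_finite_extension[OF finite[of UNIV] I, where E = "euler_op A \<beta>"])
    fix i
    have g: "zariski_open (V i)" "multivalued_holomorphic_on (V i) (g i)"
      using g_holonomic by (auto simp: holonomic_function_def)
    obtain J where J: "left_ideal J" "holonomic_quotient J"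
      "\<forall>P\<in>J. multifun_eq_on (V i) (act_multi P (g i)) zero_multifun"
      using g_holonomic by (auto simp: holonomic_function_def)
    have "P * euler_op A \<beta> i \<in> ?I" if "P \<in> J" for P
    proof (rule annihilator_mult_right[OF f_holomorphic g(2) U_open g(1)])
      show "multifun_eq_on (U \<inter> V i) (act_multi (euler_op A \<beta> i) f) (g i)"
        using f_solution by (simp add: solves_incomplete_hypergeometric_def)
      show "P \<in> annihilator (V i) (g i)"
        using J(3) that by (simp add: annihilator_iff[OF g(2)])
    qed
    thus "\<exists>K. holonomic_growth K \<and> (\<forall>P\<in>K. P * euler_op A \<beta> i \<in> ?I)"
      using holonomic_growth_of_quotient[OF J(1,2)] by blast
  next
    fix H assume H: "left_ideal H" "?I \<subseteq> H" "\<forall>i\<in>UNIV. euler_op A \<beta> i \<in> H"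
    show "holonomic_growth H"
    proof (rule hypergeometric_ideal_growth[OF H(1), of A \<beta>])
      fix u v :: "nat^'n" assume "A *v nat_vec_to_int u = A *v nat_vec_to_int v"
      \<comment> \<open>The toric equations are homogeneous on all of \<open>U\<close>, so the box
        operators already annihilate \<open>f\<close>; only the Euler operators had to be
        adjoined.\<close>
      hence "box_op u v \<in> ?I"
        using f_solution by (simp add: solves_incomplete_hypergeometric_def annihilator_iff[OF f_holomorphic])
      thus "box_op u v \<in> H" using H(2) by blast
    next
      fix i show "euler_op A \<beta> i \<in> H" using H(3) by simp
    qed
  qed
  hence "holonomic_quotient ?I" by (rule holonomic_quotient_of_growth[OF I])
  moreover have "\<forall>P\<in>?I. multifun_eq_on U (act_multi P f) zero_multifun"
    by (simp add: annihilator_iff[OF f_holomorphic])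
  ultimately show ?thesis
    unfolding holonomic_function_def using U_open f_holomorphic I by blast
qed

end
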